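(* Let $\beta>0$, let $R^e=(R^e_\lambda,\lambda>0)$ be the resolvent of the elastic Brownian motion $B^e$ on $\mathbb{R}_+$ with parameter $\beta$, and let $R^N=(R^N_\lambda,\lambda>0)$ be the resolvent of the reflecting Brownian motion $|B|$ on $\mathbb{R}_+$. Then for all $f\in C_0(\mathbb{R}_+)$, $\lambda>0$, $x\in\mathbb{R}_+$, $$R^e_\lambda f(x)=R^N_\lambda f(x)-\frac{\beta}{\beta+\sqrt{2\lambda}}\,e^{-\sqrt{2\lambda}\,x}\,R^N_\lambda f(0).$$
   Context: Setting. $(\Omega,\mathcal{A})$ is a measurable space with probability measures $(P_x,\,x\in\mathbb{R})$ and a right continuous filtration $\mathcal{F}=(\mathcal{F}_t,\,t\ge0)$, complete with respect to $(P_x)$; $B=(B_t,\,t\ge0)$ is a standard one-dimensional Brownian motion relative to $\mathcal{F}$ with $P_x(B_0=x)=1$, equipped with shift operators $\theta_t:\Omega\to\Omega$ with $B_s\circ\theta_t=B_{s+t}$. $L=(L_t,\,t\ge0)$ is the local time of $B$ at $0$, normalized so that Tanaka's formula reads $d|B_t|=\operatorname{sign}(B_t)\,dB_t+dL_t$. All paths of $B$ and $L$ are continuous. Elastic Brownian motion. Let $P_\beta$ be the exponential law of rate $\beta$ on $\mathbb{R}_+=[0,+\infty)$, $S(s)=s$ the identity random variable on $\mathbb{R}_+$, and $\hat\Omega=\Omega\times\mathbb{R}_+$ with product $\sigma$-algebra and measures $\hat P_x=P_x\otimes P_\beta$. All random variables are extended trivially to $\hat\Omega$. Put $\zeta_\beta=\inf\{t\ge0:\,L_t>S\}$,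 and $B^e_t=|B_t|$ for $t<\zeta_\beta$, $B^e_t=\Delta$ for $t\ge\zeta_\beta$, where $\Delta$ is a cemetery point. Functions $f$ on $\mathbb{R}_+$ are extended by $f(\Delta)=0$. The resolvents are $R^e_\lambda f(x)=\hat E_x\bigl(\int_0^\infty e^{-\lambda t}f(B^e_t)\,dt\bigr)$ and $R^N_\lambda f(x)=E_x\bigl(\int_0^\infty e^{-\lambda t}f(|B_t|)\,dt\bigr)$. $C_0(\mathbb{R}_+)$ is the space of real continuous functions on $[0,+\infty)$ vanishing at infinity. *)

theory Defs
  imports "HOL-Probability.Probability"
begin

text \<open>
  Time is modelled by real numbers; only times \<open>t \<ge> 0\<close> matter.  As in the library, a
  \<open>\<sigma>\<close>-algebra on \<open>\<Omega>\<close> is represented by a measure of which only \<open>space\<close> and \<open>sets\<close>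
  are used (\<open>A\<close> for the ambient \<open>\<sigma>\<close>-algebra, \<open>F t\<close> for the filtration).  In the first
  assumption \<open>max 0\<close> makes the library's notion of a filtration speak about \<open>t \<ge> 0\<close> only.

  Completeness with respect to the whole family \<open>(P x)\<close> concerns the sets that are negligible
  for every \<open>P x\<close> simultaneously; the laws \<open>P x\<close> are mutually singular on \<open>B 0\<close>, so
  requiring all \<open>P x\<close>-negligible sets for each single \<open>x\<close> would put every subset of
  \<open>\<Omega>\<close> into \<open>F 0\<close>.
\<close>

locale brownian_family =
  fixes A :: "'w measure"
    and P :: "real \<Rightarrow> 'w measure"
    and F :: "real \<Rightarrow> 'w measure"
    and B :: "real \<Rightarrow> 'w \<Rightarrow> real"
    and \<theta> :: "real \<Rightarrow> 'w \<Rightarrow> 'w"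
  assumes filtration: "filtration (space A) (\<lambda>t. F (max 0 t))"
    and filtration_sub: "\<And>t. 0 \<le> t \<Longrightarrow> sets (F t) \<subseteq> sets A"
    and filtration_right_cont: "\<And>t. 0 \<le> t \<Longrightarrow> sets (F t) = (\<Inter>s\<in>{t<..}. sets (F s))"
    and filtration_complete: "\<And>t N. \<lbrakk>0 \<le> t; \<And>x. \<exists>Z\<in>null_sets (P x). N \<subseteq> Z\<rbrakk> \<Longrightarrow> N \<in> sets (F t)"
    and prob: "\<And>x. prob_space (P x)"
    and sets_prob: "\<And>x. sets (P x) = sets A"
    and adapted: "\<And>t. 0 \<le> t \<Longrightarrow> B t \<in> borel_measurable (F t)"
    and paths: "\<And>\<omega>. \<omega> \<in> space A \<Longrightarrow> continuous_on {0..} (\<lambda>t. B t \<omega>)"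
    and start: "\<And>x. measure (P x) {\<omega> \<in> space A. B 0 \<omega> = x} = 1"
    and normal_increments: "\<And>x s t. \<lbrakk>0 \<le> s; s < t\<rbrakk> \<Longrightarrow>
          distributed (P x) lborel (\<lambda>\<omega>. B t \<omega> - B s \<omega>) (normal_density 0 (sqrt (t - s)))"
    and indep_increments: "\<And>x s t. \<lbrakk>0 \<le> s; s < t\<rbrakk> \<Longrightarrow>
          prob_space.indep_set (P x) (sets (F s))
            {(\<lambda>\<omega>. B t \<omega> - B s \<omega>) -` U \<inter> space A | U. U \<in> sets borel}"
    and shift_space: "\<And>t \<omega>. \<lbrakk>0 \<le> t; \<omega> \<in> space A\<rbrakk> \<Longrightarrow> \<theta> t \<omega> \<in> space A"
    and shift: "\<And>s t \<omega>. \<lbrakk>0 \<le> s; 0 \<le> t; \<omega> \<in> space A\<rbrakk> \<Longrightarrow> B s (\<theta> t \<omega>) = B (s + t) \<omega>"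

text \<open>
  The Ito integral of square integrable integrands.  The triple \<open>(n, \<tau>, \<xi>)\<close> encodes the
  simple process that equals \<open>\<xi> i\<close> on \<open>(\<tau> i, \<tau> (i + 1)]\<close> for \<open>i < n\<close>.
\<close>

type_synonym 'w simple_proc = "nat \<times> (nat \<Rightarrow> real) \<times> (nat \<Rightarrow> 'w \<Rightarrow> real)"

definition simple_proc :: "(real \<Rightarrow> 'w measure) \<Rightarrow> 'w simple_proc \<Rightarrow> bool" where
  "simple_proc F = (\<lambda>(n, \<tau>, \<xi>). 0 \<le> \<tau> 0 \<and> (\<forall>i<n. \<tau> i \<le> \<tau> (Suc i)) \<and>
     (\<forall>i<n. \<xi> i \<in> borel_measurable (F (\<tau> i)) \<and> bounded (\<xi> i ` space (F (\<tau> i)))))"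

definition simple_proc_val :: "'w simple_proc \<Rightarrow> real \<Rightarrow> 'w \<Rightarrow> real" where
  "simple_proc_val = (\<lambda>(n, \<tau>, \<xi>) s \<omega>. \<Sum>i<n. \<xi> i \<omega> * indicator {\<tau> i<..\<tau> (Suc i)} s)"

definition simple_proc_integral ::
    "(real \<Rightarrow> 'w \<Rightarrow> real) \<Rightarrow> 'w simple_proc \<Rightarrow> real \<Rightarrow> 'w \<Rightarrow> real" where
  "simple_proc_integral X = (\<lambda>(n, \<tau>, \<xi>) t \<omega>.
     \<Sum>i<n. \<xi> i \<omega> * (X (min t (\<tau> (Suc i))) \<omega> - X (min t (\<tau> i)) \<omega>))"

text \<open>
  \<open>has_ito_integral M F B t H I\<close>: the random variable \<open>I\<close> is (a version of)
  \<open>\<integral>\<^sub>0\<^sup>t H\<^sub>s dB\<^sub>s\<close> under the law \<open>M\<close>, that is, the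
  \<open>L\<^sup>2(M)\<close>-limit of the integrals of simple processes approximating \<open>H\<close> in
  \<open>L\<^sup>2([0,t] \<times> \<Omega>)\<close>.
\<close>

definition has_ito_integral :: "'w measure \<Rightarrow> (real \<Rightarrow> 'w measure) \<Rightarrow> (real \<Rightarrow> 'w \<Rightarrow> real) \<Rightarrow>
    real \<Rightarrow> (real \<Rightarrow> 'w \<Rightarrow> real) \<Rightarrow> ('w \<Rightarrow> real) \<Rightarrow> bool" where
  "has_ito_integral M F B t H I \<longleftrightarrow>
     I \<in> borel_measurable M \<and>
     (\<forall>u\<in>{0..t}. (\<lambda>(s, \<omega>). H s \<omega>) \<in> borel_measurable (restrict_space borel {0..u} \<Otimes>\<^sub>M F u)) \<and>
     (\<exists>S. (\<forall>k. simple_proc F (S k)) \<and>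
        (\<lambda>k. \<integral>\<^sup>+\<omega>. (\<integral>\<^sup>+s\<in>{0..t}. ennreal ((simple_proc_val (S k) s \<omega> - H s \<omega>)\<^sup>2) \<partial>lborel) \<partial>M)
          \<longlonglongrightarrow> 0 \<and>
        (\<lambda>k. \<integral>\<^sup>+\<omega>. ennreal ((simple_proc_integral B (S k) t \<omega> - I \<omega>)\<^sup>2) \<partial>M) \<longlonglongrightarrow> 0)"

text \<open>
  The local time of \<open>B\<close> at \<open>0\<close>, given with its normalization by Tanaka's formula
  \<open>|B\<^sub>t| = |B\<^sub>0| + \<integral>\<^sub>0\<^sup>t sign(B\<^sub>s) dB\<^sub>s + L\<^sub>t\<close>.  Together with continuity this
  determines \<open>L\<close> up to indistinguishability.  The value of the sign at \<open>0\<close> is irrelevant for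
  the stochastic integral, because \<open>B\<close> spends zero Lebesgue time at \<open>0\<close>.
\<close>

definition local_time_at_0 :: "'w measure \<Rightarrow> (real \<Rightarrow> 'w measure) \<Rightarrow> (real \<Rightarrow> 'w measure) \<Rightarrow>
    (real \<Rightarrow> 'w \<Rightarrow> real) \<Rightarrow> (real \<Rightarrow> 'w \<Rightarrow> real) \<Rightarrow> bool" where
  "local_time_at_0 A P F B L \<longleftrightarrow>
     (\<forall>t\<ge>0. L t \<in> borel_measurable (F t)) \<and>
     (\<forall>\<omega>\<in>space A. continuous_on {0..} (\<lambda>t. L t \<omega>)) \<and>
     (\<forall>x. \<forall>t\<ge>0. \<exists>I. has_ito_integral (P x) F B t (\<lambda>s \<omega>. sgn (B s \<omega>)) I \<and>
        (AE \<omega> in P x. \<bar>B t \<omega>\<bar> = \<bar>B 0 \<omega>\<bar> + I \<omega> + L t \<omega>))"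

definition exp_law :: "real \<Rightarrow> real measure" where
  "exp_law \<beta> = restrict_space (density lborel (exponential_density \<beta>)) {0..}"

definition elastic_prob :: "(real \<Rightarrow> 'w measure) \<Rightarrow> real \<Rightarrow> real \<Rightarrow> ('w \<times> real) measure" where
  "elastic_prob P \<beta> x = P x \<Otimes>\<^sub>M exp_law \<beta>"

definition lifetime :: "(real \<Rightarrow> 'w \<Rightarrow> real) \<Rightarrow> 'w \<times> real \<Rightarrow> ereal" where
  "lifetime L = (\<lambda>(\<omega>, s). Inf {ereal t | t. 0 \<le> t \<and> L t \<omega> > s})"

definition reflecting_bm :: "(real \<Rightarrow> 'w \<Rightarrow> real) \<Rightarrow> real \<Rightarrow> 'w \<Rightarrow> real" where
  "reflecting_bm B t \<omega> = \<bar>B t \<omega>\<bar>"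

text \<open>The cemetery point is \<open>None\<close>.\<close>

definition elastic_bm :: "(real \<Rightarrow> 'w \<Rightarrow> real) \<Rightarrow> (real \<Rightarrow> 'w \<Rightarrow> real) \<Rightarrow>
    real \<Rightarrow> 'w \<times> real \<Rightarrow> real option" where
  "elastic_bm B L t \<omega>' =
     (if ereal t < lifetime L \<omega>' then Some (reflecting_bm B t (fst \<omega>')) else None)"

definition extend_cemetery :: "(real \<Rightarrow> real) \<Rightarrow> real option \<Rightarrow> real" where
  "extend_cemetery f = case_option 0 f"

definition resolvent :: "(real \<Rightarrow> 'w measure) \<Rightarrow> (real \<Rightarrow> 'w \<Rightarrow> 's) \<Rightarrow>
    real \<Rightarrow> ('s \<Rightarrow> real) \<Rightarrow> real \<Rightarrow> real" where
  "resolvent Q X \<alpha> f x =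
     (LINT \<omega>|Q x. (LINT t:{0..}|lborel. exp (- \<alpha> * t) * f (X t \<omega>)))"

definition elastic_resolvent :: "(real \<Rightarrow> 'w measure) \<Rightarrow> (real \<Rightarrow> 'w \<Rightarrow> real) \<Rightarrow>
    (real \<Rightarrow> 'w \<Rightarrow> real) \<Rightarrow> real \<Rightarrow> real \<Rightarrow> (real \<Rightarrow> real) \<Rightarrow> real \<Rightarrow> real" where
  "elastic_resolvent P B L \<beta> \<alpha> f =
     resolvent (elastic_prob P \<beta>) (elastic_bm B L) \<alpha> (extend_cemetery f)"

definition reflecting_resolvent :: "(real \<Rightarrow> 'w measure) \<Rightarrow> (real \<Rightarrow> 'w \<Rightarrow> real) \<Rightarrow>
    real \<Rightarrow> (real \<Rightarrow> real) \<Rightarrow> real \<Rightarrow> real" where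
  "reflecting_resolvent P B = resolvent P (reflecting_bm B)"

text \<open>Functions on \<open>[0,\<infinity>)\<close> are represented by functions on the reals whose values at
  negative arguments are never used.\<close>

definition C0_nonneg :: "(real \<Rightarrow> real) set" where
  "C0_nonneg = {f. continuous_on {0..} f \<and> (f \<longlongrightarrow> 0) at_top}"

end

(* Let v(x) be the claimed value of the elastic resolvent at x, as an even function on the line, and let
k = beta v(0). Then w = v - k |.| is twice continuously differentiable and w''/2 = alpha v - f(|.|).
Put D_t = exp (- alpha t - beta L_t). By Ito's formula for w(B) and Tanaka's formula for |B|, the drift of
D v(B) is (- alpha v + w''/2)(B) D dt = - D f(|B|) dt plus (k - beta v(B)) D dL, and the latter vanishes
because L grows only when B = 0. Hence E int D_t f(|B_t|) dt = v(x). Integrating out the exponential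
variable S turns the elastic resolvent into this expectation, and beta = 0 gives the reflecting one.

No stochastic calculus is needed beyond the isometry for simple integrands. On a grid, |B_t| - |B_s| minus
the Riemann sum of sgn(B) dB is nonnegative, vanishes if B has no zero in [s,t], and converges in L^2 to
L_t - L_s. This makes L increasing and flat off the zeros of B, and shows that L_t - L_s and |B_t| - |B_s|
have the same conditional mean given F_s. A Taylor expansion over a grid replaces Ito's formula, and the
limit of the remaining pathwise sums is taken by dominated convergence. *)

theory Submission
  imports Defs
begin

text \<open>The constant comes from matching a kink. With \<open>g = sqrt (2 * \<alpha>)\<close> and
  \<open>u\<close> the reflecting resolvent, the candidate is
  \<open>u + c * exp (- g * \<bar>y\<bar>)\<close>, the general even bounded solution of the
  equation off \<open>0\<close>. Its slope jumps at \<open>0\<close> by \<open>- 2 * c * g\<close>,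
  and the boundary condition \<open>- c * g = \<beta> * (u 0 + c)\<close> gives
  \<open>c = - \<beta> * u 0 / (\<beta> + g)\<close>. The obstacle is the form in which local time
  is given: Tanaka's formula holds for one time and one law at a time, outside a null set depending
  on both, and its stochastic integral is a bare \<open>L^2\<close> limit. Local time therefore
  enters through increments between deterministic times, and statements on whole paths are recovered
  from countably many times by continuity. On a step of length \<open>h\<close> the Taylor error is
  \<open>\<epsilon> * h + const * h^2\<close>, where \<open>\<epsilon>\<close> is a modulus of
  continuity of \<open>w''\<close>. Summed over \<open>{0..T}\<close> it becomes
  \<open>\<epsilon> * T + O(h)\<close>, so \<open>w''\<close> has to be uniformly continuous on the
  whole line; this is where the decay of \<open>f\<close> at infinity is used.\<close>

section \<open>Products and sums of square integrable functions\<close>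

lemma integrable_mult_L2:
  fixes f g :: "'a \<Rightarrow> real"
  assumes [measurable]: "f \<in> borel_measurable M" "g \<in> borel_measurable M"
    and "integrable M (\<lambda>x. (f x)\<^sup>2)" "integrable M (\<lambda>x. (g x)\<^sup>2)"
  shows "integrable M (\<lambda>x. f x * g x)"
proof (rule Bochner_Integration.integrable_bound)
  show "integrable M (\<lambda>x. (f x)\<^sup>2 + (g x)\<^sup>2)"
    using assms by simp
  have "\<bar>a * b\<bar> \<le> a\<^sup>2 + b\<^sup>2" for a b :: real
  proof -
    have "2 * (\<bar>a\<bar> * \<bar>b\<bar>) \<le> a\<^sup>2 + b\<^sup>2"
      using sum_squares_bound[of "\<bar>a\<bar>" "\<bar>b\<bar>"] by simp
    moreover have "0 \<le> \<bar>a\<bar> * \<bar>b\<bar>" by simp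
    ultimately show ?thesis unfolding abs_mult by linarith
  qed
  then show "AE x in M. norm (f x * g x) \<le> norm ((f x)\<^sup>2 + (g x)\<^sup>2)"
    by simp
qed simp

lemma integrable_add_L2:
  fixes f g :: "'a \<Rightarrow> real"
  assumes "f \<in> borel_measurable M" "g \<in> borel_measurable M"
    and "integrable M (\<lambda>x. (f x)\<^sup>2)" "integrable M (\<lambda>x. (g x)\<^sup>2)"
  shows "integrable M (\<lambda>x. (f x + g x)\<^sup>2)"
proof -
  have "(\<lambda>x. (f x + g x)\<^sup>2) = (\<lambda>x. (f x)\<^sup>2 + (g x)\<^sup>2 + 2 * (f x * g x))"
    by (auto simp: power2_sum)
  then show ?thesis
    using assms integrable_mult_L2[OF assms] by simp
qed

lemma integrable_diff_L2:
  fixes f g :: "'a \<Rightarrow> real"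
  assumes "f \<in> borel_measurable M" "g \<in> borel_measurable M"
    and "integrable M (\<lambda>x. (f x)\<^sup>2)" "integrable M (\<lambda>x. (g x)\<^sup>2)"
  shows "integrable M (\<lambda>x. (f x - g x)\<^sup>2)"
  using integrable_add_L2[of f M "\<lambda>x. - g x"] assms by simp

section \<open>Brownian increments\<close>

context brownian_family
begin

lemma space_P: "space (P x) = space A"
  by (rule sets_eq_imp_space_eq) (rule sets_prob)

lemma space_F: "0 \<le> t \<Longrightarrow> space (F t) = space A"
  using filtration.space_F[OF filtration, of t] by simp

lemma sets_F_mono: "0 \<le> s \<Longrightarrow> s \<le> t \<Longrightarrow> sets (F s) \<subseteq> sets (F t)"
  using filtration.sets_F_mono[OF filtration, of s t] by simp

lemma measurable_F_mono:
  assumes "f \<in> measurable (F s) N" "0 \<le> s" "s \<le> t"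
  shows "f \<in> measurable (F t) N"
  using assms sets_F_mono[of s t] space_F[of s] space_F[of t]
  by (auto simp: measurable_def)

lemma measurable_F_P:
  assumes "f \<in> measurable (F s) N" "0 \<le> s"
  shows "f \<in> measurable (P x) N"
  using assms filtration_sub[of s] space_F[of s] space_P sets_prob
  by (auto simp: measurable_def)

lemma B_F: "0 \<le> s \<Longrightarrow> s \<le> t \<Longrightarrow> B s \<in> borel_measurable (F t)"
  using measurable_F_mono[OF adapted] by simp

lemma B_P [measurable]: "0 \<le> s \<Longrightarrow> B s \<in> borel_measurable (P x)"
  using measurable_F_P[OF adapted] by simp

lemma AE_start: "AE \<omega> in P x. B 0 \<omega> = x"
proof -
  interpret prob_space "P x" by (rule prob)
  have "{\<omega> \<in> space A. B 0 \<omega> = x} \<in> events"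
    using B_P[of 0 x] unfolding space_P[of x, symmetric] by measurable
  then have "AE \<omega> in P x. \<omega> \<in> {\<omega> \<in> space A. B 0 \<omega> = x}"
    using start[of x] prob_eq_1 by blast
  then show ?thesis by (rule AE_mp) simp
qed

lemma indep_var_increment:
  fixes z :: "'w \<Rightarrow> real" and g :: "real \<Rightarrow> real"
  assumes st: "0 \<le> s" "s < t" and z: "z \<in> borel_measurable (F s)"
    and g: "g \<in> borel_measurable borel"
  shows "prob_space.indep_var (P x) borel z borel (\<lambda>\<omega>. g (B t \<omega> - B s \<omega>))"
proof -
  interpret prob_space "P x" by (rule prob)
  let ?ZZ = "{z -` U \<inter> space (P x) | U. U \<in> sets borel}" and ?BB = "{(\<lambda>\<omega>. B t \<omega> - B s \<omega>) -` U \<inter> space A | U. U \<in> sets borel}"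
  let ?GG = "{(\<lambda>\<omega>. g (B t \<omega> - B s \<omega>)) -` U \<inter> space (P x) | U. U \<in> sets borel}"
  have zP [measurable]: "random_variable borel z"
    using measurable_F_P[OF z] st by simp
  have dP [measurable]: "random_variable borel (\<lambda>\<omega>. B t \<omega> - B s \<omega>)"
    using st by simp
  have gP: "random_variable borel (\<lambda>\<omega>. g (B t \<omega> - B s \<omega>))"
    using measurable_compose[OF dP g] .
  have 1: "sigma_sets (space (P x)) ?ZZ \<subseteq> sets (F s)"
    unfolding space_P space_F[OF st(1), symmetric]
  proof (rule sets.sigma_sets_subset, rule subsetI)
    fix C assume "C \<in> {z -` U \<inter> space (F s) | U. U \<in> sets borel}"
    then obtain U where "C = z -` U \<inter> space (F s)" "U \<in> sets borel" by blast
    then show "C \<in> sets (F s)" using measurable_sets[OF z] by simp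
  qed
  have 2: "sigma_sets (space (P x)) ?GG
     = ?GG"
    using sets_vimage_algebra2[of "\<lambda>\<omega>. g (B t \<omega> - B s \<omega>)" "space (P x)" borel]
    unfolding sets_vimage_algebra space_borel by (metis Pi_UNIV UNIV_I)
  have 3: "?GG \<subseteq>
      ?BB"
  proof (rule subsetI)
    fix C assume "C \<in> ?GG"
    then obtain U where C: "C = (\<lambda>\<omega>. g (B t \<omega> - B s \<omega>)) -` U \<inter> space (P x)" "U \<in> sets borel"
      by blast
    then have "g -` U \<in> sets borel"
      using measurable_sets[OF g, of U] by simp
    moreover have "C = (\<lambda>\<omega>. B t \<omega> - B s \<omega>) -` (g -` U) \<inter> space A"
      using C(1) by (simp add: space_P vimage_def)
    ultimately show "C \<in> ?BB"
      by blast
  qed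
  have "indep_set (sigma_sets (space (P x)) ?ZZ)
     (sigma_sets (space (P x)) ?GG)"
    unfolding indep_sets2_eq
  proof (intro conjI ballI)
    note I = indep_increments[OF st, of x, unfolded indep_sets2_eq]
    show 4: "sigma_sets (space (P x)) ?ZZ \<subseteq> events"
      by (rule subset_trans[OF 1 I[THEN conjunct1]])
    show 5: "sigma_sets (space (P x)) ?GG \<subseteq> events"
      unfolding 2 by (rule subset_trans[OF 3 I[THEN conjunct2, THEN conjunct1]])
    fix a b
    assume a: "a \<in> sigma_sets (space (P x)) ?ZZ"
      and b: "b \<in> sigma_sets (space (P x)) ?GG"
    show "prob (a \<inter> b) = prob a * prob b"
      by (rule I[THEN conjunct2, THEN conjunct2, THEN bspec, THEN bspec,
            OF subsetD[OF 1 a] subsetD[OF 3 b[unfolded 2]]])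
  qed
  then show ?thesis
    unfolding indep_var_eq using zP gP by (intro conjI)
qed

lemma increment_power_integrable:
  assumes "0 \<le> s" "s \<le> t"
  shows "integrable (P x) (\<lambda>\<omega>. (B t \<omega> - B s \<omega>) ^ k)"
proof (cases "s = t")
  case True
  interpret prob_space "P x" by (rule prob)
  show ?thesis using True by simp
next
  case False
  then have st: "0 \<le> s" "s < t" using assms by auto
  have "integrable lborel (\<lambda>y. normal_density 0 (sqrt (t - s)) y * (y - 0) ^ k)"
    using st by (intro integrable_normal_moment) simp
  then show ?thesis
    using distributed_integrable[OF normal_increments[OF st, of x], of "\<lambda>y. y ^ k"] by simp
qed

text \<open>The fourth moment is there for the Taylor remainder: it is quadratic in
  \<open>t - s\<close>, so its sum over a grid vanishes with the mesh.\<close>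

lemma increment_moments:
  assumes "0 \<le> s" "s \<le> t"
  shows "(\<integral>\<omega>. B t \<omega> - B s \<omega> \<partial>P x) = 0"
    and "(\<integral>\<omega>. (B t \<omega> - B s \<omega>)\<^sup>2 \<partial>P x) = t - s"
    and "(\<integral>\<omega>. (B t \<omega> - B s \<omega>) ^ 4 \<partial>P x) = 3 * (t - s)\<^sup>2"
proof -
  have "(\<integral>\<omega>. B t \<omega> - B s \<omega> \<partial>P x) = 0 \<and> (\<integral>\<omega>. (B t \<omega> - B s \<omega>)\<^sup>2 \<partial>P x) = t - s \<and>
     (\<integral>\<omega>. (B t \<omega> - B s \<omega>) ^ 4 \<partial>P x) = 3 * (t - s)\<^sup>2"
  proof (cases "s = t")
    case False
    then have st: "0 \<le> s" "s < t" using assms by auto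
    then have p: "sqrt (t - s) > 0" by simp
    note D = distributed_integral[OF normal_increments[OF st, of x], symmetric]
    have "(LBINT y. normal_density 0 (sqrt (t - s)) y * y) = 0"
      using integral_normal_moment_nz_1[OF p, of 0] by simp
    moreover have "(LBINT y. normal_density 0 (sqrt (t - s)) y * y\<^sup>2) = t - s"
      using integral_normal_moment_even[OF p, of 0 1] st by (simp add: fact_numeral)
    moreover have "(LBINT y. normal_density 0 (sqrt (t - s)) y * y ^ 4) = 3 * (t - s)\<^sup>2"
      using integral_normal_moment_even[OF p, of 0 2] st by (simp add: fact_numeral power2_eq_square)
    ultimately show ?thesis
      using D[of "\<lambda>y. y"] D[of "\<lambda>y. y\<^sup>2"] D[of "\<lambda>y. y ^ 4"] by simp
  qed simp
  then show "(\<integral>\<omega>. B t \<omega> - B s \<omega> \<partial>P x) = 0" "(\<integral>\<omega>. (B t \<omega> - B s \<omega>)\<^sup>2 \<partial>P x) = t - s"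
    "(\<integral>\<omega>. (B t \<omega> - B s \<omega>) ^ 4 \<partial>P x) = 3 * (t - s)\<^sup>2" by auto
qed

lemma increment_mult:
  assumes "0 \<le> s" "s \<le> t" and z: "z \<in> borel_measurable (F s)" "integrable (P x) z" and "0 < k"
  shows "integrable (P x) (\<lambda>\<omega>. z \<omega> * (B t \<omega> - B s \<omega>) ^ k)"
    and "(\<integral>\<omega>. z \<omega> * (B t \<omega> - B s \<omega>) ^ k \<partial>P x) =
      (\<integral>\<omega>. z \<omega> \<partial>P x) * (\<integral>\<omega>. (B t \<omega> - B s \<omega>) ^ k \<partial>P x)"
proof -
  interpret prob_space "P x" by (rule prob)
  have "integrable (P x) (\<lambda>\<omega>. z \<omega> * (B t \<omega> - B s \<omega>) ^ k) \<and>
    (\<integral>\<omega>. z \<omega> * (B t \<omega> - B s \<omega>) ^ k \<partial>P x) =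
      (\<integral>\<omega>. z \<omega> \<partial>P x) * (\<integral>\<omega>. (B t \<omega> - B s \<omega>) ^ k \<partial>P x)"
  proof (cases "s = t")
    case False
    then have st: "0 \<le> s" "s < t" using assms by auto
    have iv: "indep_var borel z borel (\<lambda>\<omega>. (B t \<omega> - B s \<omega>) ^ k)"
      by (rule indep_var_increment[OF st z(1), where g = "\<lambda>y. y ^ k"]) simp
    note i = increment_power_integrable[of s t x k, OF assms(1,2)]
    show ?thesis
      using indep_var_lebesgue_integral[OF iv z(2) i] indep_var_integrable[OF iv z(2) i] by simp
  \<comment> \<open>Independence is available for \<open>s < t\<close> only; for
    \<open>s = t\<close> the positive power makes both sides vanish.\<close>
  qed (use \<open>0 < k\<close> in simp)
  then show "integrable (P x) (\<lambda>\<omega>. z \<omega> * (B t \<omega> - B s \<omega>) ^ k)"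
    "(\<integral>\<omega>. z \<omega> * (B t \<omega> - B s \<omega>) ^ k \<partial>P x) =
      (\<integral>\<omega>. z \<omega> \<partial>P x) * (\<integral>\<omega>. (B t \<omega> - B s \<omega>) ^ k \<partial>P x)" by auto
qed

lemma B_power2_integrable:
  assumes "0 \<le> t"
  shows "integrable (P x) (\<lambda>\<omega>. (B t \<omega>)\<^sup>2)"
proof -
  interpret prob_space "P x" by (rule prob)
  have "integrable (P x) (\<lambda>\<omega>. (B 0 \<omega>)\<^sup>2)"
    using AE_start[of x] by (intro integrable_const_bound[of _ "x\<^sup>2"]) auto
  then have "integrable (P x) (\<lambda>\<omega>. ((B t \<omega> - B 0 \<omega>) + B 0 \<omega>)\<^sup>2)"
    using assms increment_power_integrable[of 0 t x 2] by (intro integrable_add_L2) auto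
  then show ?thesis by simp
qed

lemma B_integrable:
  assumes "0 \<le> t"
  shows "integrable (P x) (B t)"
proof -
  interpret prob_space "P x" by (rule prob)
  show ?thesis
    using B_power2_integrable[OF assms, of x] assms by (intro square_integrable_imp_integrable[OF B_P]) auto
qed

text \<open>The increment from time \<open>0\<close> has a density and hence avoids
  \<open>- x\<close>. As \<open>sgn\<close> is discontinuous at \<open>0\<close> only, this is what
  lets sign sums converge.\<close>

lemma AE_B_nonzero:
  assumes "0 < t"
  shows "AE \<omega> in P x. B t \<omega> \<noteq> 0"
proof -
  interpret prob_space "P x" by (rule prob)
  note D = normal_increments[of 0 t x, simplified, OF assms]
  have "AE y in lborel. y \<noteq> - x"
    by (rule AE_lborel_singleton)
  then have "AE \<omega> in P x. B t \<omega> - B 0 \<omega> \<noteq> - x"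
    by (subst distributed_AE2[OF D]) auto
  with AE_start[of x] show ?thesis by eventually_elim auto
qed

end

section \<open>Bounded factors and products of interval indicators\<close>

lemma bounded_image_realE:
  fixes f :: "'a \<Rightarrow> real"
  assumes "bounded (f ` S)"
  obtains C where "0 \<le> C" "\<And>x. x \<in> S \<Longrightarrow> \<bar>f x\<bar> \<le> C"
proof -
  obtain C where "\<And>x. x \<in> S \<Longrightarrow> \<bar>f x\<bar> \<le> C"
    using assms unfolding bounded_iff by auto
  then have "\<bar>f x\<bar> \<le> max 0 C" if "x \<in> S" for x
    using that by fastforce
  then show thesis using that[of "max 0 C"] by simp
qed

lemma bounded_image_mult:
  fixes f g :: "'a \<Rightarrow> real"
  assumes "bounded (f ` S)" "bounded (g ` S)"
  shows "bounded ((\<lambda>x. f x * g x) ` S)"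
proof -
  obtain C where C: "0 \<le> C" "\<And>x. x \<in> S \<Longrightarrow> \<bar>f x\<bar> \<le> C"
    by (rule bounded_image_realE[OF assms(1)]) blast
  obtain D where D: "0 \<le> D" "\<And>x. x \<in> S \<Longrightarrow> \<bar>g x\<bar> \<le> D"
    by (rule bounded_image_realE[OF assms(2)]) blast
  show ?thesis
    unfolding bounded_iff using C D
    by (auto intro!: exI[of _ "C * D"] mult_mono simp: abs_mult)
qed

lemma integrable_bounded_mult:
  fixes f z :: "'a \<Rightarrow> real"
  assumes f: "f \<in> borel_measurable M" "bounded (f ` space M)" and z: "integrable M z"
  shows "integrable M (\<lambda>x. f x * z x)"
proof -
  obtain C where C: "0 \<le> C" "\<And>x. x \<in> space M \<Longrightarrow> \<bar>f x\<bar> \<le> C"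
    by (rule bounded_image_realE[OF f(2)]) blast
  show ?thesis
  proof (rule Bochner_Integration.integrable_bound)
    show "integrable M (\<lambda>x. C * z x)" using z by simp
    show "(\<lambda>x. f x * z x) \<in> borel_measurable M" using f z by simp
    show "AE x in M. norm (f x * z x) \<le> norm (C * z x)"
      using C by (intro AE_I2) (auto simp: abs_mult intro!: mult_right_mono)
  qed
qed

lemma LBINT_indicator_mult:
  "(LBINT s. indicator {a<..b} s * indicator {c<..d} s :: real) = measure lborel ({a<..b} \<inter> {c<..(d::real)})"
  "integrable lborel (\<lambda>s. indicator {a<..b} s * indicator {c<..d} s :: real)"
proof -
  have eq: "{a<..b} \<inter> {c<..d} = {max a c<..min b d}" by auto
  show "(LBINT s. indicator {a<..b} s * indicator {c<..d} s :: real) = measure lborel ({a<..b} \<inter> {c<..d})"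
    by (simp add: indicator_inter_arith[symmetric])
  show "integrable lborel (\<lambda>s. indicator {a<..b} s * indicator {c<..d} s :: real)"
    unfolding indicator_inter_arith[symmetric] eq
    by (cases "max a c \<le> min b d") (auto intro!: integrable_real_indicator)
qed

section \<open>Isometry for simple integrands\<close>

context brownian_family
begin

lemma integrable_bounded:
  assumes "\<xi> \<in> borel_measurable (P x)" "bounded (\<xi> ` space A)"
  shows "integrable (P x) (\<xi> :: 'w \<Rightarrow> real)"
proof -
  interpret prob_space "P x" by (rule prob)
  obtain C where "\<And>\<omega>. \<omega> \<in> space A \<Longrightarrow> \<bar>\<xi> \<omega>\<bar> \<le> C"
    by (rule bounded_image_realE[OF assms(2)]) blast
  then show ?thesis
    using assms(1) by (intro integrable_const_bound[of _ C]) (auto simp: space_P)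
qed

lemma increment_cov_aux:
  assumes "0 \<le> a" "a \<le> b" "a \<le> c" "c \<le> d"
    and \<xi>: "\<xi> \<in> borel_measurable (F a)" "bounded (\<xi> ` space A)"
    and \<eta>: "\<eta> \<in> borel_measurable (F c)" "bounded (\<eta> ` space A)"
  shows "(\<integral>\<omega>. (\<xi> \<omega> * (B b \<omega> - B a \<omega>)) * (\<eta> \<omega> * (B d \<omega> - B c \<omega>)) \<partial>P x) =
    (\<integral>\<omega>. \<xi> \<omega> * \<eta> \<omega> \<partial>P x) * measure lborel ({a<..b} \<inter> {c<..d})"
proof -
  interpret prob_space "P x" by (rule prob)
  have c0: "0 \<le> c" using assms by simp
  have \<xi>c: "\<xi> \<in> borel_measurable (F c)" using measurable_F_mono[OF \<xi>(1)] assms by simp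
  have \<xi>\<eta>: "(\<lambda>\<omega>. \<xi> \<omega> * \<eta> \<omega>) \<in> borel_measurable (F u)" if "c \<le> u" for u
    using measurable_F_mono[OF \<xi>c c0 that] measurable_F_mono[OF \<eta>(1) c0 that] by simp
  have bd: "bounded ((\<lambda>\<omega>. \<xi> \<omega> * \<eta> \<omega>) ` space A)"
    using bounded_image_mult[OF \<xi>(2) \<eta>(2)] .
  have inc: "integrable (P x) (\<lambda>\<omega>. B v \<omega> - B u \<omega>)" if "0 \<le> u" "u \<le> v" for u v
    using increment_power_integrable[OF that, of x 1] by simp
  have Z: "integrable (P x) (\<lambda>\<omega>. \<xi> \<omega> * \<eta> \<omega> * (B v \<omega> - B u \<omega>) * (B q \<omega> - B p \<omega>))"
    "(\<integral>\<omega>. \<xi> \<omega> * \<eta> \<omega> * (B v \<omega> - B u \<omega>) * (B q \<omega> - B p \<omega>) \<partial>P x) = 0"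
    if "0 \<le> u" "u \<le> v" "v \<le> p" "c \<le> p" "p \<le> q" for u v p q
  proof -
    have p: "0 \<le> p" using that by simp
    have m: "(\<lambda>\<omega>. \<xi> \<omega> * \<eta> \<omega> * (B v \<omega> - B u \<omega>)) \<in> borel_measurable (F p)"
      using \<xi>\<eta>[of p] that B_F[of u p] B_F[of v p] by simp
    have i: "integrable (P x) (\<lambda>\<omega>. \<xi> \<omega> * \<eta> \<omega> * (B v \<omega> - B u \<omega>))"
      using measurable_F_P[OF \<xi>\<eta>[of p] p] that bd inc[of u v]
      by (intro integrable_bounded_mult) (auto simp: space_P)
    show "integrable (P x) (\<lambda>\<omega>. \<xi> \<omega> * \<eta> \<omega> * (B v \<omega> - B u \<omega>) * (B q \<omega> - B p \<omega>))"
      using increment_mult(1)[OF p \<open>p \<le> q\<close> m i, of 1] by simp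
    show "(\<integral>\<omega>. \<xi> \<omega> * \<eta> \<omega> * (B v \<omega> - B u \<omega>) * (B q \<omega> - B p \<omega>) \<partial>P x) = 0"
      using increment_mult(2)[OF p \<open>p \<le> q\<close> m i, of 1] increment_moments(1)[OF p \<open>p \<le> q\<close>, of x]
      by simp
  qed
  show ?thesis
  proof (cases "b \<le> c")
    case True
    then have e: "{a<..b} \<inter> {c<..d} = {}" by auto
    show ?thesis
      using Z(2)[of a b c d] True assms unfolding e by (simp add: ac_simps)
  next
    case False
    \<comment> \<open>The product of the increments from \<open>c\<close> to \<open>b\<close> and
      from \<open>c\<close> to \<open>d\<close> is symmetric in \<open>b\<close> and
      \<open>d\<close>, so ordering them as \<open>p\<close> and \<open>q\<close> treats both cases
      at once.\<close>
    define p where "p = min b d"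
    define q where "q = max b d"
    have cp: "c \<le> p" "p \<le> q" "a \<le> c" using False assms by (auto simp: p_def q_def)
    have e: "{a<..b} \<inter> {c<..d} = {c<..p}" using assms by (auto simp: p_def)
    have bc: "integrable (P x) (\<lambda>\<omega>. \<xi> \<omega> * \<eta> \<omega>)"
      using measurable_F_P[OF \<xi>\<eta>[of c] c0] bd by (intro integrable_bounded) auto
    note S = increment_mult[OF c0 \<open>c \<le> p\<close> \<xi>\<eta>[OF order_refl] bc, of 2]
    have "(\<integral>\<omega>. (\<xi> \<omega> * (B b \<omega> - B a \<omega>)) * (\<eta> \<omega> * (B d \<omega> - B c \<omega>)) \<partial>P x) =
      (\<integral>\<omega>. \<xi> \<omega> * \<eta> \<omega> * (B c \<omega> - B a \<omega>) * (B d \<omega> - B c \<omega>) + (\<xi> \<omega> * \<eta> \<omega> * (B p \<omega> - B c \<omega>)\<^sup>2 +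
          \<xi> \<omega> * \<eta> \<omega> * (B p \<omega> - B c \<omega>) * (B q \<omega> - B p \<omega>)) \<partial>P x)"
      by (intro Bochner_Integration.integral_cong refl)
        (auto simp: p_def q_def min_def max_def algebra_simps power2_eq_square)
    also have "\<dots> = 0 + ((\<integral>\<omega>. \<xi> \<omega> * \<eta> \<omega> * (B p \<omega> - B c \<omega>)\<^sup>2 \<partial>P x) + 0)"
      using Z[of a c c d] Z[of c p p q] S(1) c0 cp assms by simp
    also have "\<dots> = (\<integral>\<omega>. \<xi> \<omega> * \<eta> \<omega> \<partial>P x) * (p - c)"
      using S(2) increment_moments(2)[OF c0 cp(1), of x] by simp
    finally show ?thesis
      using cp unfolding e by simp
  qed
qed

lemma increment_cov:
  assumes "0 \<le> a" "a \<le> b" "0 \<le> c" "c \<le> d"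
    and "\<xi> \<in> borel_measurable (F a)" "bounded (\<xi> ` space A)"
    and "\<eta> \<in> borel_measurable (F c)" "bounded (\<eta> ` space A)"
  shows "(\<integral>\<omega>. (\<xi> \<omega> * (B b \<omega> - B a \<omega>)) * (\<eta> \<omega> * (B d \<omega> - B c \<omega>)) \<partial>P x) =
    (\<integral>\<omega>. \<xi> \<omega> * \<eta> \<omega> \<partial>P x) * measure lborel ({a<..b} \<inter> {c<..d})"
proof (cases "a \<le> c")
  case True
  then show ?thesis using assms by (intro increment_cov_aux) auto
next
  case False
  then have "(\<integral>\<omega>. (\<eta> \<omega> * (B d \<omega> - B c \<omega>)) * (\<xi> \<omega> * (B b \<omega> - B a \<omega>)) \<partial>P x) =
    (\<integral>\<omega>. \<eta> \<omega> * \<xi> \<omega> \<partial>P x) * measure lborel ({c<..d} \<inter> {a<..b})"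
    using assms by (intro increment_cov_aux) auto
  then show ?thesis by (simp only: mult.commute Int_commute)
qed

text \<open>\<open>elem h J\<close>: \<open>h\<close> is a linear combination of bounded simple integrands, possibly with overlapping
  intervals, and \<open>J\<close> is its integral against \<open>B\<close>.\<close>

inductive elem :: "(real \<Rightarrow> 'w \<Rightarrow> real) \<Rightarrow> ('w \<Rightarrow> real) \<Rightarrow> bool" where
  zero: "elem (\<lambda>s \<omega>. 0) (\<lambda>\<omega>. 0)"
| step: "\<lbrakk>elem h J; 0 \<le> a; a \<le> b; \<xi> \<in> borel_measurable (F a); bounded (\<xi> ` space A)\<rbrakk> \<Longrightarrow>
    elem (\<lambda>s \<omega>. h s \<omega> + \<xi> \<omega> * indicator {a<..b} s) (\<lambda>\<omega>. J \<omega> + \<xi> \<omega> * (B b \<omega> - B a \<omega>))"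

lemma elem_add:
  assumes "elem h J" "elem h' J'"
  shows "elem (\<lambda>s \<omega>. h s \<omega> + h' s \<omega>) (\<lambda>\<omega>. J \<omega> + J' \<omega>)"
  using assms(2)
proof induction
  case zero
  then show ?case using assms(1) by simp
next
  case (step h' J' a b \<xi>)
  then show ?case
    using elem.step[of _ _ a b \<xi>] by (simp add: add.assoc[symmetric])
qed

lemma elem_uminus:
  assumes "elem h J"
  shows "elem (\<lambda>s \<omega>. - h s \<omega>) (\<lambda>\<omega>. - J \<omega>)"
  using assms
proof induction
  case zero
  then show ?case using elem.zero by simp
next
  case (step h J a b \<xi>)
  have "bounded ((\<lambda>\<omega>. - \<xi> \<omega>) ` space A)"
    using bounded_image_mult[OF step.hyps(5), of "\<lambda>_. - 1"] by (auto simp: bounded_iff)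
  then show ?case
    using elem.step[OF step.IH, of a b "\<lambda>\<omega>. - \<xi> \<omega>"] step.hyps by simp
qed

lemma elem_diff:
  assumes "elem h J" "elem h' J'"
  shows "elem (\<lambda>s \<omega>. h s \<omega> - h' s \<omega>) (\<lambda>\<omega>. J \<omega> - J' \<omega>)"
  using elem_add[OF assms(1) elem_uminus[OF assms(2)]] by simp

lemma elem_L2:
  assumes "elem h J"
  shows "J \<in> borel_measurable (P x)" "integrable (P x) (\<lambda>\<omega>. (J \<omega>)\<^sup>2)"
proof -
  interpret prob_space "P x" by (rule prob)
  have "J \<in> borel_measurable (P x) \<and> integrable (P x) (\<lambda>\<omega>. (J \<omega>)\<^sup>2)"
    using assms
  proof induction
    case (step h J a b \<xi>)
    have m: "\<xi> \<in> borel_measurable (P x)"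
      using measurable_F_P step.hyps by blast
    have m2: "(\<lambda>\<omega>. \<xi> \<omega> * (B b \<omega> - B a \<omega>)) \<in> borel_measurable (P x)"
      using m step.hyps by simp
    have "bounded ((\<lambda>\<omega>. \<xi> \<omega> * \<xi> \<omega>) ` space (P x))"
      using bounded_image_mult[OF step.hyps(5) step.hyps(5)] by (simp add: space_P)
    then have "integrable (P x) (\<lambda>\<omega>. \<xi> \<omega> * \<xi> \<omega> * (B b \<omega> - B a \<omega>)\<^sup>2)"
      using m increment_power_integrable[of a b x 2] step.hyps by (intro integrable_bounded_mult) auto
    then have "integrable (P x) (\<lambda>\<omega>. (\<xi> \<omega> * (B b \<omega> - B a \<omega>))\<^sup>2)"
      by (simp add: power2_eq_square ac_simps)
    then show ?case
      using step.IH m2 integrable_add_L2[of J "P x" "\<lambda>\<omega>. \<xi> \<omega> * (B b \<omega> - B a \<omega>)"]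
        borel_measurable_add[of J "P x" "\<lambda>\<omega>. \<xi> \<omega> * (B b \<omega> - B a \<omega>)"] by blast
  qed simp
  then show "J \<in> borel_measurable (P x)" "integrable (P x) (\<lambda>\<omega>. (J \<omega>)\<^sup>2)" by auto
qed

text \<open>This is the mixed term in the isometry when one more summand is attached to an
  integrand. Both sides are linear in \<open>h\<close>, so induction reduces it to the covariance of
  two weighted increments. The integral over \<open>s\<close> stays inside for each \<omega>, where
  it is a finite sum of interval lengths, so neither Fubini nor joint measurability enters.\<close>

lemma elem_cross:
  assumes "elem h J" and ab: "0 \<le> a" "a \<le> b"
    and \<xi>: "\<xi> \<in> borel_measurable (F a)" "bounded (\<xi> ` space A)"
  shows "integrable lborel (\<lambda>s. h s \<omega> * indicator {a<..b} s)" (is ?i1)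
    and "integrable (P x) (\<lambda>\<omega>. \<xi> \<omega> * (LBINT s. h s \<omega> * indicator {a<..b} s))" (is ?i2)
    and "(\<integral>\<omega>. J \<omega> * (\<xi> \<omega> * (B b \<omega> - B a \<omega>)) \<partial>P x) =
      (\<integral>\<omega>. \<xi> \<omega> * (LBINT s. h s \<omega> * indicator {a<..b} s) \<partial>P x)" (is ?e)
proof -
  interpret prob_space "P x" by (rule prob)
  have \<xi>P: "\<xi> \<in> borel_measurable (P x)"
    using measurable_F_P[OF \<xi>(1) ab(1)] .
  have el: "elem (\<lambda>s \<omega>. 0 + \<xi> \<omega> * indicator {a<..b} s) (\<lambda>\<omega>. 0 + \<xi> \<omega> * (B b \<omega> - B a \<omega>))"
    by (rule elem.step[OF elem.zero ab \<xi>])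
  note X = elem_L2[OF el, of x, simplified]
  have "(\<forall>\<omega>. integrable lborel (\<lambda>s. h s \<omega> * indicator {a<..b} s)) \<and> ?i2 \<and> ?e"
    using assms(1)
  proof induction
    case (step h J c d \<eta>)
    let ?i = "\<lambda>h \<omega>. LBINT s. h s \<omega> * indicator {a<..b} s"
    let ?h = "\<lambda>\<omega>. LBINT s. (h s \<omega> + \<eta> \<omega> * indicator {c<..d} s) * indicator {a<..b} s"
    have \<eta>P: "\<eta> \<in> borel_measurable (P x)"
      using measurable_F_P[OF step.hyps(4,2)] .
    have el': "elem (\<lambda>s \<omega>. 0 + \<eta> \<omega> * indicator {c<..d} s) (\<lambda>\<omega>. 0 + \<eta> \<omega> * (B d \<omega> - B c \<omega>))"
      using step.hyps by (intro elem.step elem.zero)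
    note Y = elem_L2[OF el', of x, simplified] and U = elem_L2[OF step.hyps(1), of x]
    note IH = step.IH
    have s1: "integrable lborel (\<lambda>s. \<eta> \<omega> * (indicator {c<..d} s * indicator {a<..b} s))" for \<omega>
      using LBINT_indicator_mult(2) by simp
    have eq: "(\<lambda>s. (h s \<omega> + \<eta> \<omega> * indicator {c<..d} s) * indicator {a<..b} s) =
      (\<lambda>s. h s \<omega> * indicator {a<..b} s + \<eta> \<omega> * (indicator {c<..d} s * indicator {a<..b} s))" for \<omega>
      by (simp add: algebra_simps)
    have 1: "\<forall>\<omega>. integrable lborel (\<lambda>s. (h s \<omega> + \<eta> \<omega> * indicator {c<..d} s) * indicator {a<..b} s)"
      unfolding eq using Bochner_Integration.integrable_add[OF _ s1] IH by blast
    let ?m = "measure lborel ({a<..b} \<inter> {c<..d})"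
    have eq2: "\<xi> \<omega> * (?h \<omega>) =
      \<xi> \<omega> * (?i h \<omega>) + \<xi> \<omega> * \<eta> \<omega> * ?m" for \<omega>
      unfolding eq using IH s1 by (simp add: LBINT_indicator_mult Int_commute algebra_simps)
    have b: "integrable (P x) (\<lambda>\<omega>. \<xi> \<omega> * \<eta> \<omega>)"
      using bounded_image_mult[OF \<xi>(2) step.hyps(5)] \<xi>P \<eta>P by (intro integrable_bounded) auto
    have 2: "integrable (P x) (\<lambda>\<omega>. \<xi> \<omega> * (?h \<omega>))"
      unfolding eq2 using IH b by simp
    have "(\<integral>\<omega>. (J \<omega> + \<eta> \<omega> * (B d \<omega> - B c \<omega>)) * (\<xi> \<omega> * (B b \<omega> - B a \<omega>)) \<partial>P x) =
      (\<integral>\<omega>. J \<omega> * (\<xi> \<omega> * (B b \<omega> - B a \<omega>)) + (\<xi> \<omega> * (B b \<omega> - B a \<omega>)) * (\<eta> \<omega> * (B d \<omega> - B c \<omega>)) \<partial>P x)"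
      by (simp add: algebra_simps)
    also have "\<dots> = (\<integral>\<omega>. J \<omega> * (\<xi> \<omega> * (B b \<omega> - B a \<omega>)) \<partial>P x) +
      (\<integral>\<omega>. (\<xi> \<omega> * (B b \<omega> - B a \<omega>)) * (\<eta> \<omega> * (B d \<omega> - B c \<omega>)) \<partial>P x)"
      by (rule Bochner_Integration.integral_add[OF integrable_mult_L2[OF U(1) X(1) U(2) X(2)] integrable_mult_L2[OF X(1) Y(1) X(2) Y(2)]])
    also have "\<dots> = (\<integral>\<omega>. \<xi> \<omega> * (?i h \<omega>) \<partial>P x) + (\<integral>\<omega>. \<xi> \<omega> * \<eta> \<omega> \<partial>P x) * ?m"
      using IH increment_cov[OF ab step.hyps(2,3) \<xi> step.hyps(4,5)] by simp
    also have "\<dots> = (\<integral>\<omega>. \<xi> \<omega> * (?h \<omega>) \<partial>P x)"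
      unfolding eq2 using IH b by simp
    finally show ?case using 1 2 by blast
  qed simp
  then show ?i1 ?i2 ?e by auto
qed

text \<open>The squares of \<open>J + D\<close> and of the enlarged integrand are expanded along the
  induction; the mixed terms agree by \<open>elem_cross\<close>, the new squares by the covariance
  of an increment with itself. The result is put in terms of nonnegative integrals because the
  definition of the Ito integral is phrased with them.\<close>

lemma elem_isometry:
  assumes "elem h J"
  shows "(\<integral>\<^sup>+\<omega>. ennreal ((J \<omega>)\<^sup>2) \<partial>P x) = (\<integral>\<^sup>+\<omega>. (\<integral>\<^sup>+s. ennreal ((h s \<omega>)\<^sup>2) \<partial>lborel) \<partial>P x)"
proof -
  interpret prob_space "P x" by (rule prob)
  have "(\<forall>\<omega>. integrable lborel (\<lambda>s. (h s \<omega>)\<^sup>2)) \<and> integrable (P x) (\<lambda>\<omega>. LBINT s. (h s \<omega>)\<^sup>2) \<and>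
      (\<integral>\<omega>. (J \<omega>)\<^sup>2 \<partial>P x) = (\<integral>\<omega>. (LBINT s. (h s \<omega>)\<^sup>2) \<partial>P x)" (is "?P h J")
    using assms
  proof induction
    case (step h J a b \<xi>)
    let ?i = "\<lambda>\<omega>. LBINT s. h s \<omega> * indicator {a<..b} s"
    let ?h = "\<lambda>\<omega>. LBINT s. (h s \<omega> + \<xi> \<omega> * indicator {a<..b} s)\<^sup>2"
    note IH = step.IH
    note C = elem_cross[OF step.hyps]
    have \<xi>P: "\<xi> \<in> borel_measurable (P x)"
      using measurable_F_P[OF step.hyps(4,2)] .
    have el': "elem (\<lambda>s \<omega>. 0 + \<xi> \<omega> * indicator {a<..b} s) (\<lambda>\<omega>. 0 + \<xi> \<omega> * (B b \<omega> - B a \<omega>))"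
      using step.hyps by (intro elem.step elem.zero)
    note Y = elem_L2[OF el', of x, simplified] and U = elem_L2[OF step.hyps(1), of x]
    let ?m = "measure lborel ({a<..b} \<inter> {a<..b})"
    have s1: "integrable lborel (\<lambda>s. (\<xi> \<omega>)\<^sup>2 * (indicator {a<..b} s * indicator {a<..b} s))" for \<omega>
      using LBINT_indicator_mult(2) by simp
    have s2: "integrable lborel (\<lambda>s. 2 * \<xi> \<omega> * (h s \<omega> * indicator {a<..b} s))" for \<omega>
      using C(1)[of \<omega>] by simp
    have eq: "(\<lambda>s. (h s \<omega> + \<xi> \<omega> * indicator {a<..b} s)\<^sup>2) =
      (\<lambda>s. (h s \<omega>)\<^sup>2 + (2 * \<xi> \<omega> * (h s \<omega> * indicator {a<..b} s) +
         (\<xi> \<omega>)\<^sup>2 * (indicator {a<..b} s * indicator {a<..b} s)))" for \<omega>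
      by (simp add: algebra_simps power2_eq_square)
    have 1: "\<forall>\<omega>. integrable lborel (\<lambda>s. (h s \<omega> + \<xi> \<omega> * indicator {a<..b} s)\<^sup>2)"
      unfolding eq using Bochner_Integration.integrable_add[OF _ Bochner_Integration.integrable_add[OF s2 s1]] IH
      by blast
    have eq2: "(?h \<omega>) =
      (LBINT s. (h s \<omega>)\<^sup>2) + (2 * (\<xi> \<omega> * (?i \<omega>)) + (\<xi> \<omega> * \<xi> \<omega>) * ?m)" for \<omega>
    proof -
      have "(?h \<omega>) =
        (LBINT s. (h s \<omega>)\<^sup>2) + ((LBINT s. 2 * \<xi> \<omega> * (h s \<omega> * indicator {a<..b} s)) +
          (LBINT s. (\<xi> \<omega>)\<^sup>2 * (indicator {a<..b} s * indicator {a<..b} s)))"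
        unfolding eq Bochner_Integration.integral_add[OF s2 s1, symmetric]
        using IH by (intro Bochner_Integration.integral_add Bochner_Integration.integrable_add s1 s2) blast
      also have "(LBINT s. (\<xi> \<omega>)\<^sup>2 * (indicator {a<..b} s * indicator {a<..b} s)) = (\<xi> \<omega>)\<^sup>2 * ?m"
        by (simp only: Bochner_Integration.integral_mult_right_zero LBINT_indicator_mult(1))
      finally show ?thesis by (simp add: power2_eq_square)
    qed
    have b: "integrable (P x) (\<lambda>\<omega>. \<xi> \<omega> * \<xi> \<omega>)"
      using bounded_image_mult[OF step.hyps(5) step.hyps(5)] \<xi>P by (intro integrable_bounded) auto
    have b2: "integrable (P x) (\<lambda>\<omega>. 2 * (\<xi> \<omega> * (?i \<omega>)))"
      using C(2)[of x] by simp
    have b3: "integrable (P x) (\<lambda>\<omega>. (\<xi> \<omega> * \<xi> \<omega>) * ?m)" using b by simp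
    have 2: "integrable (P x) (\<lambda>\<omega>. ?h \<omega>)"
      unfolding eq2 using Bochner_Integration.integrable_add[OF _ Bochner_Integration.integrable_add[OF b2 b3]] IH
      by blast
    let ?D = "\<lambda>\<omega>. \<xi> \<omega> * (B b \<omega> - B a \<omega>)"
    have "(\<integral>\<omega>. (J \<omega> + ?D \<omega>)\<^sup>2 \<partial>P x) = (\<integral>\<omega>. (J \<omega>)\<^sup>2 + (2 * (J \<omega> * ?D \<omega>) + ?D \<omega> * ?D \<omega>) \<partial>P x)"
      by (simp add: algebra_simps power2_eq_square)
    also have "\<dots> = (\<integral>\<omega>. (J \<omega>)\<^sup>2 \<partial>P x) + ((\<integral>\<omega>. 2 * (J \<omega> * ?D \<omega>) \<partial>P x) + (\<integral>\<omega>. ?D \<omega> * ?D \<omega> \<partial>P x))"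
    proof -
      have i: "integrable (P x) (\<lambda>\<omega>. 2 * (J \<omega> * ?D \<omega>))"
        using integrable_mult_L2[OF U(1) Y(1) U(2) Y(2)] by simp
      have j: "integrable (P x) (\<lambda>\<omega>. ?D \<omega> * ?D \<omega>)"
        using integrable_mult_L2[OF Y(1) Y(1) Y(2) Y(2)] .
      show ?thesis
        using Bochner_Integration.integral_add[OF U(2) Bochner_Integration.integrable_add[OF i j]]
          Bochner_Integration.integral_add[OF i j] by simp
    qed
    also have "\<dots> = (\<integral>\<omega>. (LBINT s. (h s \<omega>)\<^sup>2) \<partial>P x) +
       (2 * (\<integral>\<omega>. \<xi> \<omega> * (?i \<omega>) \<partial>P x) + (\<integral>\<omega>. \<xi> \<omega> * \<xi> \<omega> \<partial>P x) * ?m)"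
      using IH C(3)[of x] increment_cov[OF step.hyps(2,3,2,3,4,5,4,5), of x] by simp
    also have "\<dots> = (\<integral>\<omega>. (?h \<omega>) \<partial>P x)"
      unfolding eq2 using IH b2 b3 by simp
    finally show ?case using 1 2 by blast
  qed simp
  then have P: "?P h J" .
  have e1: "(\<integral>\<^sup>+\<omega>. (\<integral>\<^sup>+s. ennreal ((h s \<omega>)\<^sup>2) \<partial>lborel) \<partial>P x) =
      (\<integral>\<^sup>+\<omega>. ennreal (LBINT s. (h s \<omega>)\<^sup>2) \<partial>P x)"
    using P by (simp add: nn_integral_eq_integral)
  have e2: "(\<integral>\<^sup>+\<omega>. ennreal (LBINT s. (h s \<omega>)\<^sup>2) \<partial>P x) = ennreal (\<integral>\<omega>. (LBINT s. (h s \<omega>)\<^sup>2) \<partial>P x)"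
    using P by (simp add: nn_integral_eq_integral)
  have e3: "(\<integral>\<^sup>+\<omega>. ennreal ((J \<omega>)\<^sup>2) \<partial>P x) = ennreal (\<integral>\<omega>. (J \<omega>)\<^sup>2 \<partial>P x)"
    using elem_L2[OF assms, of x] by (simp add: nn_integral_eq_integral)
  show ?thesis unfolding e1 e2 e3 using P by simp
qed

end

section \<open>Joint measurability, grids and sign sums\<close>

text \<open>Time is rounded down to multiples of \<open>1 / Suc n\<close>. The rounded process takes
  its times from a countable set, hence is jointly measurable, and continuity carries this to the
  limit. The \<open>max 0\<close> keeps away from negative times, where nothing is known about
  \<open>X\<close>.\<close>

lemma borel_measurable_continuous_paths:
  fixes X :: "real \<Rightarrow> 'a \<Rightarrow> real"
  assumes X: "\<And>t. 0 \<le> t \<Longrightarrow> X t \<in> borel_measurable M"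
    and c: "\<And>\<omega>. \<omega> \<in> space M \<Longrightarrow> continuous_on {0..} (\<lambda>t. X t \<omega>)"
  shows "(\<lambda>(t, \<omega>). X (max 0 t) \<omega>) \<in> borel_measurable (lborel \<Otimes>\<^sub>M M)"
proof -
  define q where "q n t = real (nat \<lfloor>real (Suc n) * t\<rfloor>) / real (Suc n)" for n and t :: real
  have q: "(\<lambda>n. q n t) \<longlonglongrightarrow> max 0 t" for t
  proof (rule LIMSEQ_I)
    fix e :: real assume "0 < e"
    then obtain N where N: "inverse (real (Suc N)) < e"
      using reals_Archimedean by blast
    have "norm (q n t - max 0 t) < e" if "N \<le> n" for n
    proof (cases "0 \<le> t")
      case True
      then have f: "real (nat \<lfloor>real (Suc n) * t\<rfloor>) = of_int \<lfloor>real (Suc n) * t\<rfloor>" by simp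
      have "\<bar>of_int \<lfloor>real (Suc n) * t\<rfloor> - real (Suc n) * t\<bar> \<le> 1" by linarith
      moreover have "q n t - t = (of_int \<lfloor>real (Suc n) * t\<rfloor> - real (Suc n) * t) / real (Suc n)"
        unfolding q_def f by (simp add: field_simps)
      ultimately have "\<bar>q n t - t\<bar> \<le> 1 / real (Suc n)"
        by (simp add: divide_right_mono)
      also have "\<dots> \<le> inverse (real (Suc N))"
        using that by (simp add: field_simps)
      finally show ?thesis using N True by simp
    next
      case False
      then have "real (Suc n) * t \<le> 0" by (simp add: mult_nonneg_nonpos)
      \<comment> \<open>For negative \<open>t\<close> the function \<open>nat\<close> cuts the floor
        off at \<open>0\<close>, so that the rounded time is \<open>0 = max 0 t\<close>.\<close>
      then have "nat \<lfloor>real (Suc n) * t\<rfloor> = 0" by linarith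
      then show ?thesis using False \<open>0 < e\<close> by (simp add: q_def)
    qed
    then show "\<exists>N. \<forall>n\<ge>N. norm (q n t - max 0 t) < e" by blast
  qed
  show ?thesis
  proof (rule borel_measurable_LIMSEQ_real)
    fix p :: "real \<times> 'a" assume "p \<in> space (lborel \<Otimes>\<^sub>M M)"
    then have "snd p \<in> space M" by (auto simp: space_pair_measure)
    note cp = c[OF this]
    have "(\<lambda>n. X (q n (fst p)) (snd p)) \<longlonglongrightarrow> X (max 0 (fst p)) (snd p)"
      by (rule continuous_on_tendsto_compose[OF cp q]) (auto simp: q_def)
    then show "(\<lambda>n. (\<lambda>(t, \<omega>). X (q n t) \<omega>) p) \<longlonglongrightarrow> (\<lambda>(t, \<omega>). X (max 0 t) \<omega>) p"
      by (simp add: case_prod_unfold)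
  next
    fix n
    have "(\<lambda>p. X (real (nat \<lfloor>real (Suc n) * fst p\<rfloor>) / real (Suc n)) (snd p)) \<in> borel_measurable (lborel \<Otimes>\<^sub>M M)"
    proof (rule measurable_compose_countable[where g = "\<lambda>p. nat \<lfloor>real (Suc n) * fst p\<rfloor>"])
      fix i :: nat
      show "(\<lambda>p. X (real i / real (Suc n)) (snd p)) \<in> borel_measurable (lborel \<Otimes>\<^sub>M M)"
        using X[of "real i / real (Suc n)"] by (intro measurable_compose[OF measurable_snd]) auto
    qed simp
    then show "(\<lambda>(t, \<omega>). X (q n t) \<omega>) \<in> borel_measurable (lborel \<Otimes>\<^sub>M M)"
      by (simp add: q_def case_prod_unfold)
  qed
qed

text \<open>The half-open intervals tile \<open>{t 0<..t n}\<close>, so at most one summand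
  survives. The induction on \<open>n\<close> needs the inside and the outside case
  together.\<close>

lemma sum_indicator_intervals:
  fixes c t :: "nat \<Rightarrow> real"
  assumes "\<And>i. t i \<le> t (Suc i)"
  shows "if t 0 < u \<and> u \<le> t n
    then \<exists>j<n. t j < u \<and> u \<le> t (Suc j) \<and> (\<Sum>i<n. c i * indicator {t i<..t (Suc i)} u) = c j
    else (\<Sum>i<n. c i * indicator {t i<..t (Suc i)} u) = 0"
proof (induction n)
  case (Suc n)
  have "t 0 \<le> t n" by (rule lift_Suc_mono_le) (use assms in auto)
  with Suc assms[of n] show ?case
    by (auto simp: less_Suc_eq split: if_splits)
qed simp

lemma simple_proc_times_nonneg: "simple_proc F (n, \<tau>, \<xi>) \<Longrightarrow> i \<le> n \<Longrightarrow> 0 \<le> \<tau> i"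
  by (induction i) (auto simp: simple_proc_def Suc_le_eq intro: order_trans)

text \<open>There are \<open>Suc n\<close> cells, so the mesh \<open>(t - s) / Suc n\<close> makes
  sense for every \<open>n\<close> and the right end has index \<open>Suc n\<close>.\<close>

definition grid :: "real \<Rightarrow> real \<Rightarrow> nat \<Rightarrow> nat \<Rightarrow> real" where
  "grid s t n i = s + (t - s) * real i / real (Suc n)"

lemma grid_0 [simp]: "grid s t n 0 = s"
  by (simp add: grid_def)

lemma grid_Suc [simp]: "grid s t n (Suc n) = t"
  by (simp add: grid_def del: of_nat_Suc)

lemma grid_step: "grid s t n (Suc i) - grid s t n i = (t - s) / real (Suc n)"
  unfolding grid_def by (simp add: algebra_simps add_divide_distrib diff_divide_distrib del: of_nat_Suc) (simp add: algebra_simps add_divide_distrib diff_divide_distrib)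

lemma grid_mono: "s \<le> t \<Longrightarrow> i \<le> j \<Longrightarrow> grid s t n i \<le> grid s t n j"
  by (auto simp: grid_def intro!: divide_right_mono mult_left_mono)

lemma grid_ge: "s \<le> t \<Longrightarrow> s \<le> grid s t n i"
  using grid_mono[of s t 0 i n] by simp

lemma grid_le: "s \<le> t \<Longrightarrow> i \<le> Suc n \<Longrightarrow> grid s t n i \<le> t"
  using grid_mono[of s t i "Suc n" n] by simp

context brownian_family
begin

definition sgn_sum :: "real \<Rightarrow> real \<Rightarrow> nat \<Rightarrow> 'w \<Rightarrow> real" where
  "sgn_sum s t n \<omega> = (\<Sum>i<Suc n. sgn (B (grid s t n i) \<omega>) *
     (B (grid s t n (Suc i)) \<omega> - B (grid s t n i) \<omega>))"

definition sgn_step :: "real \<Rightarrow> real \<Rightarrow> nat \<Rightarrow> real \<Rightarrow> 'w \<Rightarrow> real" where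
  "sgn_step s t n u \<omega> = (\<Sum>i<Suc n. sgn (B (grid s t n i) \<omega>) *
     indicator {grid s t n i<..grid s t n (Suc i)} u)"

lemma elem_sum:
  fixes n :: nat
  assumes "\<And>i. i < n \<Longrightarrow> 0 \<le> a i" "\<And>i. i < n \<Longrightarrow> a i \<le> b i"
    "\<And>i. i < n \<Longrightarrow> \<xi> i \<in> borel_measurable (F (a i))" "\<And>i. i < n \<Longrightarrow> bounded (\<xi> i ` space A)"
  shows "elem (\<lambda>s \<omega>. \<Sum>i<n. \<xi> i \<omega> * indicator {a i<..b i} s)
    (\<lambda>\<omega>. \<Sum>i<n. \<xi> i \<omega> * (B (b i) \<omega> - B (a i) \<omega>))"
  using assms
proof (induction n)
  case 0
  show ?case using elem.zero by simp
next
  case (Suc n)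
  then show ?case using elem.step[of _ _ "a n" "b n" "\<xi> n"] by simp
qed

lemma bounded_sgn: "bounded ((\<lambda>\<omega>. sgn (X \<omega> :: real)) ` S)"
  by (auto simp: bounded_iff intro!: exI[of _ 1] simp: sgn_if)

lemma elem_sgn_step:
  assumes "0 \<le> s" "s \<le> t"
  shows "elem (sgn_step s t n) (sgn_sum s t n)"
proof -
  have "(\<lambda>\<omega>. sgn (B (grid s t n i) \<omega>)) \<in> borel_measurable (F (grid s t n i))" for i
    using adapted[of "grid s t n i"] grid_ge[of s t n i] assms by simp
  then have "elem (\<lambda>u \<omega>. \<Sum>i<Suc n. sgn (B (grid s t n i) \<omega>) * indicator {grid s t n i<..grid s t n (Suc i)} u)
    (\<lambda>\<omega>. \<Sum>i<Suc n. sgn (B (grid s t n i) \<omega>) * (B (grid s t n (Suc i)) \<omega> - B (grid s t n i) \<omega>))"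
    using assms grid_ge[of s t n] by (intro elem_sum grid_mono bounded_sgn) (auto intro: order_trans)
  then show ?thesis
    unfolding sgn_step_def[abs_def] sgn_sum_def[abs_def] .
qed

lemma elem_simple_proc:
  assumes S: "simple_proc F S" and t: "0 \<le> t"
  shows "elem (\<lambda>s \<omega>. simple_proc_val S s \<omega> * indicator {0..t} s) (simple_proc_integral B S t)"
proof -
  obtain n \<tau> \<xi> where S_eq: "S = (n, \<tau>, \<xi>)" by (cases S)
  have \<tau>: "\<And>i. i < n \<Longrightarrow> \<tau> i \<le> \<tau> (Suc i)"
    and \<xi>: "\<And>i. i < n \<Longrightarrow> \<xi> i \<in> borel_measurable (F (\<tau> i))"
      "\<And>i. i < n \<Longrightarrow> bounded (\<xi> i ` space (F (\<tau> i)))"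
    using S by (auto simp: S_eq simple_proc_def)
  note pos = simple_proc_times_nonneg[OF S[unfolded S_eq]]
  \<comment> \<open>If \<open>t \<le> \<tau> i\<close>, the interval truncated at \<open>t\<close>
    is empty, but \<open>\<xi> i\<close> need not be measurable with respect to \<open>F t\<close>;
    a zero coefficient keeps the sum adapted without changing it.\<close>
  define \<eta> where "\<eta> i = (if \<tau> i < t then \<xi> i else (\<lambda>_. 0))" for i
  have "elem (\<lambda>s \<omega>. \<Sum>i<n. \<eta> i \<omega> * indicator {min t (\<tau> i)<..min t (\<tau> (Suc i))} s)
    (\<lambda>\<omega>. \<Sum>i<n. \<eta> i \<omega> * (B (min t (\<tau> (Suc i))) \<omega> - B (min t (\<tau> i)) \<omega>))"
  proof (rule elem_sum)
    fix i assume i: "i < n"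
    show "0 \<le> min t (\<tau> i)" using pos[of i] i t by simp
    show "min t (\<tau> i) \<le> min t (\<tau> (Suc i))" using \<tau>[OF i] by auto
    show "\<eta> i \<in> borel_measurable (F (min t (\<tau> i)))"
      using \<xi>(1)[OF i] by (auto simp: \<eta>_def)
    show "bounded (\<eta> i ` space A)"
      using \<xi>(2)[OF i] pos[of i] i by (auto simp: \<eta>_def space_F bounded_iff)
  qed
  moreover have "(\<Sum>i<n. \<eta> i \<omega> * indicator {min t (\<tau> i)<..min t (\<tau> (Suc i))} s) =
      simple_proc_val S s \<omega> * indicator {0..t} s" for s \<omega>
    unfolding simple_proc_val_def S_eq prod.case sum_distrib_right
  proof (rule sum.cong)
    fix i assume "i \<in> {..<n}"
    then show "\<eta> i \<omega> * indicator {min t (\<tau> i)<..min t (\<tau> (Suc i))} s =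
        \<xi> i \<omega> * indicator {\<tau> i<..\<tau> (Suc i)} s * indicator {0..t} s"
      using pos[of i] by (auto simp: \<eta>_def indicator_def)
  qed simp
  moreover have "(\<Sum>i<n. \<eta> i \<omega> * (B (min t (\<tau> (Suc i))) \<omega> - B (min t (\<tau> i)) \<omega>)) =
      simple_proc_integral B S t \<omega>" for \<omega>
    unfolding simple_proc_integral_def S_eq prod.case
  proof (rule sum.cong)
    fix i assume "i \<in> {..<n}"
    then show "\<eta> i \<omega> * (B (min t (\<tau> (Suc i))) \<omega> - B (min t (\<tau> i)) \<omega>) =
        \<xi> i \<omega> * (B (min t (\<tau> (Suc i))) \<omega> - B (min t (\<tau> i)) \<omega>)"
      using \<tau>[of i] by (auto simp: \<eta>_def min_def)
  qed simp
  ultimately show ?thesis by (simp add: fun_eq_iff)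
qed

lemma elem_measurable:
  assumes "elem h J"
  shows "(\<lambda>(u, \<omega>). h u \<omega>) \<in> borel_measurable (lborel \<Otimes>\<^sub>M P x)"
  using assms
proof induction
  case (step h J a b \<xi>)
  have [measurable]: "\<xi> \<in> borel_measurable (P x)"
    using measurable_F_P[OF step.hyps(4,2)] .
  have [measurable]: "(\<lambda>p. h (fst p) (snd p)) \<in> borel_measurable (lborel \<Otimes>\<^sub>M P x)"
    using step.IH by (simp add: case_prod_unfold)
  show ?case unfolding case_prod_unfold by measurable
qed simp

lemma B_joint_measurable: "(\<lambda>(u, \<omega>). B (max 0 u) \<omega>) \<in> borel_measurable (lborel \<Otimes>\<^sub>M P x)"
  using paths by (intro borel_measurable_continuous_paths) (auto simp: space_P)

text \<open>By continuity the sign of \<open>B\<close> is constant near a time at which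
  \<open>B\<close> does not vanish, and the left end of the cell containing \<open>u\<close> is that
  near once the mesh is small. The approximations are thus eventually equal to the limit.\<close>

lemma sgn_step_pointwise:
  assumes st: "0 \<le> s" "s \<le> t" and \<omega>: "\<omega> \<in> space A" and nz: "B (max 0 u) \<omega> \<noteq> 0"
  shows "(\<lambda>n. sgn_step s t n u \<omega>) \<longlonglongrightarrow> sgn (B (max 0 u) \<omega>) * indicator {s<..t} u"
proof (cases "s < u \<and> u \<le> t")
  case False
  have "sgn_step s t n u \<omega> = 0" for n
    using sum_indicator_intervals[of "grid s t n" u "Suc n" "\<lambda>i. sgn (B (grid s t n i) \<omega>)"]
      grid_mono[OF st(2), of _ "Suc _" n] False by (auto simp: sgn_step_def)
  then show ?thesis using False by (auto simp: indicator_def)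
next
  case True
  then have u0: "0 < u" using st by simp
  then have nz: "B u \<omega> \<noteq> 0" using nz by simp
  have "continuous_on {0..} (\<lambda>r. B r \<omega>)" using paths[OF \<omega>] .
  then obtain d where d: "0 < d" "\<And>r. 0 \<le> r \<Longrightarrow> dist r u < d \<Longrightarrow> dist (B r \<omega>) (B u \<omega>) < \<bar>B u \<omega>\<bar>"
    unfolding continuous_on_iff using u0 nz
    by (metis atLeast_iff less_imp_le zero_less_abs_iff)
  have near: "sgn (B r \<omega>) = sgn (B u \<omega>)" if "0 \<le> r" "dist r u < d" for r
    using d(2)[OF that] by (auto simp: dist_real_def sgn_if abs_if split: if_splits)
  obtain N where N: "(t - s) / d < real N" using reals_Archimedean2 by blast
  have "sgn_step s t n u \<omega> = sgn (B u \<omega>)" if "N \<le> n" for n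
  proof -
    obtain j where j: "j < Suc n" "grid s t n j < u" "u \<le> grid s t n (Suc j)"
      "sgn_step s t n u \<omega> = sgn (B (grid s t n j) \<omega>)"
      using sum_indicator_intervals[of "grid s t n" u "Suc n" "\<lambda>i. sgn (B (grid s t n i) \<omega>)"]
        grid_mono[OF st(2), of _ "Suc _" n] True by (auto simp: sgn_step_def)
    have "(t - s) / d < real (Suc n)" using N that by simp
    then have "(t - s) / real (Suc n) < d" using d(1) by (simp add: field_simps)
    then have "dist (grid s t n j) u < d"
      using j grid_step[of s t n j] by (simp add: dist_real_def)
    then show ?thesis
      using near[of "grid s t n j"] grid_ge[OF st(2), of n j] st j(4) by simp
  qed
  then have "eventually (\<lambda>n. sgn_step s t n u \<omega> = sgn (B u \<omega>)) sequentially"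
    by (auto simp: eventually_sequentially)
  then show ?thesis using True u0 by (simp add: tendsto_eventually)
qed

text \<open>Dominated convergence on the product space. Pointwise convergence can fail only where
  \<open>B u = 0\<close>, which is null for each \<open>u > 0\<close> and hence null in the product.
  Both terms are bounded by the indicator of \<open>{s<..t}\<close>, so \<open>4\<close> times it
  dominates the squared difference.\<close>

lemma sgn_step_L2:
  assumes st: "0 \<le> s" "s \<le> t"
  shows "(\<lambda>n. \<integral>\<^sup>+\<omega>. (\<integral>\<^sup>+u. ennreal ((sgn (B (max 0 u) \<omega>) * indicator {s<..t} u - sgn_step s t n u \<omega>)\<^sup>2) \<partial>lborel) \<partial>P x)
    \<longlonglongrightarrow> 0"
proof -
  interpret prob_space "P x" by (rule prob)
  interpret pair_sigma_finite "lborel :: real measure" "P x"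
    by (intro pair_sigma_finite.intro lborel.sigma_finite_measure_axioms sigma_finite_measure_axioms)
  let ?H = "\<lambda>p. sgn (B (max 0 (fst p)) (snd p)) * indicator {s<..t} (fst p)"
  let ?G = "\<lambda>n p. sgn_step s t n (fst p) (snd p)"
  have mB [measurable]: "(\<lambda>p. B (max 0 (fst p)) (snd p)) \<in> borel_measurable (lborel \<Otimes>\<^sub>M P x)"
    using B_joint_measurable by (simp add: case_prod_unfold)
  have mG [measurable]: "?G n \<in> borel_measurable (lborel \<Otimes>\<^sub>M P x)" for n
    using elem_measurable[OF elem_sgn_step[OF st]] by (simp add: case_prod_unfold)
  have nz: "AE p in lborel \<Otimes>\<^sub>M P x. fst p > 0 \<longrightarrow> B (max 0 (fst p)) (snd p) \<noteq> 0"
  proof (rule AE_pair_measure)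
    show "{p \<in> space (lborel \<Otimes>\<^sub>M P x). fst p > 0 \<longrightarrow> B (max 0 (fst p)) (snd p) \<noteq> 0} \<in> sets (lborel \<Otimes>\<^sub>M P x)"
      by measurable
    have "AE \<omega> in P x. u > 0 \<longrightarrow> B (max 0 u) \<omega> \<noteq> 0" for u
      using AE_B_nonzero[of u x] by (cases "u > 0") auto
    then show "AE u in lborel. AE \<omega> in P x. fst (u, \<omega>) > 0 \<longrightarrow> B (max 0 (fst (u, \<omega>))) (snd (u, \<omega>)) \<noteq> 0"
      by simp
  qed
  have bnd: "\<bar>sgn_step s t n u \<omega>\<bar> \<le> indicator {s<..t} u" for n u \<omega>
    using sum_indicator_intervals[of "grid s t n" u "Suc n" "\<lambda>i. sgn (B (grid s t n i) \<omega>)"]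
      grid_mono[OF st(2), of _ "Suc _" n] by (auto simp: sgn_step_def sgn_if split: if_splits)
  have "(\<lambda>n. \<integral>\<^sup>+p. ennreal ((?H p - ?G n p)\<^sup>2) \<partial>(lborel \<Otimes>\<^sub>M P x)) \<longlonglongrightarrow> (\<integral>\<^sup>+p. 0 \<partial>((lborel :: real measure) \<Otimes>\<^sub>M P x))"
  proof (rule nn_integral_dominated_convergence[where w = "\<lambda>p. ennreal (4 * indicator {s<..t} (fst p))"])
    show "(\<lambda>p. ennreal ((?H p - ?G n p)\<^sup>2)) \<in> borel_measurable (lborel \<Otimes>\<^sub>M P x)" for n
      by measurable
    show "(\<lambda>p. ennreal (4 * indicator {s<..t} (fst p))) \<in> borel_measurable (lborel \<Otimes>\<^sub>M P x)"
      by measurable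
    have "(\<integral>\<^sup>+p. ennreal (4 * indicator {s<..t} (fst p)) \<partial>(lborel \<Otimes>\<^sub>M P x)) =
        (\<integral>\<^sup>+u. (\<integral>\<^sup>+\<omega>. ennreal (4 * indicator {s<..t} u) \<partial>P x) \<partial>lborel)"
      by (subst sigma_finite_measure.nn_integral_fst[OF prob_space_imp_sigma_finite[OF prob], symmetric]) auto
    also have "\<dots> = (\<integral>\<^sup>+u. ennreal 4 * indicator {s<..t} u \<partial>lborel)"
      by (intro nn_integral_cong) (auto simp: emeasure_space_1 indicator_def)
    also have "\<dots> < \<infinity>"
      using st by (simp add: nn_integral_cmult_indicator ennreal_mult_less_top)
    finally show "(\<integral>\<^sup>+p. ennreal (4 * indicator {s<..t} (fst p)) \<partial>(lborel \<Otimes>\<^sub>M P x)) < \<infinity>" .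
    show "AE p in lborel \<Otimes>\<^sub>M P x. ennreal ((?H p - ?G n p)\<^sup>2) \<le> ennreal (4 * indicator {s<..t} (fst p))" for n
    proof (intro AE_I2 ennreal_leI)
      fix p
      have "\<bar>?H p - ?G n p\<bar> \<le> 2 * indicator {s<..t} (fst p)"
        using bnd[of n "fst p" "snd p"] by (auto simp: indicator_def sgn_if split: if_splits)
      then have "\<bar>?H p - ?G n p\<bar>\<^sup>2 \<le> (2 * indicator {s<..t} (fst p))\<^sup>2"
        by (intro power_mono) auto
      then show "(?H p - ?G n p)\<^sup>2 \<le> 4 * indicator {s<..t} (fst p)"
        by (auto simp: indicator_def power_mult_distrib)
    qed
    show "AE p in lborel \<Otimes>\<^sub>M P x. (\<lambda>n. ennreal ((?H p - ?G n p)\<^sup>2)) \<longlonglongrightarrow> 0"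
      using nz
    proof (rule AE_mp, intro AE_I2 impI)
      fix p assume "p \<in> space (lborel \<Otimes>\<^sub>M P x)" and p: "fst p > 0 \<longrightarrow> B (max 0 (fst p)) (snd p) \<noteq> 0"
      then have "snd p \<in> space A" by (auto simp: space_pair_measure space_P)
      have "(\<lambda>n. ?G n p) \<longlonglongrightarrow> ?H p"
      proof (cases "fst p > 0")
        case True
        then show ?thesis using sgn_step_pointwise[OF st \<open>snd p \<in> space A\<close>] p by blast
      next
        case False
        then have i: "indicator {s<..t} (fst p) = (0::real)" using st by (auto simp: indicator_def)
        then have "?G n p = 0" for n using bnd[of n "fst p" "snd p"] by simp
        then show ?thesis using i by simp
      qed
      then have "(\<lambda>n. ennreal ((?H p - ?G n p)\<^sup>2)) \<longlonglongrightarrow> ennreal ((?H p - ?H p)\<^sup>2)"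
        by (intro tendsto_intros)
      then show "(\<lambda>n. ennreal ((?H p - ?G n p)\<^sup>2)) \<longlonglongrightarrow> 0" by simp
    qed
  qed simp
  also have "(\<integral>\<^sup>+p. 0 \<partial>((lborel :: real measure) \<Otimes>\<^sub>M P x)) = 0" by simp
  also have "(\<lambda>n. \<integral>\<^sup>+p. ennreal ((?H p - ?G n p)\<^sup>2) \<partial>(lborel \<Otimes>\<^sub>M P x)) =
    (\<lambda>n. \<integral>\<^sup>+\<omega>. (\<integral>\<^sup>+u. ennreal ((sgn (B (max 0 u) \<omega>) * indicator {s<..t} u - sgn_step s t n u \<omega>)\<^sup>2) \<partial>lborel) \<partial>P x)"
    by (intro ext, subst nn_integral_snd[symmetric]) auto
  finally show ?thesis .
qed

end

text \<open>The pointwise gap between the two sides is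
  \<open>(a + b)^2 + (a - c)^2 + (b + c)^2\<close>. The signs in \<open>f - g + k\<close> fit a
  difference of two Tanaka formulas plus an approximation error. Nonnegative integrals make the
  bound usable before \<open>L\<close> is known to be square integrable.\<close>

lemma nn_integral_L2_triangle:
  fixes f g k :: "'a \<Rightarrow> real"
  assumes [measurable]: "f \<in> borel_measurable M" "g \<in> borel_measurable M" "k \<in> borel_measurable M"
  shows "(\<integral>\<^sup>+x. ennreal ((f x - g x + k x)\<^sup>2) \<partial>M) \<le> ennreal 3 * ((\<integral>\<^sup>+x. ennreal ((f x)\<^sup>2) \<partial>M) +
    (\<integral>\<^sup>+x. ennreal ((g x)\<^sup>2) \<partial>M) + (\<integral>\<^sup>+x. ennreal ((k x)\<^sup>2) \<partial>M))"
proof -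
  have "(a - b + c)\<^sup>2 \<le> 3 * (a\<^sup>2 + b\<^sup>2 + c\<^sup>2)" for a b c :: real
  proof -
    have "3 * (a\<^sup>2 + b\<^sup>2 + c\<^sup>2) - (a - b + c)\<^sup>2 = (a + b)\<^sup>2 + (a - c)\<^sup>2 + (b + c)\<^sup>2"
      by (simp add: power2_eq_square algebra_simps)
    then show ?thesis by (smt (verit) zero_le_power2)
  qed
  then have "(\<integral>\<^sup>+x. ennreal ((f x - g x + k x)\<^sup>2) \<partial>M) \<le>
      (\<integral>\<^sup>+x. ennreal 3 * (ennreal ((f x)\<^sup>2) + ennreal ((g x)\<^sup>2) + ennreal ((k x)\<^sup>2)) \<partial>M)"
  proof (intro nn_integral_mono)
    fix x
    have "ennreal ((f x - g x + k x)\<^sup>2) \<le> ennreal (3 * ((f x)\<^sup>2 + (g x)\<^sup>2 + (k x)\<^sup>2))"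
      by (rule ennreal_leI) fact
    then show "ennreal ((f x - g x + k x)\<^sup>2) \<le> ennreal 3 * (ennreal ((f x)\<^sup>2) + ennreal ((g x)\<^sup>2) + ennreal ((k x)\<^sup>2))"
      by (subst (asm) ennreal_mult') simp_all
  qed
  also have "\<dots> = ennreal 3 * ((\<integral>\<^sup>+x. ennreal ((f x)\<^sup>2) \<partial>M) +
    (\<integral>\<^sup>+x. ennreal ((g x)\<^sup>2) \<partial>M) + (\<integral>\<^sup>+x. ennreal ((k x)\<^sup>2) \<partial>M))"
    by (simp add: nn_integral_cmult nn_integral_add)
  finally show ?thesis .
qed

lemma tendsto_0_three:
  fixes a b c d :: "nat \<Rightarrow> ennreal"
  assumes "a \<longlonglongrightarrow> 0" "b \<longlonglongrightarrow> 0" "c \<longlonglongrightarrow> 0" "\<And>n. d n \<le> ennreal 3 * (a n + b n + c n)"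
  shows "d \<longlonglongrightarrow> 0"
proof (rule tendsto_sandwich[OF _ _ tendsto_const])
  have "(\<lambda>n. ennreal 3 * (a n + b n + c n)) \<longlonglongrightarrow> ennreal 3 * (0 + 0 + 0)"
    by (intro ennreal_tendsto_cmult tendsto_add assms) simp
  then show "(\<lambda>n. ennreal 3 * (a n + b n + c n)) \<longlonglongrightarrow> 0" by simp
qed (use assms(4) in auto)

section \<open>Local time\<close>

locale brownian_local_time = brownian_family +
  fixes L :: "real \<Rightarrow> 'a \<Rightarrow> real"
  assumes local_time: "local_time_at_0 A P F B L"
begin

lemma L_F: "0 \<le> s \<Longrightarrow> s \<le> t \<Longrightarrow> L s \<in> borel_measurable (F t)"
  using local_time measurable_F_mono[of "L s" s borel t] by (simp add: local_time_at_0_def)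

lemma L_P [measurable]: "0 \<le> s \<Longrightarrow> L s \<in> borel_measurable (P x)"
  using measurable_F_P[OF L_F[of s s]] by simp

lemma L_continuous: "\<omega> \<in> space A \<Longrightarrow> continuous_on {0..} (\<lambda>t. L t \<omega>)"
  using local_time by (simp add: local_time_at_0_def)

text \<open>The defining approximation of the Ito integral, recast for \<open>elem\<close>: the cut
  at \<open>t\<close> moves from the range of integration into the integrands, after which
  approximations belonging to different times can be subtracted.\<close>

lemma tanaka_approx:
  assumes t: "0 \<le> t"
  obtains I h J where "I \<in> borel_measurable (P x)"
    "AE \<omega> in P x. \<bar>B t \<omega>\<bar> = \<bar>B 0 \<omega>\<bar> + I \<omega> + L t \<omega>"
    "\<And>k. elem (h k) (J k)"
    "(\<lambda>k. \<integral>\<^sup>+\<omega>. (\<integral>\<^sup>+u. ennreal ((h k u \<omega> - sgn (B (max 0 u) \<omega>) * indicator {0..t} u)\<^sup>2) \<partial>lborel) \<partial>P x) \<longlonglongrightarrow> 0"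
    "(\<lambda>k. \<integral>\<^sup>+\<omega>. ennreal ((J k \<omega> - I \<omega>)\<^sup>2) \<partial>P x) \<longlonglongrightarrow> 0"
proof -
  obtain I where I: "has_ito_integral (P x) F B t (\<lambda>s \<omega>. sgn (B s \<omega>)) I"
    "AE \<omega> in P x. \<bar>B t \<omega>\<bar> = \<bar>B 0 \<omega>\<bar> + I \<omega> + L t \<omega>"
    using local_time t unfolding local_time_at_0_def by blast
  then obtain S where S: "\<And>k. simple_proc F (S k)"
    "(\<lambda>k. \<integral>\<^sup>+\<omega>. (\<integral>\<^sup>+s\<in>{0..t}. ennreal ((simple_proc_val (S k) s \<omega> - sgn (B s \<omega>))\<^sup>2) \<partial>lborel) \<partial>P x)
          \<longlonglongrightarrow> 0"
    "(\<lambda>k. \<integral>\<^sup>+\<omega>. ennreal ((simple_proc_integral B (S k) t \<omega> - I \<omega>)\<^sup>2) \<partial>P x) \<longlonglongrightarrow> 0"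
    and m: "I \<in> borel_measurable (P x)"
    unfolding has_ito_integral_def by blast
  let ?h = "\<lambda>k s \<omega>. simple_proc_val (S k) s \<omega> * indicator {0..t} s"
  have "ennreal ((simple_proc_val (S k) s \<omega> - sgn (B s \<omega>))\<^sup>2) * indicator {0..t} s =
    ennreal ((?h k s \<omega> - sgn (B (max 0 s) \<omega>) * indicator {0..t} s)\<^sup>2)" for k s \<omega>
    by (auto simp: indicator_def max_def)
  then show thesis
    using that[OF m I(2), of ?h "\<lambda>k. simple_proc_integral B (S k) t"] elem_simple_proc[OF S(1) t] S(2,3)
    by simp
qed

text \<open>By Tanaka's formula at \<open>s\<close> and \<open>t\<close> the quantity in the square
  is \<open>sgn_sum - (I2 - I1)\<close>. The integrands \<open>h2 - h1\<close> and
  \<open>sgn_step\<close> both tend to \<open>sgn B\<close> on \<open>{s<..t}\<close>, so the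
  isometry, applied to their difference, makes \<open>J2 - J1 - sgn_sum\<close> small. In this way
  no additivity of the Ito integral in time has to be proved.\<close>

lemma local_time_increment_approx:
  assumes s: "0 \<le> s" and st: "s \<le> t"
  shows "(\<lambda>n. \<integral>\<^sup>+\<omega>. ennreal ((L t \<omega> - L s \<omega> - (\<bar>B t \<omega>\<bar> - \<bar>B s \<omega>\<bar> - sgn_sum s t n \<omega>))\<^sup>2) \<partial>P x) \<longlonglongrightarrow> 0"
proof -
  interpret prob_space "P x" by (rule prob)
  interpret pair_sigma_finite "lborel :: real measure" "P x"
    by (intro pair_sigma_finite.intro lborel.sigma_finite_measure_axioms sigma_finite_measure_axioms)
  have t: "0 \<le> t" using assms by simp
  obtain I1 h1 J1 where 1: "I1 \<in> borel_measurable (P x)"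
    "AE \<omega> in P x. \<bar>B s \<omega>\<bar> = \<bar>B 0 \<omega>\<bar> + I1 \<omega> + L s \<omega>"
    "\<And>k. elem (h1 k) (J1 k)"
    "(\<lambda>k. \<integral>\<^sup>+\<omega>. (\<integral>\<^sup>+u. ennreal ((h1 k u \<omega> - sgn (B (max 0 u) \<omega>) * indicator {0..s} u)\<^sup>2) \<partial>lborel) \<partial>P x) \<longlonglongrightarrow> 0"
    "(\<lambda>k. \<integral>\<^sup>+\<omega>. ennreal ((J1 k \<omega> - I1 \<omega>)\<^sup>2) \<partial>P x) \<longlonglongrightarrow> 0"
    by (rule tanaka_approx[OF s, of x]) blast
  obtain I2 h2 J2 where 2: "I2 \<in> borel_measurable (P x)"
    "AE \<omega> in P x. \<bar>B t \<omega>\<bar> = \<bar>B 0 \<omega>\<bar> + I2 \<omega> + L t \<omega>"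
    "\<And>k. elem (h2 k) (J2 k)"
    "(\<lambda>k. \<integral>\<^sup>+\<omega>. (\<integral>\<^sup>+u. ennreal ((h2 k u \<omega> - sgn (B (max 0 u) \<omega>) * indicator {0..t} u)\<^sup>2) \<partial>lborel) \<partial>P x) \<longlonglongrightarrow> 0"
    "(\<lambda>k. \<integral>\<^sup>+\<omega>. ennreal ((J2 k \<omega> - I2 \<omega>)\<^sup>2) \<partial>P x) \<longlonglongrightarrow> 0"
    by (rule tanaka_approx[OF t, of x]) blast
  let ?H = "\<lambda>S u \<omega>. sgn (B (max 0 u) \<omega>) * indicator S u"
  let ?N = "\<lambda>f. \<integral>\<^sup>+\<omega>. (\<integral>\<^sup>+u. ennreal ((f u \<omega>)\<^sup>2) \<partial>lborel) \<partial>P x"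
  have N: "?N f = (\<integral>\<^sup>+p. ennreal ((f (fst p) (snd p))\<^sup>2) \<partial>(lborel \<Otimes>\<^sub>M P x))"
    if "(\<lambda>p. f (fst p) (snd p)) \<in> borel_measurable (lborel \<Otimes>\<^sub>M P x)" for f :: "real \<Rightarrow> 'a \<Rightarrow> real"
    using nn_integral_snd[of "\<lambda>p. ennreal ((f (fst p) (snd p))\<^sup>2)"] that by simp
  have mB [measurable]: "(\<lambda>p. B (max 0 (fst p)) (snd p)) \<in> borel_measurable (lborel \<Otimes>\<^sub>M P x)"
    using B_joint_measurable by (simp add: case_prod_unfold)
  have mh [measurable]: "(\<lambda>p. h1 k (fst p) (snd p)) \<in> borel_measurable (lborel \<Otimes>\<^sub>M P x)"
    "(\<lambda>p. h2 k (fst p) (snd p)) \<in> borel_measurable (lborel \<Otimes>\<^sub>M P x)" for k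
    using elem_measurable[OF 1(3)] elem_measurable[OF 2(3)] by (simp_all add: case_prod_unfold)
  have mG [measurable]: "(\<lambda>p. sgn_step s t k (fst p) (snd p)) \<in> borel_measurable (lborel \<Otimes>\<^sub>M P x)" for k
    using elem_measurable[OF elem_sgn_step[OF s st]] by (simp add: case_prod_unfold)
  have el: "elem (\<lambda>u \<omega>. h2 k u \<omega> - h1 k u \<omega> - sgn_step s t k u \<omega>) (\<lambda>\<omega>. J2 k \<omega> - J1 k \<omega> - sgn_sum s t k \<omega>)" for k
    by (intro elem_diff elem_sgn_step 1 2 s st)
  have i: "indicator {0..t} u - indicator {0..s} u = (indicator {s<..t} u :: real)" for u
    using s st by (auto simp: indicator_def)
  have dec: "h2 k u \<omega> - h1 k u \<omega> - sgn_step s t k u \<omega> =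
    (h2 k u \<omega> - ?H {0..t} u \<omega>) - (h1 k u \<omega> - ?H {0..s} u \<omega>) + (?H {s<..t} u \<omega> - sgn_step s t k u \<omega>)" for k u \<omega>
    unfolding i[symmetric] by (simp add: algebra_simps)
  have "?N (\<lambda>u \<omega>. h2 k u \<omega> - h1 k u \<omega> - sgn_step s t k u \<omega>) \<le> ennreal 3 *
    (?N (\<lambda>u \<omega>. h2 k u \<omega> - ?H {0..t} u \<omega>) + ?N (\<lambda>u \<omega>. h1 k u \<omega> - ?H {0..s} u \<omega>) +
     ?N (\<lambda>u \<omega>. ?H {s<..t} u \<omega> - sgn_step s t k u \<omega>))" for k
    unfolding dec by (subst (1 2 3 4) N, measurable) (rule nn_integral_L2_triangle; measurable)
  then have "(\<lambda>k. ?N (\<lambda>u \<omega>. h2 k u \<omega> - h1 k u \<omega> - sgn_step s t k u \<omega>)) \<longlonglongrightarrow> 0"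
    by (rule tendsto_0_three[OF 2(4) 1(4) sgn_step_L2[OF s st]])
  then have E: "(\<lambda>k. \<integral>\<^sup>+\<omega>. ennreal ((J2 k \<omega> - J1 k \<omega> - sgn_sum s t k \<omega>)\<^sup>2) \<partial>P x) \<longlonglongrightarrow> 0"
    unfolding elem_isometry[OF el] .
  have mJ [measurable]: "J1 k \<in> borel_measurable (P x)" "J2 k \<in> borel_measurable (P x)"
    "sgn_sum s t k \<in> borel_measurable (P x)" for k
    using elem_L2(1)[OF 1(3)] elem_L2(1)[OF 2(3)] elem_L2(1)[OF elem_sgn_step[OF s st]] by auto
  note [measurable] = 1(1) 2(1)
  let ?l = "\<lambda>n \<omega>. L t \<omega> - L s \<omega> - (\<bar>B t \<omega>\<bar> - \<bar>B s \<omega>\<bar> - sgn_sum s t n \<omega>)" and ?j = "\<lambda>n \<omega>. J2 n \<omega> - J1 n \<omega> - sgn_sum s t n \<omega>"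
  \<comment> \<open>The approximating integrals \<open>J1\<close> and \<open>J2\<close> cancel, and
    \<open>sgn_sum - (I2 - I1)\<close> remains.\<close>
  let ?r = "\<lambda>n \<omega>. (J2 n \<omega> - I2 \<omega>) - (J1 n \<omega> - I1 \<omega>) + - ?j n \<omega>"
  show ?thesis
  proof (rule tendsto_0_three[OF 2(5) 1(5) E])
    fix n
    have "(\<integral>\<^sup>+\<omega>. ennreal ((?l n \<omega>)\<^sup>2) \<partial>P x) =
      (\<integral>\<^sup>+\<omega>. ennreal ((?r n \<omega>)\<^sup>2) \<partial>P x)"
    proof (rule nn_integral_cong_AE)
      show "AE \<omega> in P x. ennreal ((?l n \<omega>)\<^sup>2) =
        ennreal ((?r n \<omega>)\<^sup>2)"
        using 1(2) 2(2)
      proof eventually_elim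
        case (elim \<omega>)
        have "?l n \<omega> =
            ?r n \<omega>"
          using elim by linarith
        then show ?case by (rule arg_cong)
      qed
    qed
    also have "\<dots> \<le> ennreal 3 * ((\<integral>\<^sup>+\<omega>. ennreal ((J2 n \<omega> - I2 \<omega>)\<^sup>2) \<partial>P x) +
        (\<integral>\<^sup>+\<omega>. ennreal ((J1 n \<omega> - I1 \<omega>)\<^sup>2) \<partial>P x) +
        (\<integral>\<^sup>+\<omega>. ennreal ((- (?j n \<omega>))\<^sup>2) \<partial>P x))"
      by (rule nn_integral_L2_triangle) measurable
    also have "(\<integral>\<^sup>+\<omega>. ennreal ((- (?j n \<omega>))\<^sup>2) \<partial>P x) =
       (\<integral>\<^sup>+\<omega>. ennreal ((?j n \<omega>)\<^sup>2) \<partial>P x)"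
      by (simp only: power2_minus)
    finally show "(\<integral>\<^sup>+\<omega>. ennreal ((?l n \<omega>)\<^sup>2) \<partial>P x) \<le>
      ennreal 3 * ((\<integral>\<^sup>+\<omega>. ennreal ((J2 n \<omega> - I2 \<omega>)\<^sup>2) \<partial>P x) +
        (\<integral>\<^sup>+\<omega>. ennreal ((J1 n \<omega> - I1 \<omega>)\<^sup>2) \<partial>P x) +
        (\<integral>\<^sup>+\<omega>. ennreal ((?j n \<omega>)\<^sup>2) \<partial>P x))" .
  qed
qed

text \<open>Since \<open>sgn b * b = \<bar>b\<bar>\<close>, the value at the left end of each cell
  cancels. The surviving summand \<open>\<bar>b'\<bar> - sgn b * b'\<close> is visibly nonnegative
  and is zero when \<open>b\<close> and \<open>b'\<close> have the same sign, which is all that the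
  next two lemmas use.\<close>

lemma abs_increment_eq:
  "\<bar>B t \<omega>\<bar> - \<bar>B s \<omega>\<bar> - sgn_sum s t n \<omega> = (\<Sum>i<Suc n. \<bar>B (grid s t n (Suc i)) \<omega>\<bar> -
     sgn (B (grid s t n i) \<omega>) * B (grid s t n (Suc i)) \<omega>)"
proof -
  have "\<bar>B t \<omega>\<bar> - \<bar>B s \<omega>\<bar> = (\<Sum>i<Suc n. \<bar>B (grid s t n (Suc i)) \<omega>\<bar> - \<bar>B (grid s t n i) \<omega>\<bar>)"
    using sum_lessThan_telescope[of "\<lambda>i. \<bar>B (grid s t n i) \<omega>\<bar>" "Suc n"] by simp
  then show ?thesis
    unfolding sgn_sum_def sum_subtractf[symmetric]
    by (simp only: sum_subtractf[symmetric]) (intro sum.cong refl, simp add: algebra_simps abs_sgn)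
qed

lemma abs_increment_nonneg: "0 \<le> \<bar>B t \<omega>\<bar> - \<bar>B s \<omega>\<bar> - sgn_sum s t n \<omega>"
  unfolding abs_increment_eq by (intro sum_nonneg) (auto simp: sgn_if abs_if)

lemma abs_increment_no_zero:
  assumes \<omega>: "\<omega> \<in> space A" and st: "0 \<le> s" "s \<le> t" and nz: "\<And>u. u \<in> {s..t} \<Longrightarrow> B u \<omega> \<noteq> 0"
  shows "\<bar>B t \<omega>\<bar> - \<bar>B s \<omega>\<bar> - sgn_sum s t n \<omega> = 0"
proof -
  have "continuous_on {s..t} (\<lambda>u. B u \<omega>)"
    using continuous_on_subset[OF paths[OF \<omega>], of "{s..t}"] st by auto
  then have c: "connected ((\<lambda>u. B u \<omega>) ` {s..t})"
    by (intro connected_continuous_image) auto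
  have same: "sgn (B u \<omega>) = sgn (B v \<omega>)" if uv: "u \<in> {s..t}" "v \<in> {s..t}" for u v
  proof (rule ccontr)
    assume "sgn (B u \<omega>) \<noteq> sgn (B v \<omega>)"
    then have "B u \<omega> < 0 \<and> 0 < B v \<omega> \<or> B v \<omega> < 0 \<and> 0 < B u \<omega>"
      using nz[OF uv(1)] nz[OF uv(2)] by (auto simp: sgn_if split: if_splits)
    then have "0 \<in> (\<lambda>u. B u \<omega>) ` {s..t}"
      using connectedD_interval[OF c, of "B u \<omega>" "B v \<omega>" 0] connectedD_interval[OF c, of "B v \<omega>" "B u \<omega>" 0] uv
      by force
    then show False using nz by force
  qed
  show ?thesis
    unfolding abs_increment_eq
  proof (rule sum.neutral, rule ballI)
    fix i assume "i \<in> {..<Suc n}"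
    then have "grid s t n i \<in> {s..t}" "grid s t n (Suc i) \<in> {s..t}"
      using grid_ge[OF st(2)] grid_le[OF st(2)] by auto
    from same[OF this] show "\<bar>B (grid s t n (Suc i)) \<omega>\<bar> - sgn (B (grid s t n i) \<omega>) * B (grid s t n (Suc i)) \<omega> = 0"
      by (simp add: abs_sgn mult.commute)
  qed
qed

text \<open>The weight \<open>D * sgn B\<close> is known at the left end of each cell, and the
  increment over the cell has mean zero independently of it.\<close>

lemma sgn_sum_orthogonal:
  assumes st: "0 \<le> s" "s \<le> t" and D: "D \<in> borel_measurable (F s)" "bounded (D ` space A)"
  shows "(\<integral>\<omega>. D \<omega> * sgn_sum s t n \<omega> \<partial>P x) = 0"
proof -
  let ?g = "grid s t n"
  have g: "0 \<le> ?g i" "s \<le> ?g i" "?g i \<le> ?g (Suc i)" for i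
    using grid_ge[OF st(2), of n i] st grid_mono[OF st(2), of i "Suc i" n] by auto
  have *: "integrable (P x) (\<lambda>\<omega>. (D \<omega> * sgn (B (?g i) \<omega>)) * (B (?g (Suc i)) \<omega> - B (?g i) \<omega>)) \<and>
    (\<integral>\<omega>. (D \<omega> * sgn (B (?g i) \<omega>)) * (B (?g (Suc i)) \<omega> - B (?g i) \<omega>) \<partial>P x) = 0" for i
  proof -
    have m: "(\<lambda>\<omega>. D \<omega> * sgn (B (?g i) \<omega>)) \<in> borel_measurable (F (?g i))"
      using measurable_F_mono[OF D(1) st(1) g(2)[of i]] adapted[OF g(1)[of i]] by simp
    have i: "integrable (P x) (\<lambda>\<omega>. D \<omega> * sgn (B (?g i) \<omega>))"
      using measurable_F_P[OF m g(1)] bounded_image_mult[OF D(2) bounded_sgn] by (intro integrable_bounded) auto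
    show ?thesis
      using increment_mult[OF g(1) g(3) m i, of 1] increment_moments(1)[OF g(1) g(3), of x] by simp
  qed
  have "(\<integral>\<omega>. D \<omega> * sgn_sum s t n \<omega> \<partial>P x) =
     (\<integral>\<omega>. (\<Sum>i<Suc n. (D \<omega> * sgn (B (?g i) \<omega>)) * (B (?g (Suc i)) \<omega> - B (?g i) \<omega>)) \<partial>P x)"
    by (simp only: sgn_sum_def sum_distrib_left mult.assoc)
  also have "\<dots> = (\<Sum>i<Suc n. 0)"
    using * by (subst Bochner_Integration.integral_sum) auto
  finally show ?thesis by simp
qed

text \<open>Everything is inherited from \<open>Z n\<close>, the increment of
  \<open>\<bar>B\<bar>\<close> minus its sign sum, which converges to \<open>L t - L s\<close> in
  \<open>L^2\<close>. Monotonicity and flatness away from zeros hold for every \<open>Z n\<close>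
  and pass along an almost surely convergent subsequence. In the last claim the sign sum is
  orthogonal to \<open>D\<close>, so the mean of \<open>D * Z n\<close> does not depend on
  \<open>n\<close>.\<close>

lemma local_time_increment:
  assumes st: "0 \<le> s" "s \<le> t"
  shows "integrable (P x) (\<lambda>\<omega>. (L t \<omega> - L s \<omega>)\<^sup>2)"
    and "AE \<omega> in P x. L s \<omega> \<le> L t \<omega>"
    and "AE \<omega> in P x. (\<forall>u\<in>{s..t}. B u \<omega> \<noteq> 0) \<longrightarrow> L t \<omega> = L s \<omega>"
    and "\<lbrakk>D \<in> borel_measurable (F s); bounded (D ` space A)\<rbrakk> \<Longrightarrow>
      (\<integral>\<omega>. D \<omega> * (L t \<omega> - L s \<omega>) \<partial>P x) = (\<integral>\<omega>. D \<omega> * (\<bar>B t \<omega>\<bar> - \<bar>B s \<omega>\<bar>) \<partial>P x)"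
proof -
  interpret prob_space "P x" by (rule prob)
  have t: "0 \<le> t" using st by simp
  define Y where "Y \<omega> = L t \<omega> - L s \<omega>" for \<omega>
  define Z where "Z n \<omega> = \<bar>B t \<omega>\<bar> - \<bar>B s \<omega>\<bar> - sgn_sum s t n \<omega>" for n \<omega>
  have el: "sgn_sum s t n \<in> borel_measurable (P x)" "integrable (P x) (\<lambda>\<omega>. (sgn_sum s t n \<omega>)\<^sup>2)" for n
    using elem_L2[OF elem_sgn_step[OF st]] by auto
  have abs2: "integrable (P x) (\<lambda>\<omega>. (\<bar>B t \<omega>\<bar> - \<bar>B s \<omega>\<bar>)\<^sup>2)"
    using B_power2_integrable[of s x] B_power2_integrable[of t x] st t by (intro integrable_diff_L2) auto
  have mY [measurable]: "Y \<in> borel_measurable (P x)" unfolding Y_def[abs_def] using st t by simp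
  have mZ [measurable]: "Z n \<in> borel_measurable (P x)" for n unfolding Z_def[abs_def] using st t el by simp
  have Z2: "integrable (P x) (\<lambda>\<omega>. (Z n \<omega>)\<^sup>2)" for n
    unfolding Z_def by (rule integrable_diff_L2[OF _ el(1) abs2 el(2)]) (use st t in simp)
  have lim: "(\<lambda>n. \<integral>\<^sup>+\<omega>. ennreal ((Y \<omega> - Z n \<omega>)\<^sup>2) \<partial>P x) \<longlonglongrightarrow> 0"
    using local_time_increment_approx[OF st, of x] by (simp add: Y_def Z_def)
  have Y2: "integrable (P x) (\<lambda>\<omega>. (Y \<omega>)\<^sup>2)"
  proof -
    \<comment> \<open>Convergence to \<open>0\<close> makes some distance finite, and
      \<open>Y\<close> is square integrable because that \<open>Z n\<close> is.\<close>
    have "eventually (\<lambda>n. (\<integral>\<^sup>+\<omega>. ennreal ((Y \<omega> - Z n \<omega>)\<^sup>2) \<partial>P x) < \<infinity>) sequentially"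
      using order_tendstoD(2)[OF lim, of \<infinity>] by simp
    then obtain n where "(\<integral>\<^sup>+\<omega>. ennreal ((Y \<omega> - Z n \<omega>)\<^sup>2) \<partial>P x) < \<infinity>"
      by (meson eventually_sequentially order_refl)
    then have "integrable (P x) (\<lambda>\<omega>. (Y \<omega> - Z n \<omega>)\<^sup>2)"
      by (intro integrableI_bounded) auto
    then have "integrable (P x) (\<lambda>\<omega>. ((Y \<omega> - Z n \<omega>) + Z n \<omega>)\<^sup>2)"
      using Z2 by (intro integrable_add_L2) auto
    then show ?thesis by simp
  qed
  then show "integrable (P x) (\<lambda>\<omega>. (L t \<omega> - L s \<omega>)\<^sup>2)" by (simp add: Y_def)
  have YZ: "integrable (P x) (\<lambda>\<omega>. (Y \<omega> - Z n \<omega>)\<^sup>2)" for n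
    using Y2 Z2 by (intro integrable_diff_L2) auto
  have lim2: "(\<lambda>n. \<integral>\<omega>. (Y \<omega> - Z n \<omega>)\<^sup>2 \<partial>P x) \<longlonglongrightarrow> 0"
    using lim YZ by (simp add: nn_integral_eq_integral ennreal_tendsto_0_iff)
  obtain r :: "nat \<Rightarrow> nat" where "AE \<omega> in P x. (\<lambda>n. (Y \<omega> - Z (r n) \<omega>)\<^sup>2) \<longlonglongrightarrow> 0"
    using tendsto_L1_AE_subseq[of "P x" "\<lambda>n \<omega>. (Y \<omega> - Z n \<omega>)\<^sup>2"] YZ lim2 by auto
  then have ae: "AE \<omega> in P x. (\<lambda>n. Z (r n) \<omega>) \<longlonglongrightarrow> Y \<omega>"
  proof eventually_elim
    case (elim \<omega>)
    then have "(\<lambda>n. Y \<omega> - Z (r n) \<omega>) \<longlonglongrightarrow> 0"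
      using tendsto_real_sqrt[OF elim] tendsto_rabs_zero_iff by fastforce
    from tendsto_diff[OF tendsto_const[of "Y \<omega>"] this] show ?case by simp
  qed
  show "AE \<omega> in P x. L s \<omega> \<le> L t \<omega>"
    using ae
  proof eventually_elim
    case (elim \<omega>)
    then have "0 \<le> Y \<omega>"
      by (rule LIMSEQ_le_const) (auto simp only: Z_def abs_increment_nonneg)
    then show ?case by (simp add: Y_def)
  qed
  show "AE \<omega> in P x. (\<forall>u\<in>{s..t}. B u \<omega> \<noteq> 0) \<longrightarrow> L t \<omega> = L s \<omega>"
    using ae AE_space
  proof eventually_elim
    case (elim \<omega>)
    show ?case
    proof
      assume "\<forall>u\<in>{s..t}. B u \<omega> \<noteq> 0"
      then have "Z n \<omega> = 0" for n
        unfolding Z_def using elim(2) st by (intro abs_increment_no_zero) (auto simp: space_P)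
      then have "Y \<omega> = 0" using elim(1) by (simp add: LIMSEQ_const_iff)
      then show "L t \<omega> = L s \<omega>" by (simp add: Y_def)
    qed
  qed
  assume D: "D \<in> borel_measurable (F s)" "bounded (D ` space A)"
  have mD [measurable]: "D \<in> borel_measurable (P x)" using measurable_F_P[OF D(1) st(1)] .
  obtain C where C: "0 \<le> C" "\<And>\<omega>. \<omega> \<in> space A \<Longrightarrow> \<bar>D \<omega>\<bar> \<le> C"
    by (rule bounded_image_realE[OF D(2)]) blast
  have L1: "integrable (P x) (\<lambda>\<omega>. D \<omega> * W \<omega>)" if "W \<in> borel_measurable (P x)" "integrable (P x) (\<lambda>\<omega>. (W \<omega>)\<^sup>2)" for W
    using D(2) square_integrable_imp_integrable[OF that] by (intro integrable_bounded_mult) (auto simp: space_P)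
  have DY: "integrable (P x) (\<lambda>\<omega>. D \<omega> * Y \<omega>)" by (rule L1[OF mY Y2])
  let ?EB = "\<integral>\<omega>. D \<omega> * (\<bar>B t \<omega>\<bar> - \<bar>B s \<omega>\<bar>) \<partial>P x" and ?EY = "\<integral>\<omega>. D \<omega> * Y \<omega> \<partial>P x"
  let ?YZ = "\<lambda>n. \<integral>\<omega>. (Y \<omega> - Z n \<omega>)\<^sup>2 \<partial>P x"
  have eq: "(\<integral>\<omega>. D \<omega> * Z n \<omega> \<partial>P x) = ?EB" for n
  proof -
    have "(\<integral>\<omega>. D \<omega> * Z n \<omega> \<partial>P x) = (\<integral>\<omega>. D \<omega> * (\<bar>B t \<omega>\<bar> - \<bar>B s \<omega>\<bar>) - D \<omega> * sgn_sum s t n \<omega> \<partial>P x)"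
      by (simp add: Z_def right_diff_distrib)
    also have "\<dots> = ?EB - (\<integral>\<omega>. D \<omega> * sgn_sum s t n \<omega> \<partial>P x)"
      using st t by (intro Bochner_Integration.integral_diff L1[OF _ abs2] L1[OF el]) simp
    finally show ?thesis using sgn_sum_orthogonal[OF st D] by simp
  qed
  have bnd: "(?EY - ?EB)\<^sup>2 \<le> C\<^sup>2 * ?YZ n" for n
  proof -
    let ?W = "\<lambda>\<omega>. D \<omega> * (Y \<omega> - Z n \<omega>)"
    have i1: "integrable (P x) ?W" by (intro L1 YZ) simp
    have le: "(?W \<omega>)\<^sup>2 \<le> C\<^sup>2 * (Y \<omega> - Z n \<omega>)\<^sup>2" if "\<omega> \<in> space A" for \<omega>
      using power_mono[OF C(2)[OF that], of 2] by (simp add: power_mult_distrib mult_right_mono)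
    have i2: "integrable (P x) (\<lambda>\<omega>. (?W \<omega>)\<^sup>2)"
      using YZ[of n] le by (intro Bochner_Integration.integrable_bound[OF integrable_mult_right[of "C\<^sup>2", OF YZ[of n]]])
        (auto simp: space_P abs_mult)
    \<comment> \<open>Nonnegativity of the variance plays the part of the Cauchy-Schwarz
      inequality.\<close>
    have "(expectation ?W)\<^sup>2 \<le> expectation (\<lambda>\<omega>. (?W \<omega>)\<^sup>2)"
      using variance_eq[OF i1 i2] variance_positive[of ?W] by simp
    also have "\<dots> \<le> (\<integral>\<omega>. C\<^sup>2 * (Y \<omega> - Z n \<omega>)\<^sup>2 \<partial>P x)"
      using YZ[of n] i2 le by (intro integral_mono_AE) (auto simp: space_P)
    finally have "(expectation ?W)\<^sup>2 \<le> C\<^sup>2 * ?YZ n" by simp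
    moreover have "expectation ?W = ?EY - (\<integral>\<omega>. D \<omega> * Z n \<omega> \<partial>P x)"
      unfolding right_diff_distrib by (intro Bochner_Integration.integral_diff L1 Y2 Z2) simp_all
    ultimately show ?thesis unfolding eq by simp
  qed
  have "(\<lambda>n. C\<^sup>2 * ?YZ n) \<longlonglongrightarrow> C\<^sup>2 * 0"
    by (intro tendsto_intros lim2)
  then have "(?EY - ?EB)\<^sup>2 \<le> C\<^sup>2 * 0"
    by (rule LIMSEQ_le_const) (use bnd in blast)
  then show "(\<integral>\<omega>. D \<omega> * (L t \<omega> - L s \<omega>) \<partial>P x) = ?EB"
    by (simp add: Y_def)
qed

end

section \<open>Sums along a fixed path\<close>

text \<open>Lagrange's form of the remainder leaves \<open>(w2 t - w2 y) * d^2 / 2\<close>. For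
  \<open>\<bar>d\<bar> < \<eta>\<close> the modulus of continuity applies; otherwise
  \<open>K * d^2\<close> is multiplied by \<open>d^2 / \<eta>^2\<close>, which is at least
  \<open>1\<close>. The fourth power thereby replaces a tail estimate for large increments.\<close>

lemma taylor_order2_error:
  fixes w w1 w2 :: "real \<Rightarrow> real"
  assumes w: "\<And>y. (w has_real_derivative w1 y) (at y)" "\<And>y. (w1 has_real_derivative w2 y) (at y)"
    and K: "\<And>y. \<bar>w2 y\<bar> \<le> K" and \<eta>: "0 < \<eta>" "\<And>y z. \<bar>y - z\<bar> < \<eta> \<Longrightarrow> \<bar>w2 y - w2 z\<bar> \<le> \<epsilon>"
  shows "\<bar>w (y + d) - w y - w1 y * d - w2 y * d\<^sup>2 / 2\<bar> \<le> \<epsilon> * d\<^sup>2 + K / \<eta>\<^sup>2 * d ^ 4"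
proof -
  have \<epsilon>0: "0 \<le> \<epsilon>" using \<eta>(2)[of 0 0] \<eta>(1) by simp
  have K0: "0 \<le> K" using K[of 0] by linarith
  define W where "W m = (if m = 0 then w else if m = 1 then w1 else w2)" for m :: nat
  obtain t where t: "\<bar>t - y\<bar> \<le> \<bar>d\<bar>" "w (y + d) = w y + w1 y * d + w2 t * d\<^sup>2 / 2"
  proof (cases "d = 0")
    case True
    then show ?thesis using that[of y] by simp
  next
    case False
    \<comment> \<open>The interval of radius \<open>\<bar>d\<bar>\<close> around \<open>y\<close>
      contains \<open>y + d\<close> for either sign of \<open>d\<close>.\<close>
    have "\<exists>t. (if y + d < y then y + d < t \<and> t < y else y < t \<and> t < y + d) \<and>
      w (y + d) = (\<Sum>m<2. W m y / fact m * (y + d - y) ^ m) + W 2 t / fact 2 * (y + d - y) ^ 2"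
      by (rule Taylor[where a = "y - \<bar>d\<bar>" and b = "y + \<bar>d\<bar>"])
        (use False in \<open>auto simp: W_def less_2_cases_iff intro!: w\<close>)
    then obtain t where t: "if y + d < y then y + d < t \<and> t < y else y < t \<and> t < y + d"
      "w (y + d) = (\<Sum>m<2. W m y / fact m * (y + d - y) ^ m) + W 2 t / fact 2 * (y + d - y) ^ 2"
      by blast
    have "\<bar>t - y\<bar> \<le> \<bar>d\<bar>" using t(1) by (auto split: if_splits)
    moreover have "w (y + d) = w y + w1 y * d + w2 t * d\<^sup>2 / 2"
      using t(2) by (simp add: W_def eval_nat_numeral)
    ultimately show ?thesis using that by blast
  qed
  have "w (y + d) - w y - w1 y * d - w2 y * d\<^sup>2 / 2 = (w2 t - w2 y) * (d\<^sup>2 / 2)"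
    unfolding t(2) by (simp add: algebra_simps diff_divide_distrib)
  then have e: "\<bar>w (y + d) - w y - w1 y * d - w2 y * d\<^sup>2 / 2\<bar> = \<bar>w2 t - w2 y\<bar> * (d\<^sup>2 / 2)"
    by (simp only: abs_mult) simp
  show ?thesis
  proof (cases "\<bar>d\<bar> < \<eta>")
    case True
    then have "\<bar>w2 t - w2 y\<bar> * (d\<^sup>2 / 2) \<le> \<epsilon> * (d\<^sup>2 / 2)"
      using \<eta>(2)[of t y] t(1) by (intro mult_right_mono) auto
    also have "\<dots> \<le> \<epsilon> * d\<^sup>2" using \<epsilon>0 by (intro mult_left_mono) auto
    also have "\<dots> \<le> \<epsilon> * d\<^sup>2 + K / \<eta>\<^sup>2 * d ^ 4" using K0 by simp
    finally show ?thesis unfolding e .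
  next
    case False
    have "\<bar>w2 t - w2 y\<bar> \<le> 2 * K" using K[of t] K[of y] by linarith
    then have "\<bar>w2 t - w2 y\<bar> * (d\<^sup>2 / 2) \<le> 2 * K * (d\<^sup>2 / 2)"
      by (intro mult_right_mono) auto
    also have "\<dots> = K * d\<^sup>2 * 1" by simp
    also have "\<dots> \<le> K * d\<^sup>2 * (d\<^sup>2 / \<eta>\<^sup>2)"
    proof (rule mult_left_mono)
      have "\<eta>\<^sup>2 \<le> \<bar>d\<bar>\<^sup>2" using False \<eta>(1) by (intro power_mono) auto
      then show "1 \<le> d\<^sup>2 / \<eta>\<^sup>2" using \<eta>(1) by simp
    qed (use K0 in simp)
    also have "\<dots> = K / \<eta>\<^sup>2 * d ^ 4" by (simp add: power_mult[symmetric] power2_eq_square power4_eq_xxxx)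
    also have "\<dots> \<le> \<epsilon> * d\<^sup>2 + K / \<eta>\<^sup>2 * d ^ 4" using \<epsilon>0 by simp
    finally show ?thesis unfolding e .
  qed
qed

lemma riemann_sum_tendsto:
  fixes g :: "real \<Rightarrow> real"
  assumes T: "0 \<le> T" and g: "continuous_on {0..T} g"
  shows "(\<lambda>n. \<Sum>i<Suc n. T / real (Suc n) * g (grid 0 T n i)) \<longlonglongrightarrow> integral {0..T} g"
proof (rule LIMSEQ_I)
  fix e :: real assume e: "0 < e"
  \<comment> \<open>The summand \<open>1\<close> covers \<open>T = 0\<close>.\<close>
  define \<epsilon> where "\<epsilon> = e / (2 * (T + 1))"
  have \<epsilon>: "0 < \<epsilon>" "T * \<epsilon> < e"
    using e T mult_nonneg_nonneg[of T e] by (auto simp: \<epsilon>_def field_simps add_nonneg_pos)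
  have "uniformly_continuous_on {0..T} g"
    using g by (intro compact_uniformly_continuous) auto
  then obtain d where d: "0 < d" "\<And>u v. u \<in> {0..T} \<Longrightarrow> v \<in> {0..T} \<Longrightarrow> dist u v < d \<Longrightarrow> dist (g u) (g v) < \<epsilon>"
    unfolding uniformly_continuous_on_def using \<epsilon>(1) by metis
  obtain N where N: "T / d < real N" using reals_Archimedean2 by blast
  have "norm ((\<Sum>i<Suc n. T / real (Suc n) * g (grid 0 T n i)) - integral {0..T} g) < e" if n: "N \<le> n" for n
  proof -
    let ?g = "grid 0 T n" and ?h = "T / real (Suc n)"
    have h: "0 \<le> ?h" "?h < d"
    proof -
      show "0 \<le> ?h" using T by simp
      have "T / d < real (Suc n)" using N n by simp
      then show "?h < d" using d(1) by (simp add: field_simps)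
    qed
    have gr: "0 \<le> ?g i" "?g i \<le> ?g (Suc i)" "?g (Suc i) - ?g i = ?h" for i
      using grid_ge[OF T, of n i] grid_mono[OF T, of i "Suc i" n] grid_step[of 0 T n i] by auto
    have "\<bar>integral {0..?g k} g - (\<Sum>i<k. ?h * g (?g i))\<bar> \<le> real k * (?h * \<epsilon>)" if "k \<le> Suc n" for k
      using that
    proof (induction k)
      case (Suc k)
      have kT: "?g (Suc k) \<le> T" using grid_le[OF T Suc.prems] .
      have sub: "{0..?g (Suc k)} \<subseteq> {0..T}" "{?g k..?g (Suc k)} \<subseteq> {0..T}" using kT gr(1)[of k] by auto
      have int: "g integrable_on {0..?g (Suc k)}"
        using continuous_on_subset[OF g sub(1)] by (rule integrable_continuous_real)
      have int2: "g integrable_on {?g k..?g (Suc k)}"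
        using continuous_on_subset[OF g sub(2)] by (rule integrable_continuous_real)
      have split: "integral {0..?g (Suc k)} g = integral {0..?g k} g + integral {?g k..?g (Suc k)} g"
        using Henstock_Kurzweil_Integration.integral_combine[OF gr(1,2) int] by simp
      have "norm (integral {?g k..?g (Suc k)} (\<lambda>u. g u - g (?g k))) \<le> \<epsilon> * (?g (Suc k) - ?g k)"
      proof (rule integral_bound[OF gr(2)])
        show "continuous_on {?g k..?g (Suc k)} (\<lambda>u. g u - g (?g k))"
          by (intro continuous_intros continuous_on_subset[OF g sub(2)])
        fix u assume u: "u \<in> {?g k..?g (Suc k)}"
        then have "dist u (?g k) < d" using gr(3)[of k] h by (auto simp: dist_real_def)
        then have "dist (g u) (g (?g k)) < \<epsilon>" using d(2)[of u "?g k"] u sub(2) gr(2)[of k] by fastforce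
        then show "norm (g u - g (?g k)) \<le> \<epsilon>" by (simp add: dist_real_def)
      qed
      moreover have "integral {?g k..?g (Suc k)} (\<lambda>u. g u - g (?g k)) = integral {?g k..?g (Suc k)} g - ?h * g (?g k)"
        using int2 gr(2,3)[of k] by (subst Henstock_Kurzweil_Integration.integral_diff) auto
      ultimately have "\<bar>integral {?g k..?g (Suc k)} g - ?h * g (?g k)\<bar> \<le> ?h * \<epsilon>"
        unfolding gr(3) by (simp only: real_norm_def mult.commute)
      then have "\<bar>integral {0..?g (Suc k)} g - (\<Sum>i<Suc k. ?h * g (?g i))\<bar> \<le> real k * (?h * \<epsilon>) + ?h * \<epsilon>"
        using Suc unfolding split by simp
      moreover have "real k * (?h * \<epsilon>) + ?h * \<epsilon> = real (Suc k) * (?h * \<epsilon>)"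
        by (simp only: of_nat_Suc ring_distribs mult_1)
      ultimately show ?case by simp
    qed simp
    from this[of "Suc n"] have "\<bar>integral {0..T} g - (\<Sum>i<Suc n. ?h * g (?g i))\<bar> \<le> T * \<epsilon>"
      by (simp del: sum.lessThan_Suc of_nat_Suc)
    then show ?thesis using \<epsilon>(2) by (simp del: sum.lessThan_Suc of_nat_Suc)
  qed
  then show "\<exists>N. \<forall>n\<ge>N. norm ((\<Sum>i<Suc n. T / real (Suc n) * g (grid 0 T n i)) - integral {0..T} g) < e"
    by blast
qed

text \<open>The inequality \<open>1 + y \<le> exp y\<close>, used at \<open>- x\<close> and at
  \<open>x\<close>, puts \<open>exp (- x)\<close> between \<open>1 - x\<close> and
  \<open>1 / (1 + x)\<close>, and the latter is at most \<open>1 - x + x^2\<close>.\<close>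

lemma exp_minus_taylor:
  fixes x :: real
  assumes "0 \<le> x"
  shows "\<bar>exp (- x) - 1 + x\<bar> \<le> x\<^sup>2"
proof -
  have "0 \<le> exp (- x) - 1 + x" using exp_ge_add_one_self[of "- x"] by simp
  moreover have "exp (- x) \<le> 1 / (1 + x)"
    using exp_ge_add_one_self[of x] assms by (simp add: exp_minus field_simps)
  moreover have "1 / (1 + x) \<le> 1 - x + x\<^sup>2"
    using assms by (simp add: field_simps power2_eq_square)
  ultimately show ?thesis by linarith
qed

text \<open>A path \<open>b\<close> killed at rate \<open>\<alpha>\<close> and by its local time \<open>l\<close>; \<open>Z n\<close> collects, over a grid, the terms of
  the increment of \<open>D v(b)\<close> that remain after the martingale part is removed.\<close>

locale killed_path =
  fixes T \<alpha> \<beta> C :: real and b l v \<phi> :: "real \<Rightarrow> real"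
  assumes T: "0 \<le> T" and \<alpha>: "0 \<le> \<alpha>" and \<beta>: "0 \<le> \<beta>"
    and b: "continuous_on {0..T} b" and l: "continuous_on {0..T} l" and l0: "l 0 = 0"
    and l_mono: "\<And>n i. i \<le> n \<Longrightarrow> l (grid 0 T n i) \<le> l (grid 0 T n (Suc i))"
    and l_flat: "\<And>n i. \<lbrakk>i \<le> n; \<forall>u\<in>{grid 0 T n i..grid 0 T n (Suc i)}. b u \<noteq> 0\<rbrakk> \<Longrightarrow>
      l (grid 0 T n (Suc i)) = l (grid 0 T n i)"
    and v: "continuous_on UNIV v" and \<phi>: "continuous_on UNIV \<phi>"
    and v_le: "\<And>y. \<bar>v y\<bar> \<le> C" and \<phi>_le: "\<And>y. \<bar>\<phi> y\<bar> \<le> C"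
begin

definition D :: "real \<Rightarrow> real" where
  "D u = exp (- \<alpha> * u - \<beta> * l u)"

definition Z :: "nat \<Rightarrow> real" where
  "Z n = (\<Sum>i<Suc n. T / real (Suc n) * (D (grid 0 T n i) * (\<alpha> * v (b (grid 0 T n i)) - \<phi> (b (grid 0 T n i)))) +
     \<beta> * v 0 * (D (grid 0 T n i) * (l (grid 0 T n (Suc i)) - l (grid 0 T n i))) +
     (D (grid 0 T n (Suc i)) - D (grid 0 T n i)) * v (b (grid 0 T n (Suc i))))"

lemma C_nonneg: "0 \<le> C"
  using v_le[of 0] by linarith

lemma sum_l: "(\<Sum>i<Suc n. l (grid 0 T n (Suc i)) - l (grid 0 T n i)) = l T"
  using sum_lessThan_telescope[of "\<lambda>i. l (grid 0 T n i)" "Suc n"] l0 by (simp del: sum.lessThan_Suc)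

lemma l_grid_nonneg: "i \<le> Suc n \<Longrightarrow> 0 \<le> l (grid 0 T n i)"
proof (induction i)
  case (Suc i)
  then show ?case using l_mono[of i n] by simp
qed (simp add: l0)

lemma l_T_nonneg: "0 \<le> l T"
  using l_grid_nonneg[of "Suc 0" 0] by simp

lemma grid_facts:
  "0 \<le> grid 0 T n i" "grid 0 T n i \<le> grid 0 T n (Suc i)" "grid 0 T n (Suc i) - grid 0 T n i = T / real (Suc n)"
  using grid_ge[OF T, of n i] grid_mono[OF T, of i "Suc i" n] grid_step[of 0 T n i] by auto

lemma grid_in: "i \<le> Suc n \<Longrightarrow> grid 0 T n i \<in> {0..T}"
  using grid_facts(1) grid_le[OF T] by simp

lemma D_grid: "i \<le> Suc n \<Longrightarrow> D (grid 0 T n i) \<le> 1" "0 \<le> D u"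
proof -
  show "0 \<le> D u" by (simp add: D_def)
  assume "i \<le> Suc n"
  then have "0 \<le> \<alpha> * grid 0 T n i" "0 \<le> \<beta> * l (grid 0 T n i)"
    using l_grid_nonneg[of i n] grid_facts(1)[of n i] \<alpha> \<beta> by auto
  then show "D (grid 0 T n i) \<le> 1" unfolding D_def by simp
qed

text \<open>The bound is free of \<open>n\<close> and linear in \<open>l T\<close>, hence integrable
  once the path is random; it serves as the dominating function. The time steps add up to
  \<open>T\<close>, the increments of \<open>l\<close> telescope to \<open>l T\<close>, and
  \<open>D\<close> decreases along the grid, so its variation is at most \<open>1\<close>.\<close>

lemma Z_bounded: "\<bar>Z n\<bar> \<le> T * ((\<alpha> + 1) * C) + \<beta> * C * l T + C"
proof -
  let ?g = "grid 0 T n" and ?h = "T / real (Suc n)"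
  have "\<bar>?h * (D (?g i) * (\<alpha> * v (b (?g i)) - \<phi> (b (?g i)))) + \<beta> * v 0 * (D (?g i) * (l (?g (Suc i)) - l (?g i))) +
     (D (?g (Suc i)) - D (?g i)) * v (b (?g (Suc i)))\<bar> \<le>
     ?h * ((\<alpha> + 1) * C) + \<beta> * C * (l (?g (Suc i)) - l (?g i)) + (D (?g i) - D (?g (Suc i))) * C" if i: "i \<in> {..<Suc n}" for i
  proof -
    have D1: "0 \<le> D (?g i)" "D (?g i) \<le> 1" using D_grid(1)[of i n] D_grid(2)[of "?g i"] i by auto
    have lm: "0 \<le> l (?g (Suc i)) - l (?g i)" using l_mono[of i n] i by simp
    have "\<alpha> * ?g i \<le> \<alpha> * ?g (Suc i)" "\<beta> * l (?g i) \<le> \<beta> * l (?g (Suc i))"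
      using grid_facts(2)[of n i] \<alpha> \<beta> lm by (auto intro: mult_left_mono)
    then have Dm: "D (?g (Suc i)) \<le> D (?g i)" unfolding D_def by simp
    have "\<bar>\<alpha> * v (b (?g i)) - \<phi> (b (?g i))\<bar> \<le> \<alpha> * \<bar>v (b (?g i))\<bar> + \<bar>\<phi> (b (?g i))\<bar>"
      using abs_triangle_ineq4[of "\<alpha> * v (b (?g i))" "\<phi> (b (?g i))"] \<alpha> by (simp add: abs_mult)
    also have "\<dots> \<le> (\<alpha> + 1) * C"
      using mult_left_mono[OF v_le \<alpha>, of "b (?g i)"] \<phi>_le[of "b (?g i)"] by (simp add: algebra_simps)
    finally have 1: "\<bar>?h * (D (?g i) * (\<alpha> * v (b (?g i)) - \<phi> (b (?g i))))\<bar> \<le> ?h * (1 * ((\<alpha> + 1) * C))"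
      unfolding abs_mult using T D1 by (intro mult_mono) auto
    have 2: "\<bar>\<beta> * v 0 * (D (?g i) * (l (?g (Suc i)) - l (?g i)))\<bar> \<le> \<beta> * C * (1 * (l (?g (Suc i)) - l (?g i)))"
      unfolding abs_mult using \<beta> lm D1 v_le[of 0] C_nonneg by (intro mult_mono) auto
    have 3: "\<bar>(D (?g (Suc i)) - D (?g i)) * v (b (?g (Suc i)))\<bar> \<le> (D (?g i) - D (?g (Suc i))) * C"
      unfolding abs_mult using Dm v_le by (intro mult_mono) auto
    show ?thesis using 1 2 3 unfolding mult_1 by linarith
  qed
  then have "\<bar>Z n\<bar> \<le> (\<Sum>i<Suc n. ?h * ((\<alpha> + 1) * C) + \<beta> * C * (l (?g (Suc i)) - l (?g i)) + (D (?g i) - D (?g (Suc i))) * C)"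
    unfolding Z_def by (intro order_trans[OF sum_abs] sum_mono)
  also have "\<dots> = T * ((\<alpha> + 1) * C) + \<beta> * C * l T + (D 0 - D T) * C"
  proof -
    have "(\<Sum>i<Suc n. D (?g i) - D (?g (Suc i))) = D 0 - D T"
      using sum_lessThan_telescope'[of "\<lambda>i. D (?g i)" "Suc n"] by (simp del: sum.lessThan_Suc)
    moreover have "(\<Sum>i<Suc n. ?h * ((\<alpha> + 1) * C)) = T * ((\<alpha> + 1) * C)"
      by (simp del: sum.lessThan_Suc of_nat_Suc)
    ultimately show ?thesis
      by (simp only: sum.distrib sum_distrib_left[symmetric] sum_distrib_right[symmetric] sum_l)
  qed
  also have "(D 0 - D T) * C \<le> 1 * C"
    using D_grid(1)[of 0 0] D_grid(2)[of T] C_nonneg by (intro mult_right_mono) auto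
  finally show ?thesis by simp
qed

text \<open>Over a cell \<open>D\<close> is multiplied by \<open>exp (- x)\<close>, where
  \<open>x\<close> is the time step times \<alpha> plus the increment of \<open>l\<close> times
  \<beta>. To first order this subtracts \<open>x * v\<close> at the right end, which cancels the
  \<alpha> and \<beta> terms of \<open>Z\<close> up to the oscillation of \<open>v\<close> along the
  path. The rest is quadratic in \<open>x\<close>, so at most \<open>\<epsilon> * x * C\<close>, and
  the \<open>x i\<close> sum to \<open>\<alpha> * T + \<beta> * l T\<close>.\<close>

lemma Z_error:
  assumes \<epsilon>: "\<And>u u'. \<lbrakk>u \<in> {0..T}; u' \<in> {0..T}; \<bar>u - u'\<bar> \<le> T / real (Suc n)\<rbrakk> \<Longrightarrow>
      \<bar>v (b u) - v (b u')\<bar> \<le> \<epsilon> \<and> \<bar>(\<alpha> * u + \<beta> * l u) - (\<alpha> * u' + \<beta> * l u')\<bar> \<le> \<epsilon>"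
  shows "\<bar>Z n + (\<Sum>i<Suc n. T / real (Suc n) * (D (grid 0 T n i) * \<phi> (b (grid 0 T n i))))\<bar> \<le>
    (1 + C) * \<epsilon> * (\<alpha> * T + \<beta> * l T)"
proof -
  let ?g = "grid 0 T n" and ?h = "T / real (Suc n)"
  define x where "x i = \<alpha> * ?h + \<beta> * (l (?g (Suc i)) - l (?g i))" for i
  have h0: "0 \<le> ?h" using T by simp
  have "\<bar>?h * (D (?g i) * (\<alpha> * v (b (?g i)) - \<phi> (b (?g i)))) + \<beta> * v 0 * (D (?g i) * (l (?g (Suc i)) - l (?g i))) +
     (D (?g (Suc i)) - D (?g i)) * v (b (?g (Suc i))) + ?h * (D (?g i) * \<phi> (b (?g i)))\<bar> \<le> (1 + C) * \<epsilon> * x i"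
    if i: "i \<in> {..<Suc n}" for i
  proof -
    define \<Delta> where "\<Delta> = l (?g (Suc i)) - l (?g i)"
    have D1: "0 \<le> D (?g i)" "D (?g i) \<le> 1" using D_grid(1)[of i n] D_grid(2)[of "?g i"] i by auto
    have \<Delta>: "0 \<le> \<Delta>" using l_mono[of i n] i by (simp add: \<Delta>_def)
    have gi: "?g i \<in> {0..T}" "?g (Suc i) \<in> {0..T}" using grid_in[of i n] grid_in[of "Suc i" n] i by auto
    have near: "\<bar>u - ?g (Suc i)\<bar> \<le> ?h" if "u \<in> {?g i..?g (Suc i)}" for u
      using grid_facts(3)[of n i] that by auto
    have x0: "0 \<le> x i" unfolding x_def \<Delta>_def[symmetric] by (intro add_nonneg_nonneg mult_nonneg_nonneg \<alpha> \<beta> \<Delta> h0)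
    have x_eq: "x i = (\<alpha> * ?g (Suc i) + \<beta> * l (?g (Suc i))) - (\<alpha> * ?g i + \<beta> * l (?g i))"
      unfolding x_def grid_facts(3)[of n i, symmetric] by (simp add: algebra_simps)
    have eps: "\<bar>v (b (?g i)) - v (b (?g (Suc i)))\<bar> \<le> \<epsilon>" "x i \<le> \<epsilon>"
      using \<epsilon>[OF gi near] grid_facts(2)[of n i] unfolding x_eq by auto
    have \<epsilon>0: "0 \<le> \<epsilon>" using eps(1) by linarith
    have "D (?g (Suc i)) = D (?g i) * exp (- x i)"
      unfolding D_def exp_add[symmetric] x_eq by (simp add: algebra_simps)
    then have "?h * (D (?g i) * (\<alpha> * v (b (?g i)) - \<phi> (b (?g i)))) + \<beta> * v 0 * (D (?g i) * (l (?g (Suc i)) - l (?g i))) +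
     (D (?g (Suc i)) - D (?g i)) * v (b (?g (Suc i))) + ?h * (D (?g i) * \<phi> (b (?g i))) =
     D (?g i) * (\<alpha> * ?h * (v (b (?g i)) - v (b (?g (Suc i)))) + \<beta> * \<Delta> * (v 0 - v (b (?g (Suc i)))) +
       (exp (- x i) - 1 + x i) * v (b (?g (Suc i))))" (is "?lhs = D (?g i) * ?r")
      unfolding \<Delta>_def x_def by (simp add: algebra_simps)
    then have "\<bar>?lhs\<bar> = D (?g i) * \<bar>?r\<bar>" using D1 by (simp only: abs_mult abs_of_nonneg)
    also have "\<dots> \<le> 1 * \<bar>?r\<bar>" using D1 by (intro mult_right_mono) auto
    also have "1 * \<bar>?r\<bar> \<le> \<bar>\<alpha> * ?h * (v (b (?g i)) - v (b (?g (Suc i))))\<bar> + \<bar>\<beta> * \<Delta> * (v 0 - v (b (?g (Suc i))))\<bar> +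
       \<bar>(exp (- x i) - 1 + x i) * v (b (?g (Suc i)))\<bar>"
      unfolding mult_1 by (intro order_trans[OF abs_triangle_ineq] add_right_mono abs_triangle_ineq)
    also have "\<dots> \<le> \<alpha> * ?h * \<epsilon> + \<beta> * \<Delta> * \<epsilon> + (\<epsilon> * x i) * C"
    proof (intro add_mono)
      show "\<bar>\<alpha> * ?h * (v (b (?g i)) - v (b (?g (Suc i))))\<bar> \<le> \<alpha> * ?h * \<epsilon>"
        unfolding abs_mult abs_of_nonneg[OF \<alpha>] abs_of_nonneg[OF h0]
        by (intro mult_left_mono eps(1) mult_nonneg_nonneg \<alpha> h0)
      show "\<bar>\<beta> * \<Delta> * (v 0 - v (b (?g (Suc i))))\<bar> \<le> \<beta> * \<Delta> * \<epsilon>"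
      proof (cases "\<Delta> = 0")
        case False
        then have "l (?g (Suc i)) \<noteq> l (?g i)" by (simp add: \<Delta>_def)
        \<comment> \<open>Growth of \<open>l\<close> forces a zero of the path inside the same cell,
          and there \<open>v 0\<close> is a value of \<open>v\<close> along the path. This is the
          discrete form of local time being carried by the zeros.\<close>
        then obtain u where u: "u \<in> {?g i..?g (Suc i)}" "b u = 0"
          using l_flat[of i n] i less_Suc_eq_le[of i n] by blast
        then have "\<bar>v (b u) - v (b (?g (Suc i)))\<bar> \<le> \<epsilon>"
          using \<epsilon>[OF _ gi(2) near[OF u(1)]] gi by auto
        then show ?thesis
          unfolding abs_mult u(2) using \<beta> \<Delta> by (intro mult_mono) auto
      qed simp
      have "\<bar>exp (- x i) - 1 + x i\<bar> \<le> \<epsilon> * x i"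
        using exp_minus_taylor[OF x0] mult_right_mono[OF eps(2) x0] by (simp add: power2_eq_square)
      then show "\<bar>(exp (- x i) - 1 + x i) * v (b (?g (Suc i)))\<bar> \<le> (\<epsilon> * x i) * C"
        unfolding abs_mult using v_le \<epsilon>0 x0 by (intro mult_mono) auto
    qed
    also have "\<dots> = (1 + C) * \<epsilon> * x i"
      unfolding x_def \<Delta>_def by (simp add: algebra_simps add_divide_distrib)
    finally show ?thesis .
  qed
  then have "\<bar>Z n + (\<Sum>i<Suc n. ?h * (D (?g i) * \<phi> (b (?g i))))\<bar> \<le> (\<Sum>i<Suc n. (1 + C) * \<epsilon> * x i)"
    unfolding Z_def sum.distrib[symmetric] by (intro order_trans[OF sum_abs] sum_mono)
  also have "\<dots> = (1 + C) * \<epsilon> * (\<alpha> * T + \<beta> * l T)"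
  proof -
    have "(\<Sum>i<Suc n. x i) = \<alpha> * T + \<beta> * l T"
      unfolding x_def sum.distrib sum_distrib_left[symmetric] sum_l by (simp del: sum.lessThan_Suc of_nat_Suc)
    then show ?thesis by (simp only: sum_distrib_left[symmetric])
  qed
  finally show ?thesis .
qed

lemma D_continuous: "continuous_on {0..T} D"
  unfolding D_def[abs_def] by (intro continuous_intros l)

text \<open>Uniform continuity supplies the hypothesis of \<open>Z_error\<close> for fine grids, so
  \<open>Z n\<close> is asymptotically minus a Riemann sum.\<close>

lemma Z_tendsto: "Z \<longlonglongrightarrow> - integral {0..T} (\<lambda>u. D u * \<phi> (b u))"
proof -
  let ?R = "\<lambda>n. \<Sum>i<Suc n. T / real (Suc n) * (D (grid 0 T n i) * \<phi> (b (grid 0 T n i)))"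
  have \<phi>b: "continuous_on {0..T} (\<lambda>u. \<phi> (b u))"
    using continuous_on_compose2[OF \<phi> b] by simp
  have vb: "continuous_on {0..T} (\<lambda>u. v (b u))"
    using continuous_on_compose2[OF v b] by simp
  have R: "?R \<longlonglongrightarrow> integral {0..T} (\<lambda>u. D u * \<phi> (b u))"
    by (rule riemann_sum_tendsto[OF T]) (intro continuous_intros D_continuous \<phi>b)
  have "(\<lambda>n. Z n + ?R n) \<longlonglongrightarrow> 0"
  proof (rule LIMSEQ_I)
    fix e :: real assume e: "0 < e"
    define M where "M = (1 + C) * (\<alpha> * T + \<beta> * l T)"
    have M: "0 \<le> M" using C_nonneg \<alpha> \<beta> T l_T_nonneg by (simp add: M_def)
    define \<epsilon> where "\<epsilon> = e / (M + 1)"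
    have \<epsilon>: "0 < \<epsilon>" "\<epsilon> * M < e" using e M by (auto simp: \<epsilon>_def field_simps)
    have "uniformly_continuous_on {0..T} (\<lambda>u. v (b u))"
      using vb by (intro compact_uniformly_continuous) auto
    then obtain d where d: "0 < d" "\<And>u u'. u \<in> {0..T} \<Longrightarrow> u' \<in> {0..T} \<Longrightarrow> dist u u' < d \<Longrightarrow> dist (v (b u)) (v (b u')) < \<epsilon>"
      unfolding uniformly_continuous_on_def using \<epsilon>(1) by metis
    have "uniformly_continuous_on {0..T} (\<lambda>u. \<alpha> * u + \<beta> * l u)"
      by (intro compact_uniformly_continuous continuous_intros l) auto
    then obtain d' where d': "0 < d'" "\<And>u u'. u \<in> {0..T} \<Longrightarrow> u' \<in> {0..T} \<Longrightarrow> dist u u' < d' \<Longrightarrow>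
        dist (\<alpha> * u + \<beta> * l u) (\<alpha> * u' + \<beta> * l u') < \<epsilon>"
      unfolding uniformly_continuous_on_def using \<epsilon>(1) by metis
    obtain N where N: "T / min d d' < real N" using reals_Archimedean2 by blast
    have "norm (Z n + ?R n - 0) < e" if n: "N \<le> n" for n
    proof -
      have "T / min d d' < real (Suc n)" using N n by simp
      then have h: "T / real (Suc n) < min d d'" using d(1) d'(1) by (simp add: divide_less_eq mult.commute del: of_nat_Suc min_less_iff_conj)
      have "\<bar>Z n + ?R n\<bar> \<le> (1 + C) * \<epsilon> * (\<alpha> * T + \<beta> * l T)"
      proof (rule Z_error)
        fix u u' assume u: "u \<in> {0..T}" "u' \<in> {0..T}" "\<bar>u - u'\<bar> \<le> T / real (Suc n)"
        then have "dist u u' < d" "dist u u' < d'" using h by (auto simp: dist_real_def)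
        from d(2)[OF u(1,2) this(1)] d'(2)[OF u(1,2) this(2)]
        show "\<bar>v (b u) - v (b u')\<bar> \<le> \<epsilon> \<and> \<bar>\<alpha> * u + \<beta> * l u - (\<alpha> * u' + \<beta> * l u')\<bar> \<le> \<epsilon>"
          by (simp add: dist_real_def)
      qed
      also have "\<dots> = \<epsilon> * M" by (simp add: M_def)
      finally show ?thesis using \<epsilon>(2) by simp
    qed
    then show "\<exists>N. \<forall>n\<ge>N. norm (Z n + ?R n - 0) < e" by blast
  qed
  from tendsto_diff[OF this R] show ?thesis by simp
qed

end

section \<open>Almost sure properties of the paths of local time\<close>

context brownian_local_time
begin

text \<open>Tanaka's formula at time \<open>0\<close> reduces to \<open>L 0 = - I\<close>. The
  simple integrals up to time \<open>0\<close> vanish identically, so their \<open>L^2\<close> limit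
  \<open>I\<close> vanishes almost surely.\<close>

lemma AE_local_time_0: "AE \<omega> in P x. L 0 \<omega> = 0"
proof -
  obtain I where I: "has_ito_integral (P x) F B 0 (\<lambda>s \<omega>. sgn (B s \<omega>)) I"
    "AE \<omega> in P x. \<bar>B 0 \<omega>\<bar> = \<bar>B 0 \<omega>\<bar> + I \<omega> + L 0 \<omega>"
    using local_time unfolding local_time_at_0_def by blast
  then obtain S where S: "\<And>k. simple_proc F (S k)"
    "(\<lambda>k. \<integral>\<^sup>+\<omega>. ennreal ((simple_proc_integral B (S k) 0 \<omega> - I \<omega>)\<^sup>2) \<partial>P x) \<longlonglongrightarrow> 0"
    and [measurable]: "I \<in> borel_measurable (P x)"
    unfolding has_ito_integral_def by blast
  have "simple_proc_integral B (S k) 0 \<omega> = 0" for k \<omega>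
  proof -
    obtain n \<tau> \<xi> where S_eq: "S k = (n, \<tau>, \<xi>)" by (cases "S k")
    note pos = simple_proc_times_nonneg[OF S(1)[of k, unfolded S_eq]]
    show ?thesis
      unfolding simple_proc_integral_def S_eq prod.case
      using pos by (intro sum.neutral) (auto simp: min_def Suc_le_eq)
  qed
  then have "(\<integral>\<^sup>+\<omega>. ennreal ((I \<omega>)\<^sup>2) \<partial>P x) = 0"
    using S(2) by (simp add: LIMSEQ_const_iff)
  then have "AE \<omega> in P x. I \<omega> = 0"
    by (subst (asm) nn_integral_0_iff_AE) auto
  with I(2) show ?thesis by eventually_elim simp
qed

text \<open>The null set outside which \<open>L s \<le> L t\<close> depends on the pair of times.
  Pairs of rationals need only one null set, and continuity of \<open>L\<close> extends the
  inequality to all times.\<close>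

lemma AE_local_time_mono: "AE \<omega> in P x. \<forall>s t. 0 \<le> s \<longrightarrow> s \<le> t \<longrightarrow> L s \<omega> \<le> L t \<omega>"
proof -
  have "AE \<omega> in P x. \<forall>p q :: rat. 0 \<le> p \<longrightarrow> p \<le> q \<longrightarrow> L (of_rat p) \<omega> \<le> L (of_rat q) \<omega>"
  proof (subst AE_all_countable, rule allI, subst AE_all_countable, rule allI)
    fix p q :: rat
    show "AE \<omega> in P x. 0 \<le> p \<longrightarrow> p \<le> q \<longrightarrow> L (of_rat p) \<omega> \<le> L (of_rat q) \<omega>"
      using local_time_increment(2)[of "of_rat p" "of_rat q" x]
      by (cases "0 \<le> p \<and> p \<le> q") (auto simp: of_rat_less_eq)
  qed
  then show ?thesis
    using AE_space
  proof eventually_elim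
    case (elim \<omega>)
    have c: "continuous_on {0..} (\<lambda>t. L t \<omega>)"
      using L_continuous elim(2) by (simp add: space_P)
    show ?case
    proof (intro allI impI, rule ccontr)
      fix s t :: real assume s: "0 \<le> s" and st: "s \<le> t" and "\<not> L s \<omega> \<le> L t \<omega>"
      then have lt: "L t \<omega> < L s \<omega>" by simp
      then have "s < t" using st by (cases "s = t") auto
      define e where "e = (L s \<omega> - L t \<omega>) / 2"
      have e: "0 < e" using lt by (simp add: e_def)
      obtain d1 where d1: "0 < d1" "\<And>u. 0 \<le> u \<Longrightarrow> dist u s < d1 \<Longrightarrow> dist (L u \<omega>) (L s \<omega>) < e"
        using c s e unfolding continuous_on_iff by (metis atLeast_iff)
      obtain d2 where d2: "0 < d2" "\<And>u. 0 \<le> u \<Longrightarrow> dist u t < d2 \<Longrightarrow> dist (L u \<omega>) (L t \<omega>) < e"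
        using c s st e unfolding continuous_on_iff by (metis atLeast_iff order_trans)
      \<comment> \<open>The bound \<open>(t - s) / 2\<close> keeps a rational just right of
        \<open>s\<close> below one just left of \<open>t\<close>, so that monotonicity at rationals
        applies to them.\<close>
      define d where "d = min (min d1 d2) ((t - s) / 2)"
      have d: "0 < d" "d \<le> d1" "d \<le> d2" "s + d \<le> t - d"
        using d1(1) d2(1) \<open>s < t\<close> by (auto simp: d_def min_def field_simps)
      obtain p where p: "s < real_of_rat p" "real_of_rat p < s + d" using of_rat_dense[of s "s + d"] d(1) by auto
      obtain q where q: "t - d < real_of_rat q" "real_of_rat q < t" using of_rat_dense[of "t - d" t] d(1) by auto
      have "0 < real_of_rat p" "real_of_rat p \<le> real_of_rat q" using p q s d by linarith+
      then have pq: "0 \<le> p" "p \<le> q" by (auto simp: of_rat_less_eq)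
      then have pq0: "0 \<le> real_of_rat p" "0 \<le> real_of_rat q" by auto
      have "dist (real_of_rat p) s < d1" "dist (real_of_rat q) t < d2"
        using p q d by (auto simp: dist_real_def)
      note near = d1(2)[OF pq0(1) this(1)] d2(2)[OF pq0(2) this(2)]
      have "L (real_of_rat p) \<omega> \<le> L (real_of_rat q) \<omega>" using elim(1) pq by simp
      with near show False by (auto simp: dist_real_def e_def abs_if split: if_splits)
    qed
  qed
qed

text \<open>For fixed \<open>T\<close> there are countably many grid cells, so one null set serves
  them all. The pathwise limit only asks for flatness on such cells.\<close>

lemma AE_local_time_flat:
  assumes "0 \<le> T"
  shows "AE \<omega> in P x. \<forall>n i. (\<forall>u\<in>{grid 0 T n i..grid 0 T n (Suc i)}. B u \<omega> \<noteq> 0) \<longrightarrow>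
    L (grid 0 T n (Suc i)) \<omega> = L (grid 0 T n i) \<omega>"
proof (subst AE_all_countable, rule allI, subst AE_all_countable, rule allI)
  fix n i
  show "AE \<omega> in P x. (\<forall>u\<in>{grid 0 T n i..grid 0 T n (Suc i)}. B u \<omega> \<noteq> 0) \<longrightarrow>
      L (grid 0 T n (Suc i)) \<omega> = L (grid 0 T n i) \<omega>"
    using grid_ge[OF assms, of n i] grid_mono[OF assms, of i "Suc i" n] by (intro local_time_increment(3)) auto
qed

lemma local_time_integrable: "0 \<le> t \<Longrightarrow> integrable (P x) (L t)"
proof -
  assume t: "0 \<le> t"
  interpret prob_space "P x" by (rule prob)
  have i: "integrable (P x) (\<lambda>\<omega>. L t \<omega> - L 0 \<omega>)"
    by (rule square_integrable_imp_integrable[OF _ local_time_increment(1)]) (use t in auto)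
  show ?thesis
    by (rule integrable_cong_AE_imp[OF i]) (use t AE_local_time_0[of x] in \<open>auto\<close>)
qed

end

section \<open>Second order expansion in expectation\<close>

context brownian_family
begin

text \<open>One step of Ito's formula under the expectation. The weight \<open>D\<close> is known at
  time \<open>s\<close>, so the first order term has mean zero and the squared increment may be
  replaced by \<open>t - s\<close>. The remainder costs a second and a fourth moment. The growth
  bounds on \<open>w\<close> and \<open>w1\<close> serve integrability.\<close>

lemma taylor_expectation:
  assumes st: "0 \<le> s" "s \<le> t" and D: "D \<in> borel_measurable (F s)" "\<And>\<omega>. \<bar>D \<omega>\<bar> \<le> 1"
    and w: "\<And>y. (w has_real_derivative w1 y) (at y)" "\<And>y. (w1 has_real_derivative w2 y) (at y)"
    and w_le: "\<And>y. \<bar>w y\<bar> \<le> M * (1 + \<bar>y\<bar>)" and w1_le: "\<And>y. \<bar>w1 y\<bar> \<le> M"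
    and K: "\<And>y. \<bar>w2 y\<bar> \<le> K" and w2: "w2 \<in> borel_measurable borel"
    and \<eta>: "0 < \<eta>" "\<And>y z. \<bar>y - z\<bar> < \<eta> \<Longrightarrow> \<bar>w2 y - w2 z\<bar> \<le> \<epsilon>"
  shows "integrable (P x) (\<lambda>\<omega>. D \<omega> * (w (B t \<omega>) - w (B s \<omega>)))"
    and "\<bar>(\<integral>\<omega>. D \<omega> * (w (B t \<omega>) - w (B s \<omega>)) \<partial>P x) - (t - s) * (\<integral>\<omega>. D \<omega> * (w2 (B s \<omega>) / 2) \<partial>P x)\<bar> \<le>
      \<epsilon> * (t - s) + K / \<eta>\<^sup>2 * (3 * (t - s)\<^sup>2)"
proof -
  interpret prob_space "P x" by (rule prob)
  have t: "0 \<le> t" using st by simp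
  let ?d = "\<lambda>\<omega>. B t \<omega> - B s \<omega>"
  have wm: "w \<in> borel_measurable borel" "w1 \<in> borel_measurable borel"
    using w by (auto intro!: borel_measurable_continuous_onI DERIV_continuous_on intro: has_field_derivative_at_within)
  note [measurable] = wm w2
  have DP [measurable]: "D \<in> borel_measurable (P x)" using measurable_F_P[OF D(1) st(1)] .
  have Db: "bounded (D ` S)" for S using D(2) by (auto simp: bounded_iff)
  have w1b: "bounded ((\<lambda>\<omega>. w1 (B s \<omega>)) ` S)" for S using w1_le by (auto simp: bounded_iff)
  have w2b: "bounded ((\<lambda>\<omega>. w2 (B s \<omega>)) ` S)" for S using K by (auto simp: bounded_iff)
  have wi: "integrable (P x) (\<lambda>\<omega>. w (B u \<omega>))" if "0 \<le> u" for u
  proof (rule Bochner_Integration.integrable_bound)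
    show "integrable (P x) (\<lambda>\<omega>. M * (1 + \<bar>B u \<omega>\<bar>))" using B_integrable[OF that, of x] by simp
    show "AE \<omega> in P x. norm (w (B u \<omega>)) \<le> norm (M * (1 + \<bar>B u \<omega>\<bar>))"
      using w_le by (intro AE_I2) (metis abs_ge_self order_trans real_norm_def)
  qed (use that in simp)
  have 1: "integrable (P x) (\<lambda>\<omega>. D \<omega> * (w (B t \<omega>) - w (B s \<omega>)))"
    using wi[OF t] wi[OF st(1)] by (intro integrable_bounded_mult Db) auto
  then show "integrable (P x) (\<lambda>\<omega>. D \<omega> * (w (B t \<omega>) - w (B s \<omega>)))" .
  have m1: "(\<lambda>\<omega>. D \<omega> * w1 (B s \<omega>)) \<in> borel_measurable (F s)" "(\<lambda>\<omega>. D \<omega> * w2 (B s \<omega>)) \<in> borel_measurable (F s)"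
    using D(1) adapted[OF st(1)] by simp_all
  have i1: "integrable (P x) (\<lambda>\<omega>. D \<omega> * w1 (B s \<omega>))" "integrable (P x) (\<lambda>\<omega>. D \<omega> * w2 (B s \<omega>))"
    using bounded_image_mult[OF Db w1b] bounded_image_mult[OF Db w2b] st by (auto intro!: integrable_bounded)
  have 2: "integrable (P x) (\<lambda>\<omega>. D \<omega> * w1 (B s \<omega>) * ?d \<omega>)" "(\<integral>\<omega>. D \<omega> * w1 (B s \<omega>) * ?d \<omega> \<partial>P x) = 0"
    using increment_mult[OF st m1(1) i1(1), of 1] increment_moments(1)[OF st, of x] by auto
  have 3: "integrable (P x) (\<lambda>\<omega>. D \<omega> * w2 (B s \<omega>) * (?d \<omega>)\<^sup>2)"
    "(\<integral>\<omega>. D \<omega> * w2 (B s \<omega>) * (?d \<omega>)\<^sup>2 \<partial>P x) = (\<integral>\<omega>. D \<omega> * w2 (B s \<omega>) \<partial>P x) * (t - s)"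
    using increment_mult[OF st m1(2) i1(2), of 2] increment_moments(2)[OF st, of x] by auto
  define R where "R \<omega> = D \<omega> * (w (B t \<omega>) - w (B s \<omega>) - w1 (B s \<omega>) * ?d \<omega> - w2 (B s \<omega>) * (?d \<omega>)\<^sup>2 / 2)" for \<omega>
  have R_eq: "R \<omega> = D \<omega> * (w (B t \<omega>) - w (B s \<omega>)) - D \<omega> * w1 (B s \<omega>) * ?d \<omega> - D \<omega> * w2 (B s \<omega>) * (?d \<omega>)\<^sup>2 / 2" for \<omega>
    by (simp add: R_def algebra_simps)
  have Ri: "integrable (P x) R"
    unfolding R_eq[abs_def] using 1 2(1) 3(1) by simp
  have "(\<integral>\<omega>. R \<omega> \<partial>P x) = (\<integral>\<omega>. D \<omega> * (w (B t \<omega>) - w (B s \<omega>)) \<partial>P x) - (\<integral>\<omega>. D \<omega> * w1 (B s \<omega>) * ?d \<omega> \<partial>P x) -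
      (\<integral>\<omega>. D \<omega> * w2 (B s \<omega>) * (?d \<omega>)\<^sup>2 / 2 \<partial>P x)"
    unfolding R_eq using 1 2(1) 3(1) by (subst Bochner_Integration.integral_diff; simp)+
  also have "\<dots> = (\<integral>\<omega>. D \<omega> * (w (B t \<omega>) - w (B s \<omega>)) \<partial>P x) - (t - s) * (\<integral>\<omega>. D \<omega> * (w2 (B s \<omega>) / 2) \<partial>P x)"
    using 2(2) 3(2) by simp
  finally have eq: "(\<integral>\<omega>. R \<omega> \<partial>P x) =
      (\<integral>\<omega>. D \<omega> * (w (B t \<omega>) - w (B s \<omega>)) \<partial>P x) - (t - s) * (\<integral>\<omega>. D \<omega> * (w2 (B s \<omega>) / 2) \<partial>P x)" .
  have Rle: "\<bar>R \<omega>\<bar> \<le> \<epsilon> * (?d \<omega>)\<^sup>2 + K / \<eta>\<^sup>2 * (?d \<omega>) ^ 4" for \<omega>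
  proof -
    have "\<bar>R \<omega>\<bar> \<le> 1 * \<bar>w (B t \<omega>) - w (B s \<omega>) - w1 (B s \<omega>) * ?d \<omega> - w2 (B s \<omega>) * (?d \<omega>)\<^sup>2 / 2\<bar>"
      unfolding R_def abs_mult using D(2) by (intro mult_right_mono) auto
    also have "\<dots> \<le> \<epsilon> * (?d \<omega>)\<^sup>2 + K / \<eta>\<^sup>2 * (?d \<omega>) ^ 4"
      using taylor_order2_error[OF w K \<eta>, where y = "B s \<omega>" and d = "?d \<omega>"] by simp
    finally show ?thesis .
  qed
  have "\<bar>\<integral>\<omega>. R \<omega> \<partial>P x\<bar> \<le> (\<integral>\<omega>. \<bar>R \<omega>\<bar> \<partial>P x)" by (rule integral_abs_bound)
  also have "\<dots> \<le> (\<integral>\<omega>. \<epsilon> * (?d \<omega>)\<^sup>2 + K / \<eta>\<^sup>2 * (?d \<omega>) ^ 4 \<partial>P x)"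
    using Ri Rle increment_power_integrable[OF st, of x] by (intro integral_mono) auto
  also have "\<dots> = \<epsilon> * (t - s) + K / \<eta>\<^sup>2 * (3 * (t - s)\<^sup>2)"
    using increment_power_integrable[OF st, of x] increment_moments(2,3)[OF st, of x] by simp
  finally show "\<bar>(\<integral>\<omega>. D \<omega> * (w (B t \<omega>) - w (B s \<omega>)) \<partial>P x) - (t - s) * (\<integral>\<omega>. D \<omega> * (w2 (B s \<omega>) / 2) \<partial>P x)\<bar> \<le>
      \<epsilon> * (t - s) + K / \<eta>\<^sup>2 * (3 * (t - s)\<^sup>2)"
    unfolding eq .
qed

end

text \<open>Up to the factor \<alpha> this is \<open>erlang_density 0 \<alpha>\<close>, whose
  moments are known.\<close>

lemma integrable_exp_decay:
  assumes "0 < (\<alpha> :: real)"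
  shows "integrable lborel (\<lambda>u. indicator {0..} u * exp (- \<alpha> * u))"
proof (rule integrableI_bounded)
  have "(\<integral>\<^sup>+u. ennreal (norm (indicator {0..} u * exp (- \<alpha> * u))) \<partial>lborel) =
      (\<integral>\<^sup>+u. ennreal (1 / \<alpha>) * ennreal (erlang_density 0 \<alpha> u * u ^ 0) \<partial>lborel)"
    using assms by (intro nn_integral_cong) (auto simp: erlang_density_def indicator_def ennreal_mult[symmetric])
  also have "\<dots> = ennreal (1 / \<alpha>) * ennreal (fact (0 + 0) / (fact 0 * \<alpha> ^ 0))"
    by (subst nn_integral_cmult) (use nn_integral_erlang_ith_moment[OF assms, of 0 0] in simp_all)
  also have "\<dots> < \<infinity>" by (simp add: ennreal_mult_less_top)
  finally show "(\<integral>\<^sup>+u. ennreal (norm (indicator {0..} u * exp (- \<alpha> * u))) \<partial>lborel) < \<infinity>" .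
qed simp

section \<open>The Feynman-Kac identity\<close>

text \<open>The coefficient \<open>\<beta> * v 0\<close> is half the jump of the slope of
  \<open>v\<close> at \<open>0\<close>, and \<open>\<beta> = 0\<close> is the reflecting boundary
  condition. Taking the kink off the bounded function \<open>v\<close> leaves a \<open>w\<close>
  that may grow linearly, which is why its bound has the form
  \<open>M * (1 + \<bar>y\<bar>)\<close>.\<close>

locale resolvent_solution =
  fixes \<alpha> \<beta> C M :: real and \<phi> v w w1 w2 :: "real \<Rightarrow> real"
  assumes \<alpha>: "0 < \<alpha>" and \<beta>: "0 \<le> \<beta>"
    and \<phi>: "continuous_on UNIV \<phi>" and \<phi>_le: "\<And>y. \<bar>\<phi> y\<bar> \<le> C" and v_le: "\<And>y. \<bar>v y\<bar> \<le> C"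
    and v_eq: "\<And>y. v y = w y + \<beta> * v 0 * \<bar>y\<bar>"
    and w_deriv: "\<And>y. (w has_real_derivative w1 y) (at y)" "\<And>y. (w1 has_real_derivative w2 y) (at y)"
    and w_le: "\<And>y. \<bar>w y\<bar> \<le> M * (1 + \<bar>y\<bar>)" and w1_le: "\<And>y. \<bar>w1 y\<bar> \<le> M"
    and w2_eq: "\<And>y. w2 y / 2 = \<alpha> * v y - \<phi> y"
    and w2_uc: "uniformly_continuous_on UNIV w2"
begin

lemma v_continuous: "continuous_on UNIV v"
proof -
  have "continuous_on UNIV w"
    using w_deriv(1) by (auto intro!: DERIV_continuous_on intro: has_field_derivative_at_within)
  then have "continuous_on UNIV (\<lambda>y. w y + \<beta> * v 0 * \<bar>y\<bar>)"
    by (intro continuous_intros)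
  then show ?thesis unfolding v_eq[symmetric] .
qed

lemma w2_le: "\<bar>w2 y\<bar> \<le> 2 * (\<alpha> + 1) * C"
proof -
  have "w2 y = 2 * (\<alpha> * v y - \<phi> y)" using w2_eq[of y] by simp
  moreover have "\<bar>\<alpha> * v y - \<phi> y\<bar> \<le> \<alpha> * \<bar>v y\<bar> + \<bar>\<phi> y\<bar>"
    using abs_triangle_ineq4[of "\<alpha> * v y" "\<phi> y"] \<alpha> by (simp add: abs_mult)
  moreover have "\<alpha> * \<bar>v y\<bar> \<le> \<alpha> * C" using v_le \<alpha> by (intro mult_left_mono) auto
  ultimately show ?thesis using \<phi>_le[of y] by (simp add: abs_mult algebra_simps)
qed

end

context brownian_local_time
begin

text \<open>\<open>L\<close> is nonnegative only almost surely. The absolute value bounds the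
  discount by \<open>exp (- \<alpha> * u)\<close> at every \<omega> when
  \<open>\<beta> \<ge> 0\<close>, so no exceptional set has to be carried through the integrability
  arguments.\<close>

definition disc :: "real \<Rightarrow> real \<Rightarrow> real \<Rightarrow> 'a \<Rightarrow> real" where
  "disc \<alpha> \<beta> u \<omega> = exp (- \<alpha> * u - \<beta> * \<bar>L u \<omega>\<bar>)"

lemma disc_nonneg: "0 \<le> disc \<alpha> \<beta> u \<omega>"
  by (simp add: disc_def)

lemma disc_le: "0 \<le> \<beta> \<Longrightarrow> disc \<alpha> \<beta> u \<omega> \<le> exp (- \<alpha> * u)"
  by (simp add: disc_def)

lemma disc_le_1: "0 \<le> \<alpha> \<Longrightarrow> 0 \<le> \<beta> \<Longrightarrow> 0 \<le> u \<Longrightarrow> \<bar>disc \<alpha> \<beta> u \<omega>\<bar> \<le> 1"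
  using disc_le[of \<beta> \<alpha> u \<omega>] disc_nonneg[of \<alpha> \<beta> u \<omega>]
  by (simp add: order_trans[of _ "exp (- \<alpha> * u)" 1])

lemma disc_F: "0 \<le> u \<Longrightarrow> disc \<alpha> \<beta> u \<in> borel_measurable (F u)"
  using L_F[of u u] unfolding disc_def[abs_def] by simp

lemma disc_P [measurable]: "0 \<le> u \<Longrightarrow> disc \<alpha> \<beta> u \<in> borel_measurable (P x)"
  unfolding disc_def[abs_def] by simp

lemma L_joint_measurable: "(\<lambda>(u, \<omega>). L (max 0 u) \<omega>) \<in> borel_measurable (lborel \<Otimes>\<^sub>M P x)"
  using L_continuous by (intro borel_measurable_continuous_paths) (auto simp: space_P)

lemma integrand_joint_measurable:
  assumes "continuous_on UNIV \<phi>"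
  shows "(\<lambda>(\<omega>, u). indicator {0..} u * (disc \<alpha> \<beta> (max 0 u) \<omega> * \<phi> (B (max 0 u) \<omega>))) \<in>
    borel_measurable (P x \<Otimes>\<^sub>M lborel)"
proof -
  have [measurable]: "\<phi> \<in> borel_measurable borel"
    using assms by (rule borel_measurable_continuous_onI)
  have [measurable]: "(\<lambda>p. L (max 0 (snd p)) (fst p)) \<in> borel_measurable (P x \<Otimes>\<^sub>M lborel)"
    "(\<lambda>p. B (max 0 (snd p)) (fst p)) \<in> borel_measurable (P x \<Otimes>\<^sub>M lborel)"
    using measurable_pair_swap[OF L_joint_measurable] measurable_pair_swap[OF B_joint_measurable]
    by (simp_all add: case_prod_unfold)
  show ?thesis
    unfolding disc_def case_prod_unfold by measurable
qed

lemma discounted_integral_measurable: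
  assumes "continuous_on UNIV \<phi>"
  shows "(\<lambda>\<omega>. LINT u:{0..T}|lborel. disc \<alpha> \<beta> u \<omega> * \<phi> (B u \<omega>)) \<in> borel_measurable (P x)"
proof -
  let ?k = "\<lambda>\<omega> u. indicator {0..} u * (disc \<alpha> \<beta> (max 0 u) \<omega> * \<phi> (B (max 0 u) \<omega>))"
  have "(\<lambda>(\<omega>, u). indicator {0..T} u * (?k \<omega> u)) \<in>
    borel_measurable (P x \<Otimes>\<^sub>M lborel)"
    using integrand_joint_measurable[OF assms, of \<alpha> \<beta> x] by (auto simp: case_prod_unfold)
  then have "(\<lambda>\<omega>. LBINT u. indicator {0..T} u * (?k \<omega> u)) \<in> borel_measurable (P x)"
    by (rule lborel.borel_measurable_lebesgue_integral)
  moreover have "(LBINT u. indicator {0..T} u * (?k \<omega> u)) =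
      (LINT u:{0..T}|lborel. disc \<alpha> \<beta> u \<omega> * \<phi> (B u \<omega>))" for \<omega>
    unfolding set_lebesgue_integral_def
    by (intro Bochner_Integration.integral_cong) (auto simp: indicator_def)
  ultimately show ?thesis by simp
qed

text \<open>The increment \<open>Y\<close> splits into \<open>disc\<close> at \<open>s\<close> times
  the increment of \<open>w (B)\<close>, the same weight times \<open>\<beta> * v 0\<close> times
  the increment of \<open>\<bar>B\<bar>\<close>, and the change of \<open>disc\<close> times
  \<open>v (B t)\<close>. The first is expanded by Taylor, the second has exactly the mean of the
  corresponding local time term, and the third is copied into \<open>Z\<close>. The only error is
  therefore that of the Taylor expansion.\<close>

lemma discounted_increment:
  assumes "resolvent_solution \<alpha> \<beta> C M \<phi> v w w1 w2" and st: "0 \<le> s" "s \<le> t"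
    and \<eta>: "0 < \<eta>" "\<And>y z. \<bar>y - z\<bar> < \<eta> \<Longrightarrow> \<bar>w2 y - w2 z\<bar> \<le> \<epsilon>"
  defines "Y \<equiv> \<lambda>\<omega>. disc \<alpha> \<beta> t \<omega> * v (B t \<omega>) - disc \<alpha> \<beta> s \<omega> * v (B s \<omega>)"
    and "Z \<equiv> \<lambda>\<omega>. (t - s) * (disc \<alpha> \<beta> s \<omega> * (\<alpha> * v (B s \<omega>) - \<phi> (B s \<omega>))) +
      \<beta> * v 0 * (disc \<alpha> \<beta> s \<omega> * (L t \<omega> - L s \<omega>)) + (disc \<alpha> \<beta> t \<omega> - disc \<alpha> \<beta> s \<omega>) * v (B t \<omega>)"
  shows "integrable (P x) Y" "integrable (P x) Z"
    and "\<bar>(\<integral>\<omega>. Y \<omega> \<partial>P x) - (\<integral>\<omega>. Z \<omega> \<partial>P x)\<bar> \<le>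
      \<epsilon> * (t - s) + (2 * (\<alpha> + 1) * C) / \<eta>\<^sup>2 * (3 * (t - s)\<^sup>2)"
proof -
  interpret resolvent_solution \<alpha> \<beta> C M \<phi> v w w1 w2 by fact
  interpret prob_space "P x" by (rule prob)
  have t: "0 \<le> t" using st by simp
  let ?D = "disc \<alpha> \<beta>"
  let ?EC = "\<integral>\<omega>. (?D t \<omega> - ?D s \<omega>) * v (B t \<omega>) \<partial>P x"
  let ?DL = "\<lambda>\<omega>. ?D s \<omega> * (L t \<omega> - L s \<omega>)" and ?DB = "\<lambda>\<omega>. ?D s \<omega> * (\<bar>B t \<omega>\<bar> - \<bar>B s \<omega>\<bar>)"
  let ?D2 = "\<lambda>\<omega>. ?D s \<omega> * (w2 (B s \<omega>) / 2)" and ?e = "\<epsilon> * (t - s) + (2 * (\<alpha> + 1) * C) / \<eta>\<^sup>2 * (3 * (t - s)\<^sup>2)"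
  have [measurable]: "v \<in> borel_measurable borel" "w2 \<in> borel_measurable borel" "\<phi> \<in> borel_measurable borel"
    using v_continuous uniformly_continuous_imp_continuous[OF w2_uc] \<phi> by (auto intro: borel_measurable_continuous_onI)
  have Db: "bounded (?D u ` S)" if "0 \<le> u" for u S
    using disc_le_1[of \<alpha> \<beta> u] \<alpha> \<beta> that by (auto simp: bounded_iff)
  have vb: "bounded ((\<lambda>\<omega>. v (B u \<omega>)) ` S)" for u S using v_le by (auto simp: bounded_iff)
  have w2b: "bounded ((\<lambda>\<omega>. w2 (B u \<omega>) / 2) ` S)" for u S
  proof -
    have "norm (w2 y / 2) \<le> 2 * (\<alpha> + 1) * C" for y
      using w2_le[of y] by (simp add: abs_le_iff)
    then show ?thesis unfolding bounded_iff by blast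
  qed
  have Dv: "integrable (P x) (\<lambda>\<omega>. ?D a \<omega> * v (B u \<omega>))" if "0 \<le> a" "0 \<le> u" for a u
    using bounded_image_mult[OF Db[OF that(1)] vb] that by (intro integrable_bounded) auto
  have Dw: "integrable (P x) (\<lambda>\<omega>. ?D2 \<omega>)"
    using bounded_image_mult[OF Db[OF st(1)] w2b] st by (intro integrable_bounded) auto
  have DL: "integrable (P x) (\<lambda>\<omega>. ?DL \<omega>)"
    using local_time_integrable[OF t, of x] local_time_integrable[OF st(1), of x] Db[OF st(1)] st
    by (intro integrable_bounded_mult) auto
  have DB: "integrable (P x) (\<lambda>\<omega>. ?DB \<omega>)"
    using B_integrable[OF t, of x] B_integrable[OF st(1), of x] Db[OF st(1)] st
    by (intro integrable_bounded_mult) auto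
  show Yi: "integrable (P x) Y" unfolding Y_def using Dv st t by simp
  have cI: "integrable (P x) (\<lambda>\<omega>. (?D t \<omega> - ?D s \<omega>) * v (B t \<omega>))"
    unfolding left_diff_distrib using Dv st t by simp
  have i1: "integrable (P x) (\<lambda>\<omega>. (t - s) * (?D2 \<omega>))"
    by (rule integrable_mult_right[OF Dw])
  have i2: "integrable (P x) (\<lambda>\<omega>. \<beta> * v 0 * (?DL \<omega>))"
    by (rule integrable_mult_right[OF DL])
  show "integrable (P x) Z"
    unfolding Z_def w2_eq[symmetric]
    by (rule Bochner_Integration.integrable_add[OF Bochner_Integration.integrable_add[OF i1 i2] cI])
  have T1: "integrable (P x) (\<lambda>\<omega>. ?D s \<omega> * (w (B t \<omega>) - w (B s \<omega>)))"
    and T2: "\<bar>(\<integral>\<omega>. ?D s \<omega> * (w (B t \<omega>) - w (B s \<omega>)) \<partial>P x) - (t - s) * (\<integral>\<omega>. ?D2 \<omega> \<partial>P x)\<bar> \<le>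
      ?e"
    by (rule taylor_expectation[OF st disc_F[OF st(1)] disc_le_1 w_deriv w_le w1_le w2_le _ \<eta>];
        use \<alpha> \<beta> st in simp)+
  have "Y \<omega> = ?D s \<omega> * (w (B t \<omega>) - w (B s \<omega>)) + \<beta> * v 0 * (?DB \<omega>) +
      (?D t \<omega> - ?D s \<omega>) * v (B t \<omega>)" for \<omega>
    unfolding Y_def v_eq[of "B t \<omega>"] v_eq[of "B s \<omega>"] by (simp add: algebra_simps)
  then have "(\<integral>\<omega>. Y \<omega> \<partial>P x) = (\<integral>\<omega>. ?D s \<omega> * (w (B t \<omega>) - w (B s \<omega>)) \<partial>P x) +
      \<beta> * v 0 * (\<integral>\<omega>. ?DB \<omega> \<partial>P x) + ?EC"
    using T1 DB cI by simp
  moreover have "(\<integral>\<omega>. Z \<omega> \<partial>P x) = (t - s) * (\<integral>\<omega>. ?D2 \<omega> \<partial>P x) +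
      \<beta> * v 0 * (\<integral>\<omega>. ?DL \<omega> \<partial>P x) + ?EC"
    unfolding Z_def w2_eq[symmetric]
      Bochner_Integration.integral_add[OF Bochner_Integration.integrable_add[OF i1 i2] cI]
      Bochner_Integration.integral_add[OF i1 i2] Bochner_Integration.integral_mult_right_zero ..
  moreover have "(\<integral>\<omega>. ?DL \<omega> \<partial>P x) = (\<integral>\<omega>. ?DB \<omega> \<partial>P x)"
    by (rule local_time_increment(4)[OF st disc_F[OF st(1)] Db[OF st(1)]])
  ultimately show "\<bar>(\<integral>\<omega>. Y \<omega> \<partial>P x) - (\<integral>\<omega>. Z \<omega> \<partial>P x)\<bar> \<le>
      ?e"
    using T2 by simp
qed

text \<open>On every grid the means of the increments \<open>Y\<close> telescope to the left side,
  while the sums of the \<open>Z\<close> converge in mean to minus the discounted integral. The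
  accumulated Taylor error tends to \<open>\<epsilon> * T\<close> as the mesh vanishes, and
  \<epsilon> is arbitrary.\<close>

lemma feynman_kac_finite:
  assumes "resolvent_solution \<alpha> \<beta> C M \<phi> v w w1 w2" and T: "0 \<le> T"
  shows "(\<integral>\<omega>. disc \<alpha> \<beta> T \<omega> * v (B T \<omega>) \<partial>P x) - v x =
    - (\<integral>\<omega>. (LINT u:{0..T}|lborel. disc \<alpha> \<beta> u \<omega> * \<phi> (B u \<omega>)) \<partial>P x)"
proof -
  interpret resolvent_solution \<alpha> \<beta> C M \<phi> v w w1 w2 by fact
  interpret prob_space "P x" by (rule prob)
  let ?D = "disc \<alpha> \<beta>"
  let ?g = "grid 0 T"
  let ?I = "\<lambda>\<omega>. LINT u:{0..T}|lborel. ?D u \<omega> * \<phi> (B u \<omega>)"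
  define Y where "Y n i \<omega> = ?D (?g n (Suc i)) \<omega> * v (B (?g n (Suc i)) \<omega>) -
    ?D (?g n i) \<omega> * v (B (?g n i) \<omega>)" for n i \<omega>
  define Z where "Z n i \<omega> = (?g n (Suc i) - ?g n i) *
      (?D (?g n i) \<omega> * (\<alpha> * v (B (?g n i) \<omega>) - \<phi> (B (?g n i) \<omega>))) +
      \<beta> * v 0 * (?D (?g n i) \<omega> * (L (?g n (Suc i)) \<omega> - L (?g n i) \<omega>)) +
      (?D (?g n (Suc i)) \<omega> - ?D (?g n i) \<omega>) * v (B (?g n (Suc i)) \<omega>)" for n i \<omega>
  define S where "S n \<omega> = (\<Sum>i<Suc n. Z n i \<omega>)" for n \<omega>
  have g: "0 \<le> ?g n i" "?g n i \<le> ?g n (Suc i)" for n i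
    using grid_ge[OF T, of n i] grid_mono[OF T, of i "Suc i" n] by auto
  have inc: "integrable (P x) (Y n i)" "integrable (P x) (Z n i)"
    "\<lbrakk>0 < \<eta>; \<And>y z. \<bar>y - z\<bar> < \<eta> \<Longrightarrow> \<bar>w2 y - w2 z\<bar> \<le> \<epsilon>\<rbrakk> \<Longrightarrow>
      \<bar>(\<integral>\<omega>. Y n i \<omega> \<partial>P x) - (\<integral>\<omega>. Z n i \<omega> \<partial>P x)\<bar> \<le>
      \<epsilon> * (T / real (Suc n)) + (2 * (\<alpha> + 1) * C) / \<eta>\<^sup>2 * (3 * (T / real (Suc n))\<^sup>2)" for n i \<eta> \<epsilon>
  proof -
    \<comment> \<open>For integrability alone any modulus will do, so the global bound on
      \<open>w2\<close> is used with \<open>\<eta> = 1\<close>.\<close>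
    have unif: "\<bar>w2 y - w2 z\<bar> \<le> 2 * (\<alpha> + 1) * C + 2 * (\<alpha> + 1) * C" for y z
      using w2_le[of y] w2_le[of z] by linarith
    show "integrable (P x) (Y n i)" "integrable (P x) (Z n i)"
      unfolding Y_def[abs_def] Z_def[abs_def]
      by (rule discounted_increment(1)[OF assms(1) g zero_less_one unif],
        rule discounted_increment(2)[OF assms(1) g zero_less_one unif])
    assume \<eta>: "0 < \<eta>" and close: "\<And>y z. \<bar>y - z\<bar> < \<eta> \<Longrightarrow> \<bar>w2 y - w2 z\<bar> \<le> \<epsilon>"
    show "\<bar>(\<integral>\<omega>. Y n i \<omega> \<partial>P x) - (\<integral>\<omega>. Z n i \<omega> \<partial>P x)\<bar> \<le>
      \<epsilon> * (T / real (Suc n)) + (2 * (\<alpha> + 1) * C) / \<eta>\<^sup>2 * (3 * (T / real (Suc n))\<^sup>2)"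
      unfolding Y_def Z_def grid_step diff_zero
      by (rule discounted_increment(3)[OF assms(1) g \<eta> close, unfolded grid_step diff_zero])
  qed
  have vm [measurable]: "v \<in> borel_measurable borel"
    using v_continuous by (rule borel_measurable_continuous_onI)
  have Dv: "integrable (P x) (\<lambda>\<omega>. ?D u \<omega> * v (B u \<omega>))" if "0 \<le> u" for u
  proof (rule integrable_bounded)
    show "(\<lambda>\<omega>. ?D u \<omega> * v (B u \<omega>)) \<in> borel_measurable (P x)" using that by simp
    show "bounded ((\<lambda>\<omega>. ?D u \<omega> * v (B u \<omega>)) ` space A)"
      using disc_le_1[of \<alpha> \<beta> u] \<alpha> \<beta> that v_le by (intro bounded_image_mult) (auto simp: bounded_iff)
  qed
  have tele: "(\<integral>\<omega>. ?D T \<omega> * v (B T \<omega>) \<partial>P x) - v x = (\<Sum>i<Suc n. \<integral>\<omega>. Y n i \<omega> \<partial>P x)" for n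
  proof -
    have "(\<Sum>i<Suc n. \<integral>\<omega>. Y n i \<omega> \<partial>P x) = (\<integral>\<omega>. (\<Sum>i<Suc n. Y n i \<omega>) \<partial>P x)"
      using inc(1) by (intro Bochner_Integration.integral_sum[symmetric])
    also have "\<dots> = (\<integral>\<omega>. ?D T \<omega> * v (B T \<omega>) - ?D 0 \<omega> * v (B 0 \<omega>) \<partial>P x)"
      unfolding Y_def using sum_lessThan_telescope[of "\<lambda>i. ?D (?g n i) _ * v (B (?g n i) _)" "Suc n"]
      by (simp del: sum.lessThan_Suc)
    also have "\<dots> = (\<integral>\<omega>. ?D T \<omega> * v (B T \<omega>) \<partial>P x) - (\<integral>\<omega>. ?D 0 \<omega> * v (B 0 \<omega>) \<partial>P x)"
      using Dv T by simp
    also have "(\<integral>\<omega>. ?D 0 \<omega> * v (B 0 \<omega>) \<partial>P x) = (\<integral>\<omega>. v x \<partial>P x)"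
      using AE_start[of x] AE_local_time_0[of x]
      by (intro integral_cong_AE) (auto simp: disc_def)
    finally show ?thesis by (simp add: prob_space)
  qed
  have ES: "(\<integral>\<omega>. S n \<omega> \<partial>P x) = (\<Sum>i<Suc n. \<integral>\<omega>. Z n i \<omega> \<partial>P x)" for n
    unfolding S_def using inc(2) by (intro Bochner_Integration.integral_sum)
  have S_lim: "(\<lambda>n. \<integral>\<omega>. S n \<omega> \<partial>P x) \<longlonglongrightarrow> (\<integral>\<omega>. - ?I \<omega> \<partial>P x)"
  proof -
    have ae: "AE \<omega> in P x. (\<forall>n. \<bar>S n \<omega>\<bar> \<le> T * ((\<alpha> + 1) * C) + \<beta> * C * L T \<omega> + C) \<and> (\<lambda>n. S n \<omega>) \<longlonglongrightarrow> - ?I \<omega>"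
      using AE_local_time_mono[of x] AE_local_time_0[of x] AE_local_time_flat[OF T, of x] AE_space
    proof eventually_elim
      case (elim \<omega>)
      have \<omega>: "\<omega> \<in> space A" using elim(4) by (simp add: space_P)
      have L0: "0 \<le> L u \<omega>" if "0 \<le> u" for u using elim(1,2) that by (metis order_refl)
      \<comment> \<open>Off the exceptional sets the path meets the deterministic hypotheses, and
        the absolute value in \<open>disc\<close> disappears because \<open>L\<close> is nonnegative
        there.\<close>
      interpret kp: killed_path T \<alpha> \<beta> C "\<lambda>u. B u \<omega>" "\<lambda>u. L u \<omega>" v \<phi>
      proof
        show "continuous_on {0..T} (\<lambda>u. B u \<omega>)" "continuous_on {0..T} (\<lambda>u. L u \<omega>)"
          using continuous_on_subset[OF paths[OF \<omega>], of "{0..T}"] continuous_on_subset[OF L_continuous[OF \<omega>], of "{0..T}"]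
          by auto
        show "L (?g n i) \<omega> \<le> L (?g n (Suc i)) \<omega>" for n i
          using elim(1) g by blast
      qed (use T \<alpha> \<beta> elim(2,3) v_continuous \<phi> v_le \<phi>_le in auto)
      have D_eq: "kp.D u = ?D u \<omega>" if "0 \<le> u" for u
        using L0[OF that] by (simp add: kp.D_def disc_def)
      have S_eq: "S n \<omega> = kp.Z n" for n
        unfolding S_def Z_def kp.Z_def grid_step D_eq[OF g(1)] by simp
      have c: "continuous_on {0..T} (\<lambda>u. kp.D u * \<phi> (B u \<omega>))"
        using continuous_on_compose2[OF \<phi> kp.b] by (intro continuous_intros kp.D_continuous) simp
      have "?I \<omega> = (LINT u:{0..T}|lborel. kp.D u * \<phi> (B u \<omega>))"
        by (intro set_lebesgue_integral_cong) (auto simp: D_eq)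
      also have "\<dots> = integral {0..T} (\<lambda>u. kp.D u * \<phi> (B u \<omega>))"
        by (rule set_borel_integral_eq_integral(2)[OF borel_integrable_atLeastAtMost'[OF c]])
      finally show ?case
        using kp.Z_tendsto kp.Z_bounded unfolding S_eq by simp
    qed
    show ?thesis
    proof (rule integral_dominated_convergence)
      show "(\<lambda>\<omega>. - ?I \<omega>) \<in> borel_measurable (P x)"
        using discounted_integral_measurable[OF \<phi>] by simp
      show "S n \<in> borel_measurable (P x)" for n
        unfolding S_def[abs_def] using inc(2) by (intro borel_measurable_sum) auto
      show "integrable (P x) (\<lambda>\<omega>. T * ((\<alpha> + 1) * C) + \<beta> * C * L T \<omega> + C)"
        using local_time_integrable[OF T, of x] by simp
      show "AE \<omega> in P x. (\<lambda>n. S n \<omega>) \<longlonglongrightarrow> - ?I \<omega>"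
        using ae by eventually_elim simp
      show "AE \<omega> in P x. norm (S n \<omega>) \<le> T * ((\<alpha> + 1) * C) + \<beta> * C * L T \<omega> + C" for n
        using ae by eventually_elim simp
    qed
  qed
  define X where "X = (\<integral>\<omega>. ?D T \<omega> * v (B T \<omega>) \<partial>P x) - v x"
  have bound: "\<bar>X - (\<integral>\<omega>. - ?I \<omega> \<partial>P x)\<bar> \<le> \<epsilon> * T" if \<epsilon>: "0 < \<epsilon>" for \<epsilon>
  proof -
    obtain \<eta> where \<eta>: "0 < \<eta>" "\<And>y z. dist y z < \<eta> \<Longrightarrow> dist (w2 y) (w2 z) < \<epsilon>"
      using w2_uc \<epsilon> unfolding uniformly_continuous_on_def by (metis UNIV_I)
    then have \<eta>': "\<bar>w2 y - w2 z\<bar> \<le> \<epsilon>" if "\<bar>y - z\<bar> < \<eta>" for y z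
      using that \<eta>(2)[of y z] by (simp add: dist_real_def less_imp_le)
    \<comment> \<open>The bound on \<open>w2\<close> from the Taylor remainder, times the
      \<open>3\<close> of the Gaussian fourth moment.\<close>
    define c where "c = (2 * (\<alpha> + 1) * C) / \<eta>\<^sup>2 * 3"
    have b: "\<bar>X - (\<integral>\<omega>. S n \<omega> \<partial>P x)\<bar> \<le> \<epsilon> * T + c * T * (T / real (Suc n))" for n
    proof -
      let ?h = "T / real (Suc n)"
      have "\<bar>X - (\<integral>\<omega>. S n \<omega> \<partial>P x)\<bar> = \<bar>\<Sum>i<Suc n. (\<integral>\<omega>. Y n i \<omega> \<partial>P x) - (\<integral>\<omega>. Z n i \<omega> \<partial>P x)\<bar>"
        unfolding X_def tele[of n] ES sum_subtractf ..
      also have "\<dots> \<le> (\<Sum>i<Suc n. \<epsilon> * ?h + c * ?h\<^sup>2)"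
        using inc(3)[OF \<eta>(1) \<eta>', of n]
        by (intro order_trans[OF sum_abs] sum_mono) (simp add: c_def mult.assoc)
      also have "\<dots> = real (Suc n) * ?h * (\<epsilon> + c * ?h)"
        by (simp only: sum_constant card_lessThan power2_eq_square ring_distribs ac_simps)
      also have "\<dots> = \<epsilon> * T + c * T * ?h"
        by (simp add: algebra_simps del: of_nat_Suc)
      finally show ?thesis .
    qed
    have "(\<lambda>n. T / real (Suc n)) \<longlonglongrightarrow> 0"
      using tendsto_mult[OF tendsto_const[of T] LIMSEQ_inverse_real_of_nat] by (simp add: divide_inverse)
    then have "(\<lambda>n. \<epsilon> * T + c * T * (T / real (Suc n))) \<longlonglongrightarrow> \<epsilon> * T + c * T * 0"
      by (intro tendsto_intros)
    then have le: "(\<lambda>n. \<epsilon> * T + c * T * (T / real (Suc n))) \<longlonglongrightarrow> \<epsilon> * T" by simp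
    have "(\<lambda>n. \<bar>X - (\<integral>\<omega>. S n \<omega> \<partial>P x)\<bar>) \<longlonglongrightarrow> \<bar>X - (\<integral>\<omega>. - ?I \<omega> \<partial>P x)\<bar>"
      by (intro tendsto_intros S_lim)
    from LIMSEQ_le[OF this le] b show ?thesis by blast
  qed
  have "X - (\<integral>\<omega>. - ?I \<omega> \<partial>P x) = 0"
  proof (rule ccontr)
    assume nz: "X - (\<integral>\<omega>. - ?I \<omega> \<partial>P x) \<noteq> 0"
    let ?d = "\<bar>X - (\<integral>\<omega>. - ?I \<omega> \<partial>P x)\<bar>"
    \<comment> \<open>With this choice of \<epsilon> the bound stays below \<open>?d\<close> itself,
      also for \<open>T = 0\<close>.\<close>
    have "?d \<le> ?d / (2 * (T + 1)) * T"
      using nz T by (intro bound) simp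
    also have "\<dots> < ?d"
    proof -
      have "d / (2 * (T + 1)) * T < d" if "0 < d" for d :: real
        using that T mult_nonneg_nonneg[of T d] by (simp add: field_simps add_nonneg_pos)
      then show ?thesis using nz by simp
    qed
    finally show False by simp
  qed
  then show ?thesis by (simp add: X_def)
qed

text \<open>The horizon tends to infinity along the integers: the boundary term is at most
  \<open>exp (- \<alpha> * n) * C\<close>, and \<open>C * exp (- \<alpha> * u)\<close> dominates the
  integrand.\<close>

lemma feynman_kac:
  assumes "resolvent_solution \<alpha> \<beta> C M \<phi> v w w1 w2"
  shows "(\<integral>\<omega>. (LINT u:{0..}|lborel. disc \<alpha> \<beta> u \<omega> * \<phi> (B u \<omega>)) \<partial>P x) = v x"
proof -
  interpret resolvent_solution \<alpha> \<beta> C M \<phi> v w w1 w2 by fact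
  interpret prob_space "P x" by (rule prob)
  let ?D = "disc \<alpha> \<beta>"
  let ?f = "\<lambda>\<omega> u. indicator {0..} u * (?D u \<omega> * \<phi> (B u \<omega>))"
  let ?J = "\<lambda>n \<omega>. LINT u:{0..real n}|lborel. ?D u \<omega> * \<phi> (B u \<omega>)"
  let ?K = "\<lambda>\<omega>. LINT u:{0..}|lborel. ?D u \<omega> * \<phi> (B u \<omega>)"
  let ?e = "\<lambda>u. C * (indicator {0..} u * exp (- \<alpha> * u))"
  have C0: "0 \<le> C" using v_le[of 0] by linarith
  have mf [measurable]: "?f \<omega> \<in> borel_measurable lborel" if "\<omega> \<in> space A" for \<omega>
  proof -
    have "(\<lambda>u. (\<lambda>(\<omega>, u). indicator {0..} u * (disc \<alpha> \<beta> (max 0 u) \<omega> * \<phi> (B (max 0 u) \<omega>))) (\<omega>, u)) \<in> borel_measurable lborel"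
      using that by (intro measurable_compose[OF _ integrand_joint_measurable[OF \<phi>]] measurable_Pair1') (auto simp: space_P)
    moreover have "(\<lambda>u. (\<lambda>(\<omega>, u). indicator {0..} u * (disc \<alpha> \<beta> (max 0 u) \<omega> * \<phi> (B (max 0 u) \<omega>))) (\<omega>, u)) = ?f \<omega>"
      by (auto simp: indicator_def max_def)
    ultimately show ?thesis by simp
  qed
  have f_le: "\<bar>?f \<omega> u\<bar> \<le> ?e u" for \<omega> u
  proof -
    have "\<bar>?D u \<omega>\<bar> * \<bar>\<phi> (B u \<omega>)\<bar> \<le> exp (- \<alpha> * u) * C"
      using disc_le[OF \<beta>, of \<alpha> u \<omega>] disc_nonneg[of \<alpha> \<beta> u \<omega>] \<phi>_le by (intro mult_mono) auto
    then show ?thesis by (auto simp: indicator_def abs_mult mult.commute)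
  qed
  have ei: "integrable lborel (\<lambda>u. ?e u)"
    using integrable_exp_decay[OF \<alpha>] by simp
  have fi: "integrable lborel (?f \<omega>)" if "\<omega> \<in> space A" for \<omega>
  proof (rule Bochner_Integration.integrable_bound[OF ei mf[OF that]], rule AE_I2)
    show "norm (?f \<omega> u) \<le> norm (?e u)" for u
      using f_le[of u \<omega>] unfolding real_norm_def by linarith
  qed
  have "(\<lambda>n. \<integral>\<omega>. (?J n \<omega>) \<partial>P x) \<longlonglongrightarrow>
     (\<integral>\<omega>. (?K \<omega>) \<partial>P x)"
  proof (rule integral_dominated_convergence)
    have eq: "(?J n \<omega>) = (LBINT u. indicator {..real n} u *\<^sub>R ?f \<omega> u)" for n \<omega>
      unfolding set_lebesgue_integral_def
      by (intro Bochner_Integration.integral_cong) (auto simp: indicator_def)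
    have lim: "(\<lambda>n. ?J n \<omega>) \<longlonglongrightarrow> (?K \<omega>)"
      if "\<omega> \<in> space A" for \<omega>
    proof -
      have "(\<lambda>n. LBINT u. indicator {..real n} u *\<^sub>R ?f \<omega> u) \<longlonglongrightarrow> (LBINT u. ?f \<omega> u)"
        by (rule filterlim_compose[OF tendsto_integral_at_top[OF _ fi[OF that]] filterlim_real_sequentially]) simp
      moreover have "(LBINT u. ?f \<omega> u) = (?K \<omega>)"
        unfolding set_lebesgue_integral_def by simp
      ultimately show ?thesis unfolding eq by simp
    qed
    show m: "(\<lambda>\<omega>. ?J n \<omega>) \<in> borel_measurable (P x)" for n
      by (rule discounted_integral_measurable[OF \<phi>])
    show "(\<lambda>\<omega>. ?K \<omega>) \<in> borel_measurable (P x)"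
      by (rule borel_measurable_LIMSEQ_real[OF _ m]) (use lim in \<open>simp add: space_P\<close>)
    show "AE \<omega> in P x. (\<lambda>n. ?J n \<omega>) \<longlonglongrightarrow> (?K \<omega>)"
      using lim by (intro AE_I2) (simp add: space_P)
    show "integrable (P x) (\<lambda>\<omega>. LBINT u. ?e u)" by simp
    show "AE \<omega> in P x. norm (?J n \<omega>) \<le> (LBINT u. ?e u)" for n
    proof (rule AE_I2)
      fix \<omega> assume "\<omega> \<in> space (P x)"
      then have \<omega>: "\<omega> \<in> space A" by (simp add: space_P)
      show "norm (?J n \<omega>) \<le> (LBINT u. ?e u)"
        unfolding eq
      proof (rule Bochner_Integration.integral_norm_bound_integral[OF _ ei])
        show "integrable lborel (\<lambda>u. indicator {..real n} u *\<^sub>R ?f \<omega> u)"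
          using fi[OF \<omega>] by (intro integrable_mult_indicator) auto
        show "norm (indicator {..real n} u *\<^sub>R ?f \<omega> u) \<le> ?e u" for u
          using f_le[of u \<omega>] C0 by (auto simp: indicator_def)
      qed
    qed
  qed
  moreover have "(\<lambda>n. v x - (\<integral>\<omega>. ?D (real n) \<omega> * v (B (real n) \<omega>) \<partial>P x)) \<longlonglongrightarrow> v x - 0"
  proof (intro tendsto_intros)
    have "norm (\<integral>\<omega>. ?D (real n) \<omega> * v (B (real n) \<omega>) \<partial>P x) \<le> exp (- \<alpha> * real n) * C" for n
    proof -
      have "norm (\<integral>\<omega>. ?D (real n) \<omega> * v (B (real n) \<omega>) \<partial>P x) \<le> (\<integral>\<omega>. exp (- \<alpha> * real n) * C \<partial>P x)"
      proof (rule order_trans[OF integral_norm_bound], rule integral_mono)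
        have [measurable]: "v \<in> borel_measurable borel"
          using v_continuous by (rule borel_measurable_continuous_onI)
        show "integrable (P x) (\<lambda>\<omega>. norm (?D (real n) \<omega> * v (B (real n) \<omega>)))"
        proof (rule integrable_norm, rule integrable_bounded)
          show "bounded ((\<lambda>\<omega>. ?D (real n) \<omega> * v (B (real n) \<omega>)) ` space A)"
            using disc_le_1[of \<alpha> \<beta> "real n"] \<alpha> \<beta> v_le by (intro bounded_image_mult) (auto simp: bounded_iff)
        qed simp
        show "norm (?D (real n) \<omega> * v (B (real n) \<omega>)) \<le> exp (- \<alpha> * real n) * C" for \<omega>
          unfolding real_norm_def abs_mult using disc_le[OF \<beta>, of \<alpha> "real n" \<omega>] disc_nonneg[of \<alpha> \<beta> "real n" \<omega>] v_le
          by (intro mult_mono) auto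
      qed simp
      then show ?thesis by (simp add: prob_space)
    qed
    moreover have "(\<lambda>n. exp (- \<alpha> * real n) * C) \<longlonglongrightarrow> 0"
    proof -
      have "filterlim (\<lambda>n. - \<alpha> * real n) at_bot sequentially"
        using \<alpha> by (intro filterlim_tendsto_neg_mult_at_bot[OF tendsto_const _ filterlim_real_sequentially]) auto
      from filterlim_compose[OF exp_at_bot this] show ?thesis by (intro tendsto_mult_left_zero)
    qed
    ultimately show "(\<lambda>n. \<integral>\<omega>. ?D (real n) \<omega> * v (B (real n) \<omega>) \<partial>P x) \<longlonglongrightarrow> 0"
      by (rule Lim_null_comparison[OF always_eventually, OF allI])
  qed
  moreover have "(\<integral>\<omega>. (?J n \<omega>) \<partial>P x) =
      v x - (\<integral>\<omega>. ?D (real n) \<omega> * v (B (real n) \<omega>) \<partial>P x)" for n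
    using feynman_kac_finite[OF assms, of "real n" x] by simp
  ultimately show ?thesis
    using LIMSEQ_unique by auto
qed

end

section \<open>Solution of the resolvent equation\<close>

text \<open>Smallness at infinity reduces both boundedness and uniform continuity to a compact
  interval.\<close>

lemma C0_nonneg_even_extension:
  assumes "f \<in> C0_nonneg"
  shows "continuous_on UNIV (\<lambda>y. f \<bar>y\<bar>)"
    and "\<exists>C. \<forall>y. \<bar>f \<bar>y\<bar>\<bar> \<le> C"
    and "uniformly_continuous_on UNIV (\<lambda>y. f \<bar>y\<bar>)"
proof -
  have f: "continuous_on {0..} f" "(f \<longlongrightarrow> 0) at_top"
    using assms by (auto simp: C0_nonneg_def)
  show c: "continuous_on UNIV (\<lambda>y. f \<bar>y\<bar>)"
    by (rule continuous_on_compose2[OF f(1)]) (auto intro: continuous_intros)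
  have tail: "\<exists>R\<ge>0. \<forall>t\<ge>R. \<bar>f t\<bar> < e" if e: "0 < e" for e
  proof -
    have "eventually (\<lambda>t. \<bar>f t\<bar> < e) at_top"
      using tendstoD[OF f(2) e] by (simp add: dist_real_def)
    then obtain R where "\<forall>t\<ge>R. \<bar>f t\<bar> < e" by (auto simp: eventually_at_top_linorder)
    then show ?thesis by (intro exI[of _ "max 0 R"]) auto
  qed
  show "\<exists>C. \<forall>y. \<bar>f \<bar>y\<bar>\<bar> \<le> C"
  proof -
    obtain R where R: "0 \<le> R" "\<forall>t\<ge>R. \<bar>f t\<bar> < 1" using tail[of 1] by auto
    have "compact (f ` {0..R})"
      using continuous_on_subset[OF f(1), of "{0..R}"] by (intro compact_continuous_image) auto
    then obtain K where K: "\<forall>t\<in>{0..R}. \<bar>f t\<bar> \<le> K"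
      using compact_imp_bounded[of "f ` {0..R}"] unfolding bounded_iff by auto
    have "\<bar>f \<bar>y\<bar>\<bar> \<le> max K 1" for y
    proof (cases "\<bar>y\<bar> \<le> R")
      case True
      then have "\<bar>f \<bar>y\<bar>\<bar> \<le> K" using bspec[OF K, of "\<bar>y\<bar>"] by simp
      then show ?thesis by simp
    next
      case False
      then show ?thesis using R(2) by (metis less_imp_le linorder_not_le max.coboundedI2)
    qed
    then show ?thesis by blast
  qed
  show "uniformly_continuous_on UNIV (\<lambda>y. f \<bar>y\<bar>)"
    unfolding uniformly_continuous_on_def
  proof (intro allI impI)
    fix e :: real assume e: "0 < e"
    obtain R where R: "0 \<le> R" "\<forall>t\<ge>R. \<bar>f t\<bar> < e / 2" using tail[of "e / 2"] e by auto
    \<comment> \<open>The extra unit ensures that two points at distance below \<open>1\<close>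
      either both lie in this interval or both have modulus at least \<open>R\<close>.\<close>
    have "uniformly_continuous_on {-(R + 1)..R + 1} (\<lambda>y. f \<bar>y\<bar>)"
      using continuous_on_subset[OF c] by (intro compact_uniformly_continuous) auto
    then obtain d where d: "0 < d" "\<And>y z. y \<in> {-(R + 1)..R + 1} \<Longrightarrow> z \<in> {-(R + 1)..R + 1} \<Longrightarrow> dist z y < d \<Longrightarrow> dist (f \<bar>z\<bar>) (f \<bar>y\<bar>) < e"
      unfolding uniformly_continuous_on_def using e by metis
    have "dist (f \<bar>z\<bar>) (f \<bar>y\<bar>) < e" if "dist z y < min d 1" for y z
    proof (cases "\<bar>y\<bar> \<le> R + 1 \<and> \<bar>z\<bar> \<le> R + 1")
      case True
      then show ?thesis using d(2)[of y z] that by (auto simp: abs_le_iff)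
    next
      case False
      then have "R \<le> \<bar>y\<bar>" "R \<le> \<bar>z\<bar>" using that by (auto simp: dist_real_def)
      then have "\<bar>f \<bar>y\<bar>\<bar> < e / 2" "\<bar>f \<bar>z\<bar>\<bar> < e / 2" using R(2) by auto
      then show ?thesis by (simp add: dist_real_def)
    qed
    then show "\<exists>d>0. \<forall>y\<in>UNIV. \<forall>z\<in>UNIV. dist z y < d \<longrightarrow> dist (f \<bar>z\<bar>) (f \<bar>y\<bar>) < e"
      using d(1) by (intro exI[of _ "min d 1"]) auto
  qed
qed

text \<open>Meant for functions built from \<open>\<bar>y\<bar>\<close>, to which the
  differentiation rules do not apply at \<open>0\<close>.\<close>

lemma has_real_derivative_0_quadratic:
  fixes f :: "real \<Rightarrow> real"
  assumes "\<And>y. \<bar>f y - f 0 - D * y\<bar> \<le> K * y\<^sup>2"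
  shows "(f has_real_derivative D) (at 0)"
  unfolding has_field_derivative_iff
proof -
  have "((\<lambda>y. (f y - f 0) / (y - 0) - D) \<longlongrightarrow> 0) (at 0)"
  proof (rule Lim_null_comparison)
    show "((\<lambda>y. K * \<bar>y\<bar>) \<longlongrightarrow> 0) (at (0 :: real))"
      by (rule tendsto_eq_intros refl | simp)+
    show "eventually (\<lambda>y. norm ((f y - f 0) / (y - 0) - D) \<le> K * \<bar>y\<bar>) (at 0)"
    proof (intro eventually_at[THEN iffD2] exI[of _ 1] conjI ballI impI)
      fix y :: real assume y: "y \<noteq> 0 \<and> dist y 0 < 1"
      have "(f y - f 0) / (y - 0) - D = (f y - f 0 - D * y) / y" using y by (simp add: field_simps)
      then have "norm ((f y - f 0) / (y - 0) - D) = \<bar>f y - f 0 - D * y\<bar> / \<bar>y\<bar>" by simp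
      also have "\<dots> \<le> K * y\<^sup>2 / \<bar>y\<bar>" using assms by (intro divide_right_mono) auto
      also have "\<dots> = K * \<bar>y\<bar>" using y by (simp add: power2_eq_square field_simps abs_if)
      finally show "norm ((f y - f 0) / (y - 0) - D) \<le> K * \<bar>y\<bar>" .
    qed simp
  qed
  then show "((\<lambda>y. (f y - f 0) / (y - 0)) \<longlongrightarrow> D) (at 0)"
    by (simp add: LIM_zero_iff)
qed

text \<open>\<open>exp (- g \<bar>y\<bar>) + g \<bar>y\<bar>\<close> is twice differentiable although neither summand is differentiable at \<open>0\<close>.\<close>

lemma exp_abs_derivatives:
  fixes g :: real
  assumes g: "0 < g"
  shows "((\<lambda>y. exp (- g * \<bar>y\<bar>) + g * \<bar>y\<bar>) has_real_derivative g * sgn y * (1 - exp (- g * \<bar>y\<bar>))) (at y)"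
    and "((\<lambda>y. g * sgn y * (1 - exp (- g * \<bar>y\<bar>))) has_real_derivative g\<^sup>2 * exp (- g * \<bar>y\<bar>)) (at y)"
proof -
  let ?E = "\<lambda>y. exp (- g * \<bar>y\<bar>) + g * \<bar>y\<bar>" and ?E1 = "\<lambda>y. g * sgn y * (1 - exp (- g * \<bar>y\<bar>))"
  \<comment> \<open>One estimate settles both derivatives at \<open>0\<close>: after subtraction of
    the linear part, the second function is, up to sign, \<open>g * sgn y\<close> times the
    expression bounded here.\<close>
  have quad: "\<bar>exp (- (g * \<bar>y\<bar>)) - 1 + g * \<bar>y\<bar>\<bar> \<le> g\<^sup>2 * y\<^sup>2" for y
    using exp_minus_taylor[of "g * \<bar>y\<bar>"] g by (simp add: power_mult_distrib)
  consider "0 < y" | "y < 0" | "y = 0" by linarith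
  then show "(?E has_real_derivative ?E1 y) (at y)"
  proof cases
    case 1
    have "((\<lambda>y. exp (- g * y) + g * y) has_real_derivative ?E1 y) (at y)"
      using 1 by (auto intro!: derivative_eq_intros simp: algebra_simps)
    then show ?thesis
      by (rule has_field_derivative_transform_within_open[of _ _ _ "{0<..}"]) (use 1 in auto)
  next
    case 2
    have "((\<lambda>y. exp (g * y) - g * y) has_real_derivative ?E1 y) (at y)"
      using 2 by (auto intro!: derivative_eq_intros simp: algebra_simps)
    then show ?thesis
      by (rule has_field_derivative_transform_within_open[of _ _ _ "{..<0}"]) (use 2 in auto)
  next
    case 3
    have "(?E has_real_derivative 0) (at 0)"
    proof (rule has_real_derivative_0_quadratic[where K = "g\<^sup>2"])
      show "\<bar>exp (- g * \<bar>y\<bar>) + g * \<bar>y\<bar> - (exp (- g * \<bar>0\<bar>) + g * \<bar>0\<bar>) - 0 * y\<bar> \<le> g\<^sup>2 * y\<^sup>2" for y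
        using quad[of y] by (simp add: algebra_simps)
    qed
    then show ?thesis using 3 by simp
  qed
  consider "0 < y" | "y < 0" | "y = 0" by linarith
  then show "(?E1 has_real_derivative g\<^sup>2 * exp (- g * \<bar>y\<bar>)) (at y)"
  proof cases
    case 1
    have "((\<lambda>y. g * (1 - exp (- g * y))) has_real_derivative g\<^sup>2 * exp (- g * \<bar>y\<bar>)) (at y)"
      using 1 by (auto intro!: derivative_eq_intros simp: power2_eq_square)
    then show ?thesis
      by (rule has_field_derivative_transform_within_open[of _ _ _ "{0<..}"]) (use 1 in auto)
  next
    case 2
    have "((\<lambda>y. - g * (1 - exp (g * y))) has_real_derivative g\<^sup>2 * exp (- g * \<bar>y\<bar>)) (at y)"
      using 2 by (auto intro!: derivative_eq_intros simp: power2_eq_square)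
    then show ?thesis
      by (rule has_field_derivative_transform_within_open[of _ _ _ "{..<0}"]) (use 2 in auto)
  next
    case 3
    have "(?E1 has_real_derivative g\<^sup>2) (at 0)"
    proof (rule has_real_derivative_0_quadratic[where K = "g * g\<^sup>2"])
      fix y :: real
      have e: "?E1 y - g * sgn 0 * (1 - exp (- g * \<bar>0\<bar>)) - g\<^sup>2 * y =
          - (g * sgn y * (exp (- (g * \<bar>y\<bar>)) - 1 + g * \<bar>y\<bar>))"
        by (cases "y = 0") (auto simp: sgn_if power2_eq_square algebra_simps)
      have "\<bar>g * sgn y * (exp (- (g * \<bar>y\<bar>)) - 1 + g * \<bar>y\<bar>)\<bar> \<le> g * (g\<^sup>2 * y\<^sup>2)"
        unfolding abs_mult using g quad[of y] by (intro mult_mono) (auto simp: sgn_if)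
      then show "\<bar>?E1 y - g * sgn 0 * (1 - exp (- g * \<bar>0\<bar>)) - g\<^sup>2 * y\<bar> \<le> g * g\<^sup>2 * y\<^sup>2"
        unfolding e abs_minus_cancel by (simp add: mult.assoc)
    qed
    then show ?thesis using 3 by simp
  qed
qed

text \<open>The bounded solution is \<open>exp (g x)\<close> times the integral of \<open>exp (- g y) \<phi> y\<close> over \<open>{x..}\<close>;
  with \<open>H\<close> an antiderivative and \<open>l\<close> its limit, the integral is \<open>l - H x\<close>.\<close>

lemma bounded_solution_first_order:
  fixes \<phi> :: "real \<Rightarrow> real"
  assumes g: "0 < g" and \<phi>: "continuous_on UNIV \<phi>" "\<And>y. \<bar>\<phi> y\<bar> \<le> C"
  obtains q where "\<And>x. (q has_real_derivative g * q x - \<phi> x) (at x)" "\<And>x. \<bar>q x\<bar> \<le> C / g"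
proof -
  have "\<exists>H. \<forall>x. - \<infinity> < ereal x \<longrightarrow> ereal x < \<infinity> \<longrightarrow> (H has_vector_derivative exp (- g * x) * \<phi> x) (at x)"
    using \<phi>(1) by (intro einterval_antiderivative continuous_intros) (auto simp: continuous_on_eq_continuous_at)
  then obtain H where H: "\<And>x. (H has_real_derivative exp (- g * x) * \<phi> x) (at x)"
    by (auto simp: has_real_derivative_iff_has_vector_derivative)
  \<comment> \<open>\<open>E x\<close> is the integral of \<open>C * exp (- g * y)\<close> over
    \<open>{x..}\<close> and so bounds the variation of \<open>H\<close> beyond \<open>x\<close>.
    Hence \<open>H - E\<close> increases, \<open>H + E\<close> decreases, and the supremum of the
    former is the limit of \<open>H\<close>; no improper integral is formed.\<close>
  define E where "E x = C / g * exp (- g * x)" for x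
  have E: "(E has_real_derivative - C * exp (- g * x)) (at x)" for x
    unfolding E_def[abs_def] using g by (auto intro!: derivative_eq_intros)
  have up: "H x - E x \<le> H y - E y" if "x \<le> y" for x y
  proof (rule DERIV_nonneg_imp_nondecreasing[OF that])
    fix z
    have "((\<lambda>x. H x - E x) has_real_derivative exp (- g * z) * (\<phi> z + C)) (at z)"
      using DERIV_diff[OF H E, of z] by (simp add: algebra_simps)
    moreover have "0 \<le> exp (- g * z) * (\<phi> z + C)" using \<phi>(2)[of z] by (intro mult_nonneg_nonneg) auto
    ultimately show "\<exists>d. ((\<lambda>x. H x - E x) has_real_derivative d) (at z) \<and> 0 \<le> d" by blast
  qed
  have down: "H y + E y \<le> H x + E x" if "x \<le> y" for x y
  proof (rule DERIV_nonpos_imp_nonincreasing[OF that])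
    fix z
    have "((\<lambda>x. H x + E x) has_real_derivative exp (- g * z) * (\<phi> z - C)) (at z)"
      using DERIV_add[OF H E, of z] by (simp add: algebra_simps)
    moreover have "exp (- g * z) * (\<phi> z - C) \<le> 0" using \<phi>(2)[of z] by (intro mult_nonneg_nonpos) auto
    ultimately show "\<exists>d. ((\<lambda>x. H x + E x) has_real_derivative d) (at z) \<and> d \<le> 0" by blast
  qed
  have E0: "0 \<le> E x" for x using \<phi>(2)[of 0] g by (auto simp: E_def)
  have cross: "H x - E x \<le> H y + E y" for x y
  proof (cases "x \<le> y")
    case True
    then show ?thesis using up[OF True] E0[of y] by linarith
  next
    case False
    then show ?thesis using down[of y x] E0[of x] by linarith
  qed
  define l where "l = (SUP x. H x - E x)"
  have lb: "H x - E x \<le> l" for x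
    unfolding l_def using cross[of _ 0] by (intro cSUP_upper bdd_aboveI2[of _ _ "H 0 + E 0"]) auto
  have ub: "l \<le> H y + E y" for y
    unfolding l_def using cross by (intro cSUP_least) auto
  define q where "q x = exp (g * x) * (l - H x)" for x
  have "(q has_real_derivative g * q x - \<phi> x) (at x)" for x
  proof -
    have "exp (g * x) * (exp (- g * x) * \<phi> x) = \<phi> x"
      by (simp add: mult.assoc[symmetric] exp_add[symmetric])
    then show ?thesis
      unfolding q_def[abs_def] by (auto intro!: derivative_eq_intros H simp: algebra_simps)
  qed
  moreover have "\<bar>q x\<bar> \<le> C / g" for x
  proof -
    have "\<bar>l - H x\<bar> \<le> E x" using lb[of x] ub[of x] by linarith
    then have "\<bar>q x\<bar> \<le> exp (g * x) * E x" unfolding q_def abs_mult by (intro mult_mono) auto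
    also have "\<dots> = C / g * (exp (g * x) * exp (- g * x))" by (simp add: E_def)
    also have "exp (g * x) * exp (- g * x) = 1" by (simp add: exp_add[symmetric])
    finally show ?thesis by simp
  qed
  ultimately show thesis using that by blast
qed

text \<open>The equation \<open>u'' = g^2 * u - 2 * \<phi>\<close> is split into first order ones: a
  bounded \<open>q\<close> with \<open>q' = g * q - \<phi>\<close> and its reflection give
  \<open>u x = (q x + q (- x)) / g\<close>, with slope \<open>q x - q (- x)\<close>. The quantifiers
  matter: one \<open>u\<close> serves every \<beta>, only the multiple of
  \<open>exp (- g * \<bar>y\<bar>)\<close> changes, so \<open>\<beta> = 0\<close> can later identify
  \<open>u\<close> itself.\<close>

lemma resolvent_solution_exists:
  assumes f: "f \<in> C0_nonneg" and \<alpha>: "0 < \<alpha>"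
  obtains u where "\<And>\<beta>. 0 \<le> \<beta> \<Longrightarrow> \<exists>C M w w1 w2. resolvent_solution \<alpha> \<beta> C M (\<lambda>y. f \<bar>y\<bar>)
    (\<lambda>y. u y - \<beta> / (\<beta> + sqrt (2 * \<alpha>)) * u 0 * exp (- sqrt (2 * \<alpha>) * \<bar>y\<bar>)) w w1 w2"
proof -
  define g where "g = sqrt (2 * \<alpha>)"
  have g: "0 < g" "g\<^sup>2 = 2 * \<alpha>" using \<alpha> by (auto simp: g_def)
  let ?\<phi> = "\<lambda>y. f \<bar>y\<bar>"
  note \<phi> = C0_nonneg_even_extension[OF f]
  obtain C0 where C0: "\<And>y. \<bar>?\<phi> y\<bar> \<le> C0" using \<phi>(2) by blast
  obtain q where q: "\<And>x. (q has_real_derivative g * q x - ?\<phi> x) (at x)" "\<And>x. \<bar>q x\<bar> \<le> C0 / g"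
    by (rule bounded_solution_first_order[OF g(1) \<phi>(1) C0]) blast
  \<comment> \<open>Evenness of \<open>?\<phi>\<close> gives the reflected function the same source
    term.\<close>
  have q': "((\<lambda>x. q (- x)) has_real_derivative - (g * q (- x) - ?\<phi> x)) (at x)" for x
    using DERIV_chain2[where f = q and g = uminus and x = x and s = UNIV, OF q(1) DERIV_minus[OF DERIV_ident]] by simp
  define u where "u x = (q x + q (- x)) / g" for x
  have u: "(u has_real_derivative q x - q (- x)) (at x)" for x
  proof -
    have "(g * q x - ?\<phi> x + - (g * q (- x) - ?\<phi> x)) / g = q x - q (- x)"
      using g(1) by (simp add: field_simps)
    then show ?thesis
      unfolding u_def[abs_def] using DERIV_cdivide[OF DERIV_add[OF q(1) q'], of g x] by simp
  qed
  have u1: "((\<lambda>x. q x - q (- x)) has_real_derivative g\<^sup>2 * u x - 2 * ?\<phi> x) (at x)" for x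
  proof -
    have "g * q x - ?\<phi> x - - (g * q (- x) - ?\<phi> x) = g\<^sup>2 * u x - 2 * ?\<phi> x"
      using g(1) by (simp add: u_def power2_eq_square field_simps)
    then show ?thesis using DERIV_diff[OF q(1) q', of x] by simp
  qed
  have u_le: "\<bar>u x\<bar> \<le> 2 * C0 / g\<^sup>2" for x
  proof -
    have "\<bar>q x + q (- x)\<bar> \<le> 2 * (C0 / g)" using q(2)[of x] q(2)[of "- x"] by linarith
    then have "\<bar>u x\<bar> \<le> 2 * (C0 / g) / g"
      unfolding u_def abs_divide using g(1) by (intro frac_le) auto
    then show ?thesis by (simp add: power2_eq_square)
  qed
  show thesis
  proof (rule that)
    fix \<beta> :: real assume \<beta>: "0 \<le> \<beta>"
    have \<beta>g: "0 < \<beta> + g" using \<beta> g by simp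
    \<comment> \<open>The solution of \<open>\<beta> * (u 0 + c) = - (c * g)\<close>, whose two
      sides are \<open>\<beta> * v 0\<close> and the right-hand slope at \<open>0\<close> of
      \<open>c * exp (- g * \<bar>y\<bar>)\<close>.\<close>
    define c where "c = - (\<beta> / (\<beta> + g) * u 0)"
    define v where "v y = u y + c * exp (- g * \<bar>y\<bar>)" for y
    define w where "w y = u y + c * (exp (- g * \<bar>y\<bar>) + g * \<bar>y\<bar>)" for y
    define w1 where "w1 y = (q y - q (- y)) + c * (g * sgn y * (1 - exp (- g * \<bar>y\<bar>)))" for y
    define w2 where "w2 y = (g\<^sup>2 * u y - 2 * ?\<phi> y) + c * (g\<^sup>2 * exp (- g * \<bar>y\<bar>))" for y
    define k where "k = \<beta> * v 0"
    have k: "k = - (c * g)"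
      unfolding k_def v_def c_def using \<beta>g by (simp add: field_simps)
    have w: "(w has_real_derivative w1 y) (at y)" for y
      unfolding w_def[abs_def] w1_def by (intro DERIV_add DERIV_cmult u exp_abs_derivatives g)
    have w1: "(w1 has_real_derivative w2 y) (at y)" for y
      unfolding w1_def[abs_def] w2_def by (intro DERIV_add DERIV_cmult u1 exp_abs_derivatives g)
    have e_le: "exp (- g * \<bar>y\<bar>) \<le> 1" for y :: real using g(1) by simp
    have v_le: "\<bar>v y\<bar> \<le> 2 * C0 / g\<^sup>2 + \<bar>c\<bar>" for y
    proof -
      have "\<bar>c * exp (- g * \<bar>y\<bar>)\<bar> \<le> \<bar>c\<bar> * 1" unfolding abs_mult using e_le[of y] by (intro mult_left_mono) auto
      then show ?thesis unfolding v_def using u_le[of y] by linarith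
    qed
    have v_eq: "v y = w y + k * \<bar>y\<bar>" for y by (simp add: v_def w_def k algebra_simps)
    have w1_le: "\<bar>w1 y\<bar> \<le> 2 * (C0 / g) + \<bar>c\<bar> * g" for y
    proof -
      have "\<bar>g * sgn y * (1 - exp (- g * \<bar>y\<bar>))\<bar> \<le> g * 1 * 1"
        unfolding abs_mult using g(1) e_le[of y] by (intro mult_mono) (auto simp: sgn_if)
      then have "\<bar>c * (g * sgn y * (1 - exp (- g * \<bar>y\<bar>)))\<bar> \<le> \<bar>c\<bar> * g"
        unfolding abs_mult[of c] by (intro mult_left_mono) auto
      then show ?thesis unfolding w1_def using q(2)[of y] q(2)[of "- y"] by linarith
    qed
    define C where "C = max C0 (2 * C0 / g\<^sup>2 + \<bar>c\<bar>)"
    define M where "M = C + \<bar>k\<bar> + (2 * (C0 / g) + \<bar>c\<bar> * g)"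
    have v_C: "\<bar>v y\<bar> \<le> C" for y using v_le[of y] by (auto simp: C_def)
    have pos: "0 \<le> C" "0 \<le> 2 * (C0 / g) + \<bar>c\<bar> * g" using v_C[of 0] w1_le[of 0] by linarith+
    have w_le: "\<bar>w y\<bar> \<le> M * (1 + \<bar>y\<bar>)" for y
    proof -
      have "\<bar>w y\<bar> \<le> \<bar>v y\<bar> + \<bar>k\<bar> * \<bar>y\<bar>" using v_eq[of y] by (simp add: abs_mult[symmetric])
      also have "\<dots> \<le> M * 1 + M * \<bar>y\<bar>"
        using v_C[of y] pos by (intro add_mono mult_right_mono) (auto simp: M_def)
      finally show ?thesis by (simp add: algebra_simps)
    qed
    have w2_v: "w2 y = 2 * \<alpha> * v y - 2 * ?\<phi> y" for y
      unfolding w2_def v_def g(2) by (simp add: algebra_simps)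
    \<comment> \<open>\<open>v\<close> is Lipschitz because \<open>w1\<close> is bounded and
      \<open>\<bar>y\<bar>\<close> is Lipschitz; \<open>?\<phi>\<close> is uniformly continuous by
      its decay; \<open>w2\<close> is a linear combination of the two.\<close>
    have w2_uc: "uniformly_continuous_on UNIV w2"
    proof -
      let ?K = "2 * (C0 / g) + \<bar>c\<bar> * g + \<bar>k\<bar>"
      have lip: "\<bar>v y - v z\<bar> \<le> ?K * \<bar>y - z\<bar>" for y z
      proof -
        have "norm (w y - w z) \<le> (2 * (C0 / g) + \<bar>c\<bar> * g) * norm (y - z)"
          using field_differentiable_bound[OF convex_UNIV has_field_derivative_at_within[OF w]] w1_le by simp
        moreover have "\<bar>k * \<bar>y\<bar> - k * \<bar>z\<bar>\<bar> \<le> \<bar>k\<bar> * \<bar>y - z\<bar>"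
          unfolding right_diff_distrib[symmetric] abs_mult by (intro mult_left_mono) auto
        ultimately have "norm (w y - w z) + \<bar>k * \<bar>y\<bar> - k * \<bar>z\<bar>\<bar> \<le> ?K * \<bar>y - z\<bar>"
          unfolding distrib_right[of _ "\<bar>k\<bar>"] real_norm_def by (rule add_mono)
        moreover have "v y - v z = (w y - w z) + (k * \<bar>y\<bar> - k * \<bar>z\<bar>)" unfolding v_eq by simp
        ultimately show ?thesis
          using abs_triangle_ineq[of "w y - w z" "k * \<bar>y\<bar> - k * \<bar>z\<bar>"] by simp
      qed
      have K0: "0 \<le> ?K" using pos by simp
      have uv: "uniformly_continuous_on UNIV v"
        unfolding uniformly_continuous_on_def
      proof (intro allI impI)
        fix e :: real assume e: "0 < e"
        have "dist (v z) (v y) < e" if "dist z y < e / (?K + 1)" for y z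
        proof -
          have "\<bar>v z - v y\<bar> \<le> ?K * \<bar>z - y\<bar>" by (rule lip)
          also have "\<dots> \<le> (?K + 1) * \<bar>z - y\<bar>" by (intro mult_right_mono) auto
          also have "\<dots> < e"
          proof -
            have "0 < ?K + 1" using K0 by linarith
            then show ?thesis using that unfolding dist_real_def by (metis mult.commute pos_less_divide_eq)
          qed
          finally show ?thesis by (simp add: dist_real_def)
        qed
        then show "\<exists>d>0. \<forall>y\<in>UNIV. \<forall>z\<in>UNIV. dist z y < d \<longrightarrow> dist (v z) (v y) < e"
          using divide_pos_pos[OF e, of "?K + 1"] K0 by (intro exI[of _ "e / (?K + 1)"]) simp
      qed
      have "uniformly_continuous_on UNIV (\<lambda>y. 2 * \<alpha> * v y - 2 * ?\<phi> y)"
        by (rule uniformly_continuous_on_diff[OF uniformly_continuous_on_cmul_left[OF uv]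
            uniformly_continuous_on_cmul_left[OF \<phi>(3)]])
      then show ?thesis unfolding w2_v[symmetric] .
    qed
    have "resolvent_solution \<alpha> \<beta> C M ?\<phi> v w w1 w2"
    proof unfold_locales
      show "\<bar>?\<phi> y\<bar> \<le> C" for y using C0[of y] by (simp add: C_def)
      show "v y = w y + \<beta> * v 0 * \<bar>y\<bar>" for y using v_eq[of y] by (simp add: k_def)
      show "\<bar>w1 y\<bar> \<le> M" for y using w1_le[of y] pos by (simp add: M_def)
      show "w2 y / 2 = \<alpha> * v y - ?\<phi> y" for y by (simp add: w2_v)
    qed (fact \<alpha> \<beta> \<phi>(1) v_C w w1 w_le w2_uc)+
    moreover have "v = (\<lambda>y. u y - \<beta> / (\<beta> + sqrt (2 * \<alpha>)) * u 0 * exp (- sqrt (2 * \<alpha>) * \<bar>y\<bar>))"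
      by (auto simp: v_def c_def g_def)
    ultimately show "\<exists>C M w w1 w2. resolvent_solution \<alpha> \<beta> C M ?\<phi>
      (\<lambda>y. u y - \<beta> / (\<beta> + sqrt (2 * \<alpha>)) * u 0 * exp (- sqrt (2 * \<alpha>) * \<bar>y\<bar>)) w w1 w2"
      by blast
  qed
qed

section \<open>Elastic Brownian motion\<close>

lemma space_exp_law: "space (exp_law \<beta>) = {0..}"
  by (simp add: exp_law_def space_restrict_space)

lemma id_measurable_exp_law: "(\<lambda>s. s) \<in> borel_measurable (exp_law \<beta>)"
  unfolding exp_law_def by (rule measurable_restrict_space1) simp

lemma prob_space_exp_law:
  assumes "0 < \<beta>"
  shows "prob_space (exp_law \<beta>)"
proof -
  interpret D: prob_space "density lborel (exponential_density \<beta>)"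
    by (rule prob_space_exponential_density[OF assms])
  have "AE s in density lborel (exponential_density \<beta>). s \<in> {0..}"
    by (subst AE_density) (auto simp: exponential_density_def)
  then have "D.prob {0..} = 1"
    using D.prob_eq_1[of "{0..}"] by simp
  then show ?thesis
    unfolding exp_law_def by (intro prob_space_restrict_space) (auto simp: D.emeasure_eq_measure)
qed

lemma exp_law_gt:
  assumes "0 < \<beta>" "0 \<le> a"
  shows "measure (exp_law \<beta>) {a<..} = exp (- \<beta> * a)"
proof -
  interpret D: prob_space "density lborel (exponential_density \<beta>)"
    by (rule prob_space_exponential_density[OF assms(1)])
  have "distributed (density lborel (exponential_density \<beta>)) lborel (\<lambda>s. s) (exponential_density \<beta>)"
    unfolding distributed_def by (auto intro!: distr_id2)
  from D.exponential_distributedD_gt[OF this assms(2,1)]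
  have "D.prob {a<..} = exp (- a * \<beta>)" by (simp add: greaterThan_def)
  moreover have "measure (exp_law \<beta>) {a<..} = D.prob {a<..}"
    unfolding exp_law_def using assms by (intro measure_restrict_space) auto
  ultimately show ?thesis by (simp add: mult.commute)
qed

text \<open>Disposes of the tie between \<open>S\<close> and \<open>L t\<close>, in which survival
  at \<open>t\<close> would depend on whether \<open>L\<close> is constant just after
  \<open>t\<close>.\<close>

lemma AE_exp_law_neq: "AE s in exp_law \<beta>. s \<noteq> a"
proof -
  have "AE s in lborel. s \<noteq> a" by (rule AE_lborel_singleton)
  then have "AE s in density lborel (exponential_density \<beta>). s \<noteq> a"
    by (subst AE_density) auto
  then show ?thesis
    unfolding exp_law_def by (subst AE_restrict_space_iff) auto
qed

context brownian_local_time
begin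

text \<open>By continuity \<open>L\<close> stays above \<open>s\<close> just after \<open>t\<close>,
  where there is a rational still below \<open>a\<close>. The infimum thus reduces to countably many
  events, which makes the lifetime measurable.\<close>

lemma lifetime_less_iff:
  assumes "\<omega> \<in> space A"
  shows "lifetime L (\<omega>, s) < a \<longleftrightarrow> (\<exists>q::rat. 0 \<le> q \<and> ereal (of_rat q) < a \<and> s < L (of_rat q) \<omega>)"
proof
  assume "lifetime L (\<omega>, s) < a"
  then obtain t where t: "0 \<le> t" "s < L t \<omega>" "ereal t < a"
    unfolding lifetime_def by (auto simp: Inf_less_iff)
  \<comment> \<open>\<open>a\<close> may be infinite, and a real bound is needed to choose the
    rational.\<close>
  obtain b where b: "t < b" "ereal b \<le> a"
  proof (cases a)
    case PInf
    then show ?thesis using that[of "t + 1"] by simp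
  qed (use t(3) that in auto)
  obtain d where d: "0 < d" "\<And>u. 0 \<le> u \<Longrightarrow> dist u t < d \<Longrightarrow> dist (L u \<omega>) (L t \<omega>) < L t \<omega> - s"
    using L_continuous[OF assms] t unfolding continuous_on_iff by (metis atLeast_iff diff_gt_0_iff_gt)
  obtain q where q: "t < real_of_rat q" "real_of_rat q < min b (t + d)"
    using of_rat_dense[of t "min b (t + d)"] b d(1) by auto
  have "0 < real_of_rat q" using q t(1) by linarith
  then have q0: "0 \<le> q" by simp
  have "dist (L (of_rat q) \<omega>) (L t \<omega>) < L t \<omega> - s"
  proof (rule d(2))
    show "0 \<le> real_of_rat q" using \<open>0 < real_of_rat q\<close> by linarith
    show "dist (real_of_rat q) t < d" using q by (simp add: dist_real_def)
  qed
  then have "s < L (of_rat q) \<omega>" by (auto simp: dist_real_def)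
  moreover have "ereal (of_rat q) < ereal b" using q(2) by simp
  then have "ereal (of_rat q) < a" using b(2) by (rule less_le_trans)
  ultimately show "\<exists>q::rat. 0 \<le> q \<and> ereal (of_rat q) < a \<and> s < L (of_rat q) \<omega>" using q0 by blast
next
  assume "\<exists>q::rat. 0 \<le> q \<and> ereal (of_rat q) < a \<and> s < L (of_rat q) \<omega>"
  then obtain q :: rat where q: "0 \<le> q" "ereal (of_rat q) < a" "s < L (of_rat q) \<omega>" by blast
  then have "lifetime L (\<omega>, s) \<le> ereal (of_rat q)"
    unfolding lifetime_def by (auto intro!: Inf_lower exI[of _ "of_rat q"])
  with q(2) show "lifetime L (\<omega>, s) < a" by (rule le_less_trans[rotated])
qed

lemma lifetime_measurable: "lifetime L \<in> borel_measurable (P x \<Otimes>\<^sub>M exp_law \<beta>)"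
  unfolding borel_measurable_ereal_iff_Iio
proof
  fix a
  note [measurable] = id_measurable_exp_law
  have "lifetime L -` {..<a} \<inter> space (P x \<Otimes>\<^sub>M exp_law \<beta>) =
    {p \<in> space (P x \<Otimes>\<^sub>M exp_law \<beta>). \<exists>q::rat. (0 \<le> q \<and> ereal (of_rat q) < a) \<and> snd p < L (max 0 (of_rat q)) (fst p)}"
  proof (rule set_eqI)
    fix p :: "'a \<times> real"
    obtain \<omega> s where p: "p = (\<omega>, s)" by (cases p)
    have "(\<exists>q::rat. (0 \<le> q \<and> ereal (of_rat q) < a) \<and> s < L (max 0 (of_rat q)) \<omega>) \<longleftrightarrow>
        (\<exists>q::rat. 0 \<le> q \<and> ereal (of_rat q) < a \<and> s < L (of_rat q) \<omega>)"
      by (intro arg_cong[where f = Ex] ext) (auto simp: max_def)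
    then show "p \<in> lifetime L -` {..<a} \<inter> space (P x \<Otimes>\<^sub>M exp_law \<beta>) \<longleftrightarrow> p \<in> {p \<in> space (P x \<Otimes>\<^sub>M exp_law \<beta>).
        \<exists>q::rat. (0 \<le> q \<and> ereal (of_rat q) < a) \<and> snd p < L (max 0 (of_rat q)) (fst p)}"
      using lifetime_less_iff[of \<omega> s a] unfolding p by (auto simp: space_pair_measure space_P)
  qed
  also have "\<dots> \<in> sets (P x \<Otimes>\<^sub>M exp_law \<beta>)"
    by measurable
  finally show "lifetime L -` {..<a} \<inter> space (P x \<Otimes>\<^sub>M exp_law \<beta>) \<in> sets (P x \<Otimes>\<^sub>M exp_law \<beta>)" .
qed

text \<open>Along an increasing continuous \<open>L\<close>, being alive at \<open>t\<close> means
  \<open>L t < S\<close> except for a tie, and the exponential tail at \<open>L t\<close> is the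
  discount with \<open>\<alpha> = 0\<close>.\<close>

lemma survival_probability:
  assumes \<beta>: "0 < \<beta>" and \<omega>: "\<omega> \<in> space A" and t: "0 \<le> t"
    and mono: "\<forall>s t. 0 \<le> s \<longrightarrow> s \<le> t \<longrightarrow> L s \<omega> \<le> L t \<omega>" and L0: "L 0 \<omega> = 0"
  shows "(\<integral>s. (if ereal t < lifetime L (\<omega>, s) then 1 else 0) \<partial>exp_law \<beta>) = disc 0 \<beta> t \<omega>"
proof -
  interpret Q: prob_space "exp_law \<beta>" by (rule prob_space_exp_law[OF \<beta>])
  have Lt: "0 \<le> L t \<omega>" using mono[rule_format, OF order_refl t] L0 by simp
  have iff: "ereal t < lifetime L (\<omega>, s) \<longleftrightarrow> L t \<omega> < s" if s: "s \<noteq> L t \<omega>" for s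
  proof
    assume less: "ereal t < lifetime L (\<omega>, s)"
    show "L t \<omega> < s"
    proof (rule ccontr)
      assume "\<not> L t \<omega> < s"
      then have "s < L t \<omega>" using s by simp
      then have "lifetime L (\<omega>, s) \<le> ereal t"
        unfolding lifetime_def prod.case using t by (intro Inf_lower) blast
      then show False using less by simp
    qed
  next
    assume lt: "L t \<omega> < s"
    \<comment> \<open>A margin is needed for the infimum to exceed \<open>t\<close> strictly:
      continuity and monotonicity keep \<open>L\<close> below \<open>s\<close> up to
      \<open>t + d / 2\<close>.\<close>
    obtain d where d: "0 < d" "\<And>u. 0 \<le> u \<Longrightarrow> dist u t < d \<Longrightarrow> dist (L u \<omega>) (L t \<omega>) < s - L t \<omega>"
      using L_continuous[OF \<omega>] t lt unfolding continuous_on_iff by (metis atLeast_iff diff_gt_0_iff_gt)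
    have "ereal (t + d / 2) \<le> lifetime L (\<omega>, s)"
      unfolding lifetime_def prod.case
    proof (rule Inf_greatest, safe)
      fix u assume u: "0 \<le> u" "s < L u \<omega>"
      have "t + d / 2 \<le> u"
      proof (rule ccontr)
        assume "\<not> t + d / 2 \<le> u"
        then have "L u \<omega> \<le> L (t + d / 2) \<omega>" by (intro mono[rule_format] u(1)) simp
        moreover have "dist (L (t + d / 2) \<omega>) (L t \<omega>) < s - L t \<omega>"
          using t d(1) by (intro d(2)) (auto simp: dist_real_def)
        ultimately show False using u(2) by (auto simp: dist_real_def)
      qed
      then show "ereal (t + d / 2) \<le> ereal u" by simp
    qed
    then show "ereal t < lifetime L (\<omega>, s)"
      by (rule less_le_trans[rotated]) (use d(1) in simp)
  qed
  have [measurable]: "(\<lambda>s. lifetime L (\<omega>, s)) \<in> borel_measurable (exp_law \<beta>)"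
    using \<omega> by (intro measurable_compose[OF measurable_Pair1' lifetime_measurable]) (simp add: space_P)
  have "(\<integral>s. (if ereal t < lifetime L (\<omega>, s) then 1 else 0) \<partial>exp_law \<beta>) = (\<integral>s. (indicator {L t \<omega><..} s :: real) \<partial>exp_law \<beta>)"
  proof (rule integral_cong_AE)
    show "AE s in exp_law \<beta>. (if ereal t < lifetime L (\<omega>, s) then 1 else 0) = (indicator {L t \<omega><..} s :: real)"
      using AE_exp_law_neq[of "L t \<omega>" \<beta>] by eventually_elim (simp add: iff indicator_def)
    show "(\<lambda>s. indicator {L t \<omega><..} s :: real) \<in> borel_measurable (exp_law \<beta>)"
      by (rule measurable_compose[OF id_measurable_exp_law]) simp
  qed measurable
  also have "\<dots> = measure (exp_law \<beta>) ({L t \<omega><..} \<inter> space (exp_law \<beta>))"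
    by simp
  also have "{L t \<omega><..} \<inter> space (exp_law \<beta>) = {L t \<omega><..}"
    using Lt by (auto simp: space_exp_law)
  finally show ?thesis
    using exp_law_gt[OF \<beta> Lt] Lt by (simp add: disc_def)
qed

text \<open>Fubini is used twice: to split the product law, and then to move the integral over
  \<open>S\<close> inside the time integral. For a fixed path and a fixed time, only the survival
  probability depends on \<open>S\<close>.\<close>

lemma elastic_resolvent_eq:
  assumes \<beta>: "0 < \<beta>" and \<alpha>: "0 < \<alpha>" and \<phi>: "continuous_on UNIV (\<lambda>y. f \<bar>y\<bar>)" "\<And>y. \<bar>f \<bar>y\<bar>\<bar> \<le> C"
  shows "elastic_resolvent P B L \<beta> \<alpha> f x =
    (\<integral>\<omega>. (LINT t:{0..}|lborel. disc \<alpha> \<beta> t \<omega> * f \<bar>B t \<omega>\<bar>) \<partial>P x)"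
proof -
  interpret Px: prob_space "P x" by (rule prob)
  interpret Q: prob_space "exp_law \<beta>" by (rule prob_space_exp_law[OF \<beta>])
  interpret PQ: pair_prob_space "P x" "exp_law \<beta>" ..
  interpret QL: pair_sigma_finite "exp_law \<beta>" "lborel :: real measure" ..
  let ?Q = "exp_law \<beta>" and ?e = "\<lambda>t. C * (indicator {0..} t * exp (- \<alpha> * t))"
  \<comment> \<open>Since functions vanish at the cemetery, killing becomes a factor
    \<open>0\<close> or \<open>1\<close>; \<open>max 0 t\<close> makes the integrand jointly
    measurable in all three variables.\<close>
  define k where "k \<omega> s t = indicator {0..} t * (exp (- \<alpha> * t) * (f \<bar>B (max 0 t) \<omega>\<bar> *
    (if ereal t < lifetime L (\<omega>, s) then 1 else 0)))" for \<omega> s t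
  have C0: "0 \<le> C" using \<phi>(2)[of 0] by linarith
  have k_le: "\<bar>k \<omega> s t\<bar> \<le> ?e t" for \<omega> s t
  proof -
    have "\<bar>f \<bar>B (max 0 t) \<omega>\<bar>\<bar> * \<bar>if ereal t < lifetime L (\<omega>, s) then 1 else 0\<bar> \<le> C * 1"
      using \<phi>(2)[of "B (max 0 t) \<omega>"] C0 by (intro mult_mono) auto
    then show ?thesis by (auto simp: k_def indicator_def abs_mult)
  qed
  have ei: "integrable lborel (\<lambda>t. ?e t)"
    using integrable_exp_decay[OF \<alpha>] by simp
  have [measurable]: "(\<lambda>y. f \<bar>y\<bar>) \<in> borel_measurable borel"
    using \<phi>(1) by (rule borel_measurable_continuous_onI)
  have [measurable]: "(\<lambda>p. B (max 0 (snd p)) (fst p)) \<in> borel_measurable (P x \<Otimes>\<^sub>M lborel)"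
    using measurable_pair_swap[OF B_joint_measurable] by (simp add: case_prod_unfold)
  have [measurable]: "(\<lambda>p. f \<bar>B (max 0 (snd p)) (fst p)\<bar>) \<in> borel_measurable (P x \<Otimes>\<^sub>M lborel)"
    by (rule measurable_compose[of "\<lambda>p. B (max 0 (snd p)) (fst p)" _ borel "\<lambda>y. f \<bar>y\<bar>"]) measurable
  have fB [measurable]: "(\<lambda>z. f \<bar>B (max 0 (snd z)) (fst (fst z))\<bar>) \<in> borel_measurable ((P x \<Otimes>\<^sub>M ?Q) \<Otimes>\<^sub>M lborel)"
  proof -
    have "(\<lambda>z. (fst (fst z), snd z)) \<in> (P x \<Otimes>\<^sub>M ?Q) \<Otimes>\<^sub>M lborel \<rightarrow>\<^sub>M P x \<Otimes>\<^sub>M lborel" by measurable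
    from measurable_compose[OF this \<open>(\<lambda>p. f \<bar>B (max 0 (snd p)) (fst p)\<bar>) \<in> borel_measurable (P x \<Otimes>\<^sub>M lborel)\<close>]
    show ?thesis by simp
  qed
  note [measurable] = lifetime_measurable[of x \<beta>]
  have mk: "(\<lambda>z. k (fst (fst z)) (snd (fst z)) (snd z)) \<in> borel_measurable ((P x \<Otimes>\<^sub>M ?Q) \<Otimes>\<^sub>M lborel)"
    unfolding k_def prod.collapse by measurable
  have mk2: "(\<lambda>(s, t). k \<omega> s t) \<in> borel_measurable (?Q \<Otimes>\<^sub>M lborel)" if "\<omega> \<in> space A" for \<omega>
  proof -
    have "(\<lambda>p. ((\<omega>, fst p), snd p)) \<in> ?Q \<Otimes>\<^sub>M lborel \<rightarrow>\<^sub>M (P x \<Otimes>\<^sub>M ?Q) \<Otimes>\<^sub>M lborel"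
      using that by (intro measurable_Pair measurable_compose[OF measurable_fst] measurable_const) (auto simp: space_P)
    from measurable_compose[OF this mk] show ?thesis by (simp add: case_prod_unfold)
  qed
  have "elastic_resolvent P B L \<beta> \<alpha> f x = (\<integral>p. (LBINT t. k (fst p) (snd p) t) \<partial>(P x \<Otimes>\<^sub>M ?Q))"
    unfolding elastic_resolvent_def resolvent_def elastic_prob_def set_lebesgue_integral_def k_def
    by (intro Bochner_Integration.integral_cong)
      (auto simp: elastic_bm_def extend_cemetery_def reflecting_bm_def indicator_def)
  also have "\<dots> = (\<integral>\<omega>. (\<integral>s. (LBINT t. k \<omega> s t) \<partial>?Q) \<partial>P x)"
  proof -
    have "integrable (P x \<Otimes>\<^sub>M ?Q) (\<lambda>p. LBINT t. k (fst p) (snd p) t)"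
    proof (rule PQ.integrable_const_bound[of _ "LBINT t. ?e t"])
      show "(\<lambda>p. LBINT t. k (fst p) (snd p) t) \<in> borel_measurable (P x \<Otimes>\<^sub>M ?Q)"
        using mk by (intro lborel.borel_measurable_lebesgue_integral) (simp add: case_prod_unfold)
      show "AE p in P x \<Otimes>\<^sub>M ?Q. norm (LBINT t. k (fst p) (snd p) t) \<le> (LBINT t. ?e t)"
      proof (rule AE_I2)
        fix p assume "p \<in> space (P x \<Otimes>\<^sub>M ?Q)"
        then have "(\<lambda>t. k (fst p) (snd p) t) \<in> borel_measurable lborel"
          using measurable_compose[OF measurable_Pair1' mk, of p] by simp
        then have "integrable lborel (\<lambda>t. k (fst p) (snd p) t)"
        proof (rule Bochner_Integration.integrable_bound[OF ei], intro AE_I2)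
          show "norm (k (fst p) (snd p) t) \<le> norm (?e t)" for t
            unfolding real_norm_def by (rule order_trans[OF k_le abs_ge_self])
        qed
        then show "norm (LBINT t. k (fst p) (snd p) t) \<le> (LBINT t. ?e t)"
          using ei k_le by (intro Bochner_Integration.integral_norm_bound_integral) auto
      qed
    qed
    from PQ.integral_fst'[OF this] show ?thesis by simp
  qed
  also have "\<dots> = (\<integral>\<omega>. (LBINT t. (\<integral>s. k \<omega> s t \<partial>?Q)) \<partial>P x)"
  proof (rule Bochner_Integration.integral_cong[OF refl])
    fix \<omega> assume "\<omega> \<in> space (P x)"
    then have \<omega>: "\<omega> \<in> space A" by (simp add: space_P)
    have "integrable (?Q \<Otimes>\<^sub>M lborel) (\<lambda>(s, t). k \<omega> s t)"
    proof (rule integrableI_bounded[OF mk2[OF \<omega>]])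
      have "(\<integral>\<^sup>+p. ennreal (norm (case p of (s, t) \<Rightarrow> k \<omega> s t)) \<partial>(?Q \<Otimes>\<^sub>M lborel)) \<le>
          (\<integral>\<^sup>+p. ennreal (?e (snd p)) \<partial>(?Q \<Otimes>\<^sub>M lborel))"
        using k_le by (intro nn_integral_mono ennreal_leI) (auto simp: case_prod_unfold)
      also have "\<dots> = (\<integral>\<^sup>+t. (\<integral>\<^sup>+s. ennreal (?e t) \<partial>?Q) \<partial>lborel)"
        by (subst QL.nn_integral_snd[symmetric]) auto
      also have "\<dots> = (\<integral>\<^sup>+t. ennreal (?e t) \<partial>lborel)"
        by (simp add: Q.emeasure_space_1)
      also have "\<dots> = ennreal (LBINT t. ?e t)"
        using C0 by (intro nn_integral_eq_integral[OF ei]) auto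
      also have "\<dots> < \<infinity>" by simp
      finally show "(\<integral>\<^sup>+p. ennreal (norm (case p of (s, t) \<Rightarrow> k \<omega> s t)) \<partial>(?Q \<Otimes>\<^sub>M lborel)) < \<infinity>" .
    qed
    from QL.Fubini_integral[OF this]
    show "(\<integral>s. (LBINT t. k \<omega> s t) \<partial>?Q) = (LBINT t. (\<integral>s. k \<omega> s t \<partial>?Q))" by simp
  qed
  also have "\<dots> = (\<integral>\<omega>. (LBINT t. indicator {0..} t * (disc \<alpha> \<beta> (max 0 t) \<omega> * f \<bar>B (max 0 t) \<omega>\<bar>)) \<partial>P x)"
  proof (rule integral_cong_AE)
    have "(\<lambda>p. case (fst p, snd p) of (\<omega>, t) \<Rightarrow> indicator {0..} t * (disc \<alpha> \<beta> (max 0 t) \<omega> * f \<bar>B (max 0 t) \<omega>\<bar>)) \<in> borel_measurable (P x \<Otimes>\<^sub>M lborel)"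
      using integrand_joint_measurable[OF \<phi>(1), of \<alpha> \<beta> x] by simp
    then show "(\<lambda>\<omega>. LBINT t. indicator {0..} t * (disc \<alpha> \<beta> (max 0 t) \<omega> * f \<bar>B (max 0 t) \<omega>\<bar>)) \<in> borel_measurable (P x)"
      by (intro lborel.borel_measurable_lebesgue_integral) (simp add: case_prod_unfold)
    have "(\<lambda>z. ((fst (fst z), snd z), snd (fst z))) \<in> (P x \<Otimes>\<^sub>M lborel) \<Otimes>\<^sub>M ?Q \<rightarrow>\<^sub>M (P x \<Otimes>\<^sub>M ?Q) \<Otimes>\<^sub>M lborel"
      by measurable
    from measurable_compose[OF this mk]
    show "(\<lambda>\<omega>. LBINT t. (\<integral>s. k \<omega> s t \<partial>?Q)) \<in> borel_measurable (P x)"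
      by (intro lborel.borel_measurable_lebesgue_integral) (simp add: case_prod_unfold Q.borel_measurable_lebesgue_integral)
    show "AE \<omega> in P x. (LBINT t. (\<integral>s. k \<omega> s t \<partial>?Q)) =
        (LBINT t. indicator {0..} t * (disc \<alpha> \<beta> (max 0 t) \<omega> * f \<bar>B (max 0 t) \<omega>\<bar>))"
      using AE_local_time_mono[of x] AE_local_time_0[of x] AE_space
    proof eventually_elim
      case (elim \<omega>)
      show ?case
      proof (rule Bochner_Integration.integral_cong[OF refl])
        fix t :: real
        show "(\<integral>s. k \<omega> s t \<partial>?Q) = indicator {0..} t * (disc \<alpha> \<beta> (max 0 t) \<omega> * f \<bar>B (max 0 t) \<omega>\<bar>)"
        proof (cases "0 \<le> t")
          case True
          have "disc \<alpha> \<beta> t \<omega> = exp (- \<alpha> * t) * disc 0 \<beta> t \<omega>"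
            by (simp add: disc_def exp_add[symmetric])
          then show ?thesis
            using survival_probability[OF \<beta> _ True elim(1,2)] elim(3) True by (simp add: k_def space_P)
        qed (simp add: k_def)
      qed
    qed
  qed
  also have "\<dots> = (\<integral>\<omega>. (LINT t:{0..}|lborel. disc \<alpha> \<beta> t \<omega> * f \<bar>B t \<omega>\<bar>) \<partial>P x)"
    unfolding set_lebesgue_integral_def
    by (intro Bochner_Integration.integral_cong refl) (auto simp: indicator_def max_def)
  finally show ?thesis .
qed

lemma reflecting_resolvent_eq:
  "reflecting_resolvent P B \<alpha> f x = (\<integral>\<omega>. (LINT t:{0..}|lborel. disc \<alpha> 0 t \<omega> * f \<bar>B t \<omega>\<bar>) \<partial>P x)"
  by (simp add: reflecting_resolvent_def resolvent_def reflecting_bm_def disc_def)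

text \<open>The same \<open>u\<close> is used twice: with \<open>\<beta> = 0\<close> the Feynman-Kac
  identity says that \<open>u\<close> is the reflecting resolvent at every starting point, in
  particular at \<open>0\<close>; with the given \<beta> it yields the elastic one.\<close>

lemma elastic_resolvent_formula:
  assumes \<beta>: "0 < \<beta>" and f: "f \<in> C0_nonneg" and \<alpha>: "0 < \<alpha>"
  shows "elastic_resolvent P B L \<beta> \<alpha> f x = reflecting_resolvent P B \<alpha> f x -
    \<beta> / (\<beta> + sqrt (2 * \<alpha>)) * exp (- sqrt (2 * \<alpha>) * \<bar>x\<bar>) * reflecting_resolvent P B \<alpha> f 0"
proof -
  obtain u where u: "\<And>\<beta>. 0 \<le> \<beta> \<Longrightarrow> \<exists>C M w w1 w2. resolvent_solution \<alpha> \<beta> C M (\<lambda>y. f \<bar>y\<bar>)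
    (\<lambda>y. u y - \<beta> / (\<beta> + sqrt (2 * \<alpha>)) * u 0 * exp (- sqrt (2 * \<alpha>) * \<bar>y\<bar>)) w w1 w2"
    by (rule resolvent_solution_exists[OF f \<alpha>]) blast
  obtain C where C: "\<And>y. \<bar>f \<bar>y\<bar>\<bar> \<le> C" using C0_nonneg_even_extension(2)[OF f] by blast
  have N: "reflecting_resolvent P B \<alpha> f y = u y" for y
    using u[of 0] feynman_kac[of \<alpha> 0] unfolding reflecting_resolvent_eq by fastforce
  have "elastic_resolvent P B L \<beta> \<alpha> f x =
      u x - \<beta> / (\<beta> + sqrt (2 * \<alpha>)) * u 0 * exp (- sqrt (2 * \<alpha>) * \<bar>x\<bar>)"
    using u[of \<beta>] \<beta> feynman_kac[of \<alpha> \<beta>]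
    unfolding elastic_resolvent_eq[OF \<beta> \<alpha> C0_nonneg_even_extension(1)[OF f] C] by fastforce
  then show ?thesis by (simp add: N)
qed

end

theorem corollary2p5:
  fixes A :: "'w measure"
    and P :: "real \<Rightarrow> 'w measure"
    and F :: "real \<Rightarrow> 'w measure"
    and B L :: "real \<Rightarrow> 'w \<Rightarrow> real"
    and \<theta> :: "real \<Rightarrow> 'w \<Rightarrow> 'w"
    and \<beta> \<alpha> x :: real
    and f :: "real \<Rightarrow> real"
  assumes "brownian_family A P F B \<theta>"
    and "local_time_at_0 A P F B L"
    and "\<beta> > 0"
    and "f \<in> C0_nonneg"
    and "\<alpha> > 0"
    and "x \<ge> 0"
  shows "elastic_resolvent P B L \<beta> \<alpha> f x =
           reflecting_resolvent P B \<alpha> f x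
           - \<beta> / (\<beta> + sqrt (2 * \<alpha>)) * exp (- sqrt (2 * \<alpha>) * x) * reflecting_resolvent P B \<alpha> f 0"
proof -
  interpret brownian_local_time A P F B \<theta> L
    using assms(1,2) by (intro brownian_local_time.intro brownian_local_time_axioms.intro)
  show ?thesis
    using elastic_resolvent_formula[OF assms(3,4,5), of x] assms(6) by simp
qed

end
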